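(* For every positive integer $k$, there are infinitely many lens spaces which admit an orientation-reversing diffeomorphism of order $2^k$ but no self-map of degree $-1$ of smaller order.
   Context: A lens space of dimension $2n-1$ with fundamental group $\mathbb{Z}/r$ is the quotient $L_r(k_1,\ldots,k_n)$ of the unit sphere $S^{2n-1}\subset\mathbb{C}^n$ by the free $\mathbb{Z}/r$-action generated by $(z_1,\ldots,z_n)\mapsto (e^{2\pi i k_1/r}z_1,\ldots,e^{2\pi i k_n/r}z_n)$, where all $k_j$ are integers coprime to $r$. Lens spaces of all odd dimensions are allowed. A self-map $f$ of a space has order $m$ if $m$ is the smallest positive integer with $f^m=\mathrm{id}$ ($m$-fold composition). *)

theory Defs
  imports "HOL-Homology.Homology" "HOL-Algebra.Elementary_Groups"
begin

section \<open>Quotient topology\<close>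

definition quotient_topology :: "'a topology \<Rightarrow> ('a \<Rightarrow> 'b) \<Rightarrow> 'b topology" where
  "quotient_topology X p =
     topology (\<lambda>U. U \<subseteq> p ` topspace X \<and> openin X {x \<in> topspace X. p x \<in> U})"

lemma openin_quotient_topology:
  "openin (quotient_topology X p) U \<longleftrightarrow>
     U \<subseteq> p ` topspace X \<and> openin X {x \<in> topspace X. p x \<in> U}"
proof -
  have "istopology (\<lambda>U. U \<subseteq> p ` topspace X \<and> openin X {x \<in> topspace X. p x \<in> U})"
    unfolding istopology_def
  proof (intro conjI allI impI; (elim conjE)?)
    fix S T
    assume "openin X {x \<in> topspace X. p x \<in> S}" "openin X {x \<in> topspace X. p x \<in> T}"
    moreover have "{x \<in> topspace X. p x \<in> S \<inter> T} =
        {x \<in> topspace X. p x \<in> S} \<inter> {x \<in> topspace X. p x \<in> T}" by auto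
    ultimately show "openin X {x \<in> topspace X. p x \<in> S \<inter> T}" by auto
  next
    fix \<K>
    assume "\<forall>K\<in>\<K>. K \<subseteq> p ` topspace X \<and> openin X {x \<in> topspace X. p x \<in> K}"
    moreover have "{x \<in> topspace X. p x \<in> \<Union>\<K>} = (\<Union>K\<in>\<K>. {x \<in> topspace X. p x \<in> K})"
      by auto
    ultimately show "openin X {x \<in> topspace X. p x \<in> \<Union>\<K>}" by auto
  qed auto
  then show ?thesis by (simp add: quotient_topology_def)
qed

lemma topspace_quotient_topology: "topspace (quotient_topology X p) = p ` topspace X"
proof (rule antisym)
  show "topspace (quotient_topology X p) \<subseteq> p ` topspace X"
    using iffD1[OF openin_quotient_topology openin_topspace, of X p] by (rule conjunct1)
  have "{x \<in> topspace X. p x \<in> p ` topspace X} = topspace X" by auto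
  then have "openin (quotient_topology X p) (p ` topspace X)"
    by (simp add: openin_quotient_topology)
  then show "p ` topspace X \<subseteq> topspace (quotient_topology X p)"
    by (rule openin_subset)
qed

lemma quotient_map_quotient_topology: "quotient_map X (quotient_topology X p) p"
  unfolding quotient_map_def topspace_quotient_topology openin_quotient_topology by blast


section \<open>Lens spaces\<close>

text \<open>A point of \<open>\<complex>\<^sup>n\<close> is a function \<^typ>\<open>nat \<Rightarrow> complex\<close> that vanishes at every index \<open>\<ge> n\<close>, so that the
  dimension can vary inside a statement. The type carries the product topology, which induces the
  usual topology on \<open>\<complex>\<^sup>n\<close>. The coordinates \<open>z\<^sub>1, \<dots>, z\<^sub>n\<close> are \<open>z 0, \<dots>, z (n - 1)\<close>.\<close>

definition complex_space :: "nat \<Rightarrow> (nat \<Rightarrow> complex) set" where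
  "complex_space n = {z. \<forall>j\<ge>n. z j = 0}"

definition complex_sphere :: "nat \<Rightarrow> (nat \<Rightarrow> complex) set" where
  "complex_sphere n = {z \<in> complex_space n. (\<Sum>j<n. (cmod (z j))\<^sup>2) = 1}"

definition lens_parameters :: "nat \<Rightarrow> int list \<Rightarrow> bool" where
  "lens_parameters r ks \<longleftrightarrow> r > 0 \<and> ks \<noteq> [] \<and> (\<forall>k\<in>set ks. coprime k (int r))"

definition lens_rotation :: "nat \<Rightarrow> int list \<Rightarrow> (nat \<Rightarrow> complex) \<Rightarrow> nat \<Rightarrow> complex" where
  "lens_rotation r ks z =
     (\<lambda>j. if j < length ks then exp (2 * pi * \<i> * of_int (ks ! j) / of_nat r) * z j else 0)"

text \<open>The rotation has finite order, so its nonnegative powers already give the whole orbit.\<close>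

definition lens_orbit :: "nat \<Rightarrow> int list \<Rightarrow> (nat \<Rightarrow> complex) \<Rightarrow> (nat \<Rightarrow> complex) set" where
  "lens_orbit r ks z = range (\<lambda>m::nat. (lens_rotation r ks ^^ m) z)"

definition lens_space :: "nat \<Rightarrow> int list \<Rightarrow> (nat \<Rightarrow> complex) set topology" where
  "lens_space r ks = quotient_topology (top_of_set (complex_sphere (length ks))) (lens_orbit r ks)"


section \<open>Smooth maps and diffeomorphisms\<close>

text \<open>\<open>C_k k n U f\<close>: the function \<open>f\<close> is \<open>k\<close> times continuously differentiable in the real sense on the
  open subset \<open>U\<close> of \<open>\<complex>\<^sup>n = \<real>\<^sup>2\<^sup>n\<close>. The real coordinate directions are \<open>1\<close> and \<open>\<i>\<close> in
  each of the \<open>n\<close> complex coordinates, and \<open>g\<close> is the partial derivative in the given direction.\<close>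

fun C_k :: "nat \<Rightarrow> nat \<Rightarrow> (nat \<Rightarrow> complex) set \<Rightarrow> ((nat \<Rightarrow> complex) \<Rightarrow> complex) \<Rightarrow> bool" where
  "C_k 0 n U f \<longleftrightarrow> continuous_on U f"
| "C_k (Suc k) n U f \<longleftrightarrow> continuous_on U f \<and>
     (\<forall>j<n. \<forall>e\<in>{1, \<i>}. \<exists>g. C_k k n U g \<and>
        (\<forall>z\<in>U. ((\<lambda>t::real. f (z(j := z j + of_real t * e))) has_vector_derivative g z) (at 0)))"

text \<open>Smoothness on an arbitrary subset \<open>A\<close> of \<open>\<complex>\<^sup>n\<close>: near every point of \<open>A\<close> the map extends to a
  \<open>C\<^sup>\<infinity>\<close> map on an open subset of \<open>\<complex>\<^sup>n\<close>. For subsets of the sphere this is smoothness for the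
  submanifold structure.\<close>

definition smooth_on_subset ::
  "nat \<Rightarrow> (nat \<Rightarrow> complex) set \<Rightarrow> ((nat \<Rightarrow> complex) \<Rightarrow> nat \<Rightarrow> complex) \<Rightarrow> bool" where
  "smooth_on_subset n A F \<longleftrightarrow>
     (\<forall>z\<in>A. \<exists>U G. openin (top_of_set (complex_space n)) U \<and> z \<in> U \<and>
        (\<forall>j k. C_k k n U (\<lambda>w. G w j)) \<and> (\<forall>w\<in>U \<inter> A. G w = F w))"

text \<open>The action on the sphere is free, and the smooth structure of the lens space is the one that
  makes the orbit projection a local diffeomorphism. Hence a self-map is smooth iff, locally on
  the sphere, it is covered by smooth maps into the sphere.\<close>

definition lens_smooth_map ::
  "nat \<Rightarrow> int list \<Rightarrow> ((nat \<Rightarrow> complex) set \<Rightarrow> (nat \<Rightarrow> complex) set) \<Rightarrow> bool" where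
  "lens_smooth_map r ks f \<longleftrightarrow>
     (let n = length ks; S = complex_sphere n in
      \<forall>z\<in>S. \<exists>U F. openin (top_of_set S) U \<and> z \<in> U \<and> F ` U \<subseteq> S \<and> smooth_on_subset n U F \<and>
        (\<forall>w\<in>U. f (lens_orbit r ks w) = lens_orbit r ks (F w)))"

definition lens_diffeomorphism ::
  "nat \<Rightarrow> int list \<Rightarrow> ((nat \<Rightarrow> complex) set \<Rightarrow> (nat \<Rightarrow> complex) set) \<Rightarrow> bool" where
  "lens_diffeomorphism r ks f \<longleftrightarrow>
     (\<exists>g. homeomorphic_maps (lens_space r ks) (lens_space r ks) f g \<and>
        lens_smooth_map r ks f \<and> lens_smooth_map r ks g)"


section \<open>Degree, orientation and order of self-maps\<close>

definition fundamental_class :: "nat \<Rightarrow> 'a topology \<Rightarrow> 'a chain set \<Rightarrow> bool" where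
  "fundamental_class d X a \<longleftrightarrow> a \<in> carrier (homology_group (int d) X) \<and>
     (\<lambda>m::int. a [^]\<^bsub>homology_group (int d) X\<^esub> m) \<in> iso integer_group (homology_group (int d) X)"

text \<open>The two fundamental classes of a closed connected orientable \<open>d\<close>-manifold differ by a sign, so
  the degree of a self-map does not depend on the choice between them.\<close>

definition has_degree :: "nat \<Rightarrow> 'a topology \<Rightarrow> ('a \<Rightarrow> 'a) \<Rightarrow> int \<Rightarrow> bool" where
  "has_degree d X f e \<longleftrightarrow> continuous_map X X f \<and>
     (\<exists>a. fundamental_class d X a \<and>
        hom_induced (int d) X {} X {} f a = a [^]\<^bsub>homology_group (int d) X\<^esub> e)"

text \<open>Orientations are fundamental classes, so a homeomorphism reverses orientation iff it sends
  the fundamental class to its negative.\<close>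

definition orientation_reversing :: "nat \<Rightarrow> 'a topology \<Rightarrow> ('a \<Rightarrow> 'a) \<Rightarrow> bool" where
  "orientation_reversing d X f \<longleftrightarrow> homeomorphic_map X X f \<and>
     (\<exists>a. fundamental_class d X a \<and>
        hom_induced (int d) X {} X {} f a = inv\<^bsub>homology_group (int d) X\<^esub> a)"

text \<open>Only the values of \<open>f\<close> on the points of the space matter.\<close>

definition has_order :: "'a topology \<Rightarrow> ('a \<Rightarrow> 'a) \<Rightarrow> nat \<Rightarrow> bool" where
  "has_order X f m \<longleftrightarrow> m > 0 \<and> (\<forall>x\<in>topspace X. (f ^^ m) x = x) \<and>
     (\<forall>l. 0 < l \<and> l < m \<longrightarrow> \<not> (\<forall>x\<in>topspace X. (f ^^ l) x = x))"

end

theory Submission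
  imports Defs "HOL-Analysis.Analysis" "HOL-Number_Theory.Number_Theory" "HOL-Combinatorics.Permutations"
begin

text \<open>Let \<open>k \<ge> 1\<close>, put \<open>h = 2 ^ (k - 1)\<close> and let \<open>p\<close> be a prime divisor of \<open>2 ^ h + 1\<close>, so that \<open>2\<close> has
  order \<open>2 ^ k\<close> modulo \<open>p\<close>. For every odd \<open>m > 1\<close> take the lens space with fundamental group of
  order \<open>p\<close>, with \<open>n = h m\<close> coordinates and with the weights \<open>1, 2, 4, \<dots>, 2 ^ (n - 1)\<close>. Different \<open>m\<close>
  give different dimensions, hence spaces that are not homeomorphic.

  The real-linear map \<open>F (z\<^sub>1, \<dots>, z\<^sub>n) = (z\<^sub>2, \<dots>, z\<^sub>n, cnj z\<^sub>1)\<close> of the sphere has degree \<open>-1\<close> and order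
  \<open>2 n\<close>. Each weight is the double of the one before, and \<open>2 ^ n\<close> is \<open>-1\<close> modulo \<open>p\<close>; therefore
  \<open>F \<rho> = \<rho>\<^sup>2 F\<close> for the rotation \<open>\<rho>\<close>. So the power \<open>F ^^ m\<close> descends to a diffeomorphism of the lens
  space. It reverses the orientation since \<open>m\<close> is odd, and it has order \<open>2 ^ k\<close>
  (\<open>orientation_reversing_diffeomorphism_of_order\<close>).

  Conversely, let \<open>g\<close> be a self-map of the lens space with degree \<open>-1\<close> and order \<open>l\<close>. It lifts to a
  self-map \<open>G\<close> of the sphere, also of degree \<open>-1\<close>, with \<open>G \<rho> = \<rho> ^^ b \<circ> G\<close> for some \<open>b\<close>, and \<open>b ^ l\<close> is
  \<open>1\<close> modulo \<open>p\<close>. If \<open>l < 2 ^ k\<close>, then an odd power of \<open>G\<close> has a twist whose order divides \<open>h\<close>, and such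
  a residue is an even power of \<open>2\<close>. After composition with an even power of \<open>F\<close> there results a map
  of degree \<open>-1\<close> that commutes with \<open>\<rho>\<close>. But a map that commutes with \<open>\<rho>\<close> has degree \<open>1\<close> modulo \<open>p\<close>
  (\<open>degree_of_equivariant_map\<close>), and \<open>p\<close> is odd
  (\<open>no_degree_minus_one_self_map_of_small_order\<close>).

  What remains is homological. The singular chains of the sphere form a complex of free modules over
  the group ring of the cyclic group generated by \<open>\<rho>\<close>, and the chains of the lens space are its
  coinvariants, because simplices lift, uniquely up to \<open>\<rho>\<close>. Over this group ring the operators
  \<open>T = 1 - \<rho>\<close> and \<open>N = 1 + \<rho> + \<rho>\<^sup>2 + \<dots>\<close> are exact against each other, which turns all the
  arguments that usually need spectral sequences or obstruction theory into short chases. Together with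
  the vanishing of the homology of the lens space in large degrees, which holds since it has a finite
  good cover, they show that the top homology of the lens space is infinite cyclic and that the
  orbit projection is nonzero on it. So the degree of a self-map is the degree of any lift
  (\<open>degree_of_lift\<close>).\<close>

section \<open>Chain complexes with a free cyclic group action\<close>

text \<open>The abstract setting of the chases: \<open>T\<close> and \<open>N\<close> stand for multiplication by \<open>1 - \<rho>\<close> and by the sum of
  all powers of \<open>\<rho>\<close> on a complex of free modules over the group ring of a finite cyclic group. Their
  mutual exactness is all that is used of freeness, and it makes the setting symmetric in \<open>T\<close> and \<open>N\<close>.
  The elements are those of an ambient type, since the singular chains of all dimensions share one type.\<close>

locale periodic_complex =
  fixes C :: "nat \<Rightarrow> 'c::ab_group_add set" and D T N :: "nat \<Rightarrow> 'c \<Rightarrow> 'c"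
  assumes C_0: "0 \<in> C p" and C_diff: "\<lbrakk>a \<in> C p; b \<in> C p\<rbrakk> \<Longrightarrow> a - b \<in> C p"
    and D_add: "D p (a + b) = D p a + D p b"
    and T_add: "T p (a + b) = T p a + T p b"
    and N_add: "N p (a + b) = N p a + N p b"
    and D_in: "a \<in> C (Suc p) \<Longrightarrow> D (Suc p) a \<in> C p"
    and T_in: "a \<in> C p \<Longrightarrow> T p a \<in> C p"
    and N_in: "a \<in> C p \<Longrightarrow> N p a \<in> C p"
    and D_D: "a \<in> C (Suc p) \<Longrightarrow> D p (D (Suc p) a) = 0"
    and D_T: "a \<in> C (Suc p) \<Longrightarrow> D (Suc p) (T (Suc p) a) = T p (D (Suc p) a)"
    and D_N: "a \<in> C (Suc p) \<Longrightarrow> D (Suc p) (N (Suc p) a) = N p (D (Suc p) a)"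
    and T_N: "a \<in> C p \<Longrightarrow> T p (N p a) = 0"
    and N_T: "a \<in> C p \<Longrightarrow> N p (T p a) = 0"
    and ker_T: "\<lbrakk>a \<in> C p; T p a = 0\<rbrakk> \<Longrightarrow> \<exists>b\<in>C p. a = N p b"
    and ker_N: "\<lbrakk>a \<in> C p; N p a = 0\<rbrakk> \<Longrightarrow> \<exists>b\<in>C p. a = T p b"
begin

lemma swap: "periodic_complex C D N T"
  by unfold_locales
    (auto intro: C_0 C_diff D_in T_in N_in D_D T_N N_T ker_T ker_N simp: D_add T_add N_add D_T D_N)

lemma D_diff: "D p (a - b) = D p a - D p b"
  using D_add[of p "a - b" b] by (simp add: algebra_simps)

lemma T_diff: "T p (a - b) = T p a - T p b"
  using T_add[of p "a - b" b] by (simp add: algebra_simps)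

lemma N_diff: "N p (a - b) = N p a - N p b"
  using N_add[of p "a - b" b] by (simp add: algebra_simps)

lemma D_zero: "D p 0 = 0"
  using D_add[of p 0 0] by simp

definition acyclic_at :: "nat \<Rightarrow> bool" where
  "acyclic_at p \<longleftrightarrow> (\<forall>c\<in>C p. D p c = 0 \<longrightarrow> (\<exists>u\<in>C (Suc p). c = D (Suc p) u))"

text \<open>The homology of the quotient complex by the image of \<open>T\<close> vanishes at \<open>p\<close>, expressed by
  representatives. It is used for \<open>p > 0\<close>.\<close>

definition quotient_acyclic_at :: "nat \<Rightarrow> bool" where
  "quotient_acyclic_at p \<longleftrightarrow> (\<forall>c\<in>C p. (\<exists>e\<in>C (p - 1). D p c = T (p - 1) e) \<longrightarrow>
     (\<exists>u\<in>C (Suc p). \<exists>w\<in>C p. c = D (Suc p) u + T p w))"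

end

context periodic_complex
begin

interpretation swapped: periodic_complex C D N T
  by (rule swap)

text \<open>The short exact sequence that \<open>T\<close> and \<open>N\<close> produce identifies the quotient by \<open>N\<close> with the image of
  \<open>T\<close>. Where the complex itself is acyclic, the connecting homomorphism maps the homology of the
  quotient by \<open>T\<close> at \<open>Suc p\<close> onto the homology of this image at \<open>p\<close>. With the roles of \<open>T\<close> and \<open>N\<close>
  exchanged the step can be repeated, and this is the periodicity of the homology of cyclic groups.\<close>

lemma quotient_acyclic_at_descend:
  assumes quot: "quotient_acyclic_at (Suc p)" and ac: "acyclic_at p" and "p > 0"
  shows "swapped.quotient_acyclic_at p"
  unfolding swapped.quotient_acyclic_at_def
proof (intro ballI impI)
  fix c assume c: "c \<in> C p" and "\<exists>e\<in>C (p - 1). D p c = N (p - 1) e"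
  then obtain e where e: "e \<in> C (p - 1)" "D p c = N (p - 1) e" by blast
  obtain q where q: "p = Suc q" using \<open>p > 0\<close> gr0_implies_Suc by blast
  have "D p (T p c) = 0"
    using D_T[of c q] c e T_N[of e q] by (simp add: q)
  then obtain u where u: "u \<in> C (Suc p)" "T p c = D (Suc p) u"
    using ac T_in[OF c] by (auto simp: acyclic_at_def)
  have "\<exists>e\<in>C (Suc p - 1). D (Suc p) u = T (Suc p - 1) e"
    using c u(2) by (intro bexI[of _ c]) auto
  then obtain v w where v: "v \<in> C (Suc (Suc p))" and w: "w \<in> C (Suc p)"
    and uvw: "u = D (Suc (Suc p)) v + T (Suc p) w"
    using quot u(1) unfolding quotient_acyclic_at_def by blast
  have "T p c = T p (D (Suc p) w)"
    using u(2) D_D[OF v] D_T[OF w] by (simp add: uvw D_add)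
  then obtain b where "b \<in> C p" "c - D (Suc p) w = N p b"
    using ker_T[of "c - D (Suc p) w" p] c D_in[OF w] C_diff by (auto simp: T_diff)
  then show "\<exists>u\<in>C (Suc p). \<exists>w\<in>C p. c = D (Suc p) u + N p w"
    using w by (metis diff_add_cancel add.commute)
qed

definition alt :: "nat \<Rightarrow> nat \<Rightarrow> 'c \<Rightarrow> 'c" where
  "alt i = (if even i then T else N)"

text \<open>A zigzag is the part up to degree \<open>m\<close> of a map from the periodic free resolution of the cyclic group,
  recorded by the images of the generators.\<close>

definition zigzag :: "(nat \<Rightarrow> 'c) \<Rightarrow> nat \<Rightarrow> bool" where
  "zigzag c m \<longleftrightarrow> (\<forall>i\<le>m. c i \<in> C i) \<and> (\<forall>i<m. D (Suc i) (c (Suc i)) = alt i i (c i))"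

lemma alt_in: "a \<in> C p \<Longrightarrow> alt i p a \<in> C p"
  by (simp add: alt_def T_in N_in)

lemma alt_diff: "alt i p (a - b) = alt i p a - alt i p b"
  by (simp add: alt_def T_diff N_diff)

lemma alt_add: "alt i p (a + b) = alt i p a + alt i p b"
  by (simp add: alt_def T_add N_add)

lemma D_alt: "a \<in> C (Suc p) \<Longrightarrow> D (Suc p) (alt i (Suc p) a) = alt i p (D (Suc p) a)"
  by (simp add: alt_def D_T D_N)

lemma alt_alt: "a \<in> C p \<Longrightarrow> alt (Suc i) p (alt i p a) = 0" "a \<in> C p \<Longrightarrow> alt i p (alt (Suc i) p a) = 0"
  by (auto simp: alt_def T_N N_T)

lemma ker_alt: "\<lbrakk>a \<in> C p; alt i p a = 0\<rbrakk> \<Longrightarrow> \<exists>b\<in>C p. a = alt (Suc i) p b"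
  by (auto simp: alt_def ker_T ker_N split: if_splits)

lemma alt_Suc_Suc: "alt (Suc (Suc i)) = alt i"
  by (simp add: alt_def)

lemma zigzag_exists:
  assumes "c0 \<in> C 0" and "\<exists>u\<in>C 1. T 0 c0 = D 1 u"
    and "\<And>i. \<lbrakk>0 < i; i < m\<rbrakk> \<Longrightarrow> acyclic_at i"
  shows "\<exists>c. c 0 = c0 \<and> zigzag c m"
  using assms(3)
proof (induction m)
  case 0
  show ?case
    using assms(1) by (intro exI[of _ "\<lambda>_. c0"]) (simp add: zigzag_def)
next
  case (Suc m)
  then obtain c where c: "c 0 = c0" "zigzag c m" by force
  then have cm: "c m \<in> C m" by (simp add: zigzag_def)
  have "\<exists>u\<in>C (Suc m). alt m m (c m) = D (Suc m) u"
  proof (cases m)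
    case 0
    then show ?thesis using assms(2) c by (simp add: alt_def)
  next
    case (Suc k)
    have "D (Suc k) (c (Suc k)) = alt k k (c k)" "c k \<in> C k"
      using c(2) by (auto simp: zigzag_def Suc)
    then have "D m (alt m m (c m)) = 0"
      using cm by (simp add: Suc D_alt alt_alt)
    then show ?thesis
      using Suc.prems[of m] Suc alt_in[OF cm, of m] by (auto simp: acyclic_at_def)
  qed
  then obtain u where "u \<in> C (Suc m)" "alt m m (c m) = D (Suc m) u" by blast
  then have "zigzag (c(Suc m := u)) (Suc m)"
    using c(2) by (auto simp: zigzag_def le_Suc_eq less_Suc_eq)
  moreover have "(c(Suc m := u)) 0 = c0" using c(1) by simp
  ultimately show ?case by blast
qed

lemma zigzag_descend_step:
  assumes z: "zigzag c (Suc m)" and y: "y \<in> C (Suc m)" "D (Suc m) y = 0"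
    and u: "u \<in> C (Suc (Suc m))" and w: "w \<in> C (Suc m)"
    and eq: "c (Suc m) = y + D (Suc (Suc m)) u + alt m (Suc m) w"
  shows "\<exists>u\<in>C (Suc m). \<exists>w\<in>C m. c m = D (Suc m) u + alt (Suc m) m w"
proof -
  have cm: "c m \<in> C m" and "D (Suc m) (c (Suc m)) = alt m m (c m)"
    using z by (auto simp: zigzag_def)
  then have "alt m m (c m) = alt m m (D (Suc m) w)"
    using y w D_D[OF u] by (simp add: eq D_add D_alt)
  then obtain b where "b \<in> C m" "c m - D (Suc m) w = alt (Suc m) m b"
    using ker_alt[of "c m - D (Suc m) w" m m] cm D_in[OF w] C_diff by (auto simp: alt_diff)
  then show ?thesis
    using w by (metis diff_add_cancel add.commute)
qed

text \<open>If the last entry is trivial in the quotient, up to a cycle of the complex, then exactness cancels the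
  operators one after the other. What it gives for the first entry can be refuted by an augmentation.\<close>

lemma zigzag_descend:
  assumes "zigzag c (Suc m)" and "y \<in> C (Suc m)" "D (Suc m) y = 0"
    and "u \<in> C (Suc (Suc m))" and "w \<in> C (Suc m)"
    and "c (Suc m) = y + D (Suc (Suc m)) u + alt m (Suc m) w"
  shows "\<exists>u\<in>C 1. \<exists>w\<in>C 0. c 0 = D 1 u + N 0 w"
  using assms
proof (induction m arbitrary: y u w)
  case 0
  show ?case using zigzag_descend_step[OF "0.prems"] by (simp add: alt_def)
next
  case (Suc m)
  obtain u w where "u\<in>C (Suc (Suc m))" "w\<in>C (Suc m)"
    and "c (Suc m) = 0 + D (Suc (Suc m)) u + alt m (Suc m) w"
    using zigzag_descend_step[OF Suc.prems] by (auto simp: alt_Suc_Suc)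
  moreover have "zigzag c (Suc m)" using Suc.prems(1) by (auto simp: zigzag_def)
  ultimately show ?case using C_0 D_zero by (intro Suc.IH)
qed

text \<open>Two lifts of the same map to a free resolution are homotopic: \<open>e\<close> comes from the homotopy, and in the
  top degree, where the complex may have homology, the cycle \<open>y\<close> is left over.\<close>

lemma zigzag_compare:
  assumes "zigzag c (Suc m)" "zigzag c' (Suc m)" and "\<exists>u\<in>C 1. c 0 - c' 0 = D 1 u"
    and "\<And>i. \<lbrakk>0 < i; i \<le> m\<rbrakk> \<Longrightarrow> acyclic_at i"
  shows "\<exists>y\<in>C (Suc m). \<exists>e\<in>C (Suc m). D (Suc m) y = 0 \<and> c (Suc m) - c' (Suc m) = y + alt m (Suc m) e"
  using assms(1,2,4)
proof (induction m)
  case 0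
  obtain u where u: "u \<in> C 1" "c 0 - c' 0 = D 1 u" using assms(3) by blast
  have "D 1 (c 1 - c' 1) = T 0 (D 1 u)"
    using "0.prems"(1,2) unfolding u(2)[symmetric] by (simp add: zigzag_def alt_def D_diff T_diff)
  then have "D 1 (c 1 - c' 1 - T 1 u) = 0"
    using D_T[of u 0] u(1) by (simp add: D_diff)
  moreover have "c 1 - c' 1 - T 1 u \<in> C 1"
    using "0.prems"(1,2) u(1) by (intro C_diff T_in) (auto simp: zigzag_def)
  ultimately show ?case
    using u(1) by (intro bexI[of _ "c 1 - c' 1 - T 1 u"] bexI[of _ u]) (auto simp: alt_def)
next
  case (Suc m)
  have "zigzag c (Suc m)" "zigzag c' (Suc m)" using Suc.prems by (auto simp: zigzag_def)
  then obtain y e where y: "y \<in> C (Suc m)" "D (Suc m) y = 0" and e: "e \<in> C (Suc m)"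
    and eq: "c (Suc m) - c' (Suc m) = y + alt m (Suc m) e"
    using Suc.IH Suc.prems(3) by force
  obtain u where u: "u \<in> C (Suc (Suc m))" "y = D (Suc (Suc m)) u"
    using Suc.prems(3)[of "Suc m"] y by (auto simp: acyclic_at_def)
  let ?z = "c (Suc (Suc m)) - c' (Suc (Suc m)) - alt (Suc m) (Suc (Suc m)) u"
  have "D (Suc (Suc m)) (c (Suc (Suc m)) - c' (Suc (Suc m)))
      = alt (Suc m) (Suc m) (c (Suc m) - c' (Suc m))"
    using Suc.prems(1,2) by (simp add: zigzag_def D_diff alt_diff)
  also have "\<dots> = D (Suc (Suc m)) (alt (Suc m) (Suc (Suc m)) u)"
    using u e y(1) by (simp add: eq alt_add alt_alt D_alt)
  finally have "D (Suc (Suc m)) ?z = 0" by (simp add: D_diff)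
  moreover have "?z \<in> C (Suc (Suc m))"
    using Suc.prems(1,2) u(1) by (intro C_diff alt_in) (auto simp: zigzag_def)
  ultimately show ?case
    using u(1) by (intro bexI[of _ ?z] bexI[of _ u]) auto
qed

end

section \<open>The rotation of the sphere\<close>

lemma continuous_on_coordinate [continuous_intros]:
  "continuous_on A (\<lambda>z::nat \<Rightarrow> 'b::topological_space. z j)"
  by (rule continuous_on_product_then_coordinatewise) (rule continuous_on_id)

definition L2_dist :: "nat \<Rightarrow> (nat \<Rightarrow> complex) \<Rightarrow> (nat \<Rightarrow> complex) \<Rightarrow> real" where
  "L2_dist n z w = L2_set (\<lambda>j. cmod (z j - w j)) {..<n}"

lemma L2_dist_self [simp]: "L2_dist n z z = 0"
  by (simp add: L2_dist_def L2_set_def)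

lemma L2_dist_commute: "L2_dist n z w = L2_dist n w z"
  by (simp add: L2_dist_def norm_minus_commute)

lemma L2_dist_triangle: "L2_dist n z w \<le> L2_dist n z v + L2_dist n v w"
proof -
  have "cmod (z j - w j) \<le> cmod (z j - v j) + cmod (v j - w j)" for j
    by (metis diff_add_cancel add_diff_eq norm_triangle_ineq)
  then have "L2_dist n z w \<le> L2_set (\<lambda>j. cmod (z j - v j) + cmod (v j - w j)) {..<n}"
    unfolding L2_dist_def by (intro L2_set_mono) auto
  also have "\<dots> \<le> L2_dist n z v + L2_dist n v w"
    unfolding L2_dist_def by (rule L2_set_triangle_ineq)
  finally show ?thesis .
qed

lemma coordinate_le_L2_dist: "j < n \<Longrightarrow> cmod (z j - w j) \<le> L2_dist n z w"
  unfolding L2_dist_def by (rule member_le_L2_set[where f = "\<lambda>j. cmod (z j - w j)"]) auto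

lemma continuous_on_L2_dist: "continuous_on A (L2_dist n a)"
  unfolding L2_dist_def L2_set_def by (intro continuous_intros)

lemma continuous_imp_eventually_L2_dist:
  assumes "continuous_on K \<phi>" "x \<in> K" "e > 0"
  shows "\<forall>\<^sub>F y in at x within K. L2_dist n (\<phi> x) (\<phi> y) < e"
proof -
  have "continuous_on K (\<lambda>y. L2_dist n (\<phi> x) (\<phi> y))"
    using continuous_on_compose2[OF continuous_on_L2_dist assms(1)] by blast
  then have "((\<lambda>y. L2_dist n (\<phi> x) (\<phi> y)) \<longlongrightarrow> L2_dist n (\<phi> x) (\<phi> x)) (at x within K)"
    using assms(2) unfolding continuous_on_def by blast
  from order_tendstoD(2)[OF this, of e] show ?thesis
    using assms(3) by simp
qed

lemma continuous_on_if_eventually_L2_dist: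
  assumes im: "\<And>x. x \<in> K \<Longrightarrow> \<phi> x \<in> complex_space n"
    and ev: "\<And>x e. \<lbrakk>x \<in> K; e > 0\<rbrakk> \<Longrightarrow> \<forall>\<^sub>F y in at x within K. L2_dist n (\<phi> x) (\<phi> y) < e"
  shows "continuous_on K \<phi>"
proof (rule continuous_on_coordinatewise_then_product)
  fix j
  show "continuous_on K (\<lambda>x. \<phi> x j)"
  proof (cases "j < n")
    case False
    then have "\<phi> x j = 0" if "x \<in> K" for x
      using im[OF that] by (simp add: complex_space_def)
    then show ?thesis by (simp cong: continuous_on_cong)
  next
    case True
    show ?thesis
      unfolding continuous_on_def
    proof (intro ballI tendstoI)
      fix x and e :: real assume "x \<in> K" "e > 0"
      from ev[OF this] show "\<forall>\<^sub>F y in at x within K. dist (\<phi> y j) (\<phi> x j) < e"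
        by (rule eventually_mono)
          (metis True coordinate_le_L2_dist dist_commute dist_norm order_le_less_trans)
    qed
  qed
qed

lemma L2_dist_0_sphere: "z \<in> complex_sphere n \<Longrightarrow> L2_dist n z (\<lambda>_. 0) = 1"
  by (simp add: complex_sphere_def L2_dist_def L2_set_def)

locale lens_action =
  fixes r :: nat and ks :: "int list"
  assumes params: "lens_parameters r ks"
begin

abbreviation n :: nat where "n \<equiv> length ks"
abbreviation S :: "(nat \<Rightarrow> complex) set" where "S \<equiv> complex_sphere n"
abbreviation \<rho> :: "(nat \<Rightarrow> complex) \<Rightarrow> nat \<Rightarrow> complex" where "\<rho> \<equiv> lens_rotation r ks"
abbreviation q :: "(nat \<Rightarrow> complex) \<Rightarrow> (nat \<Rightarrow> complex) set" where "q \<equiv> lens_orbit r ks"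
abbreviation L :: "(nat \<Rightarrow> complex) set topology" where "L \<equiv> lens_space r ks"

definition \<omega> :: "nat \<Rightarrow> complex" where
  "\<omega> j = exp (2 * pi * \<i> * of_int (ks ! j) / of_nat r)"

lemma r_pos: "r > 0" and n_pos: "n > 0"
  using params by (auto simp: lens_parameters_def)

lemma \<omega>_power_eq_1_iff: "j < n \<Longrightarrow> \<omega> j ^ m = 1 \<longleftrightarrow> r dvd m"
proof -
  assume "j < n"
  then have "ks ! j \<in> set ks" by simp
  then have cop: "coprime (int r) (ks ! j)"
    using params by (auto simp: lens_parameters_def coprime_commute)
  have "\<omega> j ^ m = exp (of_nat m * (2 * pi * \<i> * of_int (ks ! j) / of_nat r))"
    unfolding \<omega>_def by (rule exp_of_nat_mult[symmetric])
  also have "\<dots> = 1 \<longleftrightarrow> (\<exists>i::int. of_nat m * (2 * pi * real_of_int (ks ! j) / real r) = of_int (2 * i) * pi)"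
    unfolding exp_eq_1 by simp
  also have "\<dots> \<longleftrightarrow> (\<exists>i::int. real_of_int (int m * ks ! j) = real_of_int (i * int r))"
    using r_pos by (intro ex_cong1) (auto simp: field_simps)
  also have "\<dots> \<longleftrightarrow> (\<exists>i::int. int m * ks ! j = i * int r)"
    by (simp only: of_int_eq_iff)
  also have "\<dots> \<longleftrightarrow> int r dvd int m * ks ! j"
    by (auto simp: dvd_def mult.commute)
  also have "\<dots> \<longleftrightarrow> int r dvd int m"
    using cop by (simp add: coprime_dvd_mult_left_iff)
  finally show ?thesis by simp
qed

lemma norm_\<omega> [simp]: "cmod (\<omega> j) = 1"
  by (simp add: \<omega>_def)

lemma rot_eq: "\<rho> z = (\<lambda>j. if j < n then \<omega> j * z j else 0)"
  by (simp add: lens_rotation_def \<omega>_def cong: if_cong)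

lemma rot_power: "z \<in> complex_space n \<Longrightarrow> (\<rho> ^^ m) z = (\<lambda>j. if j < n then \<omega> j ^ m * z j else 0)"
  by (induction m) (auto simp: rot_eq complex_space_def)

lemma sphere_space: "z \<in> S \<Longrightarrow> z \<in> complex_space n"
  by (simp add: complex_sphere_def)

lemma rot_power_sphere: "z \<in> S \<Longrightarrow> (\<rho> ^^ m) z \<in> S"
  by (auto simp: complex_sphere_def rot_power complex_space_def norm_mult norm_power)

lemma rot_sphere: "z \<in> S \<Longrightarrow> \<rho> z \<in> S"
  using rot_power_sphere[of z 1] by simp

lemma sphere_nonzero: "z \<in> S \<Longrightarrow> \<exists>j<n. z j \<noteq> 0"
  by (rule ccontr) (simp add: complex_sphere_def)

lemma rot_power_fixed_iff: "z \<in> S \<Longrightarrow> (\<rho> ^^ m) z = z \<longleftrightarrow> r dvd m"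
proof
  assume z: "z \<in> S" and eq: "(\<rho> ^^ m) z = z"
  obtain j where "j < n" "z j \<noteq> 0" using sphere_nonzero[OF z] by blast
  moreover have "(\<rho> ^^ m) z j = z j" using eq by simp
  ultimately show "r dvd m"
    using z by (simp add: rot_power sphere_space \<omega>_power_eq_1_iff)
next
  assume z: "z \<in> S" and "r dvd m"
  then have "(\<rho> ^^ m) z j = z j" for j
    using sphere_space[OF z] by (cases "j < n") (auto simp: rot_power \<omega>_power_eq_1_iff complex_space_def)
  then show "(\<rho> ^^ m) z = z" by (rule ext)
qed

lemma rot_power_eq_iff: "z \<in> S \<Longrightarrow> (\<rho> ^^ a) z = (\<rho> ^^ b) z \<longleftrightarrow> [a = b] (mod r)"
proof -
  assume z: "z \<in> S"
  have *: "(\<rho> ^^ a) z = (\<rho> ^^ b) z \<longleftrightarrow> [a = b] (mod r)" if "a \<le> b" for a b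
  proof -
    have "(\<rho> ^^ b) z = (\<rho> ^^ (b - a)) ((\<rho> ^^ a) z)"
      using that funpow_add[of "b - a" a \<rho>, THEN fun_cong, of z] by simp
    then have "(\<rho> ^^ b) z = (\<rho> ^^ a) z \<longleftrightarrow> r dvd b - a"
      using rot_power_fixed_iff[OF rot_power_sphere[OF z]] by simp
    then show ?thesis using that by (metis cong_altdef_nat cong_sym_eq)
  qed
  show ?thesis using *[of a b] *[of b a] by (metis cong_sym_eq nat_le_linear)
qed

lemma rot_power_mod: "z \<in> S \<Longrightarrow> (\<rho> ^^ (m mod r)) z = (\<rho> ^^ m) z"
  by (rule funpow_mod_eq) (simp add: rot_power_fixed_iff)

lemma rot_power_inverse: "z \<in> S \<Longrightarrow> m \<le> r \<Longrightarrow> (\<rho> ^^ (r - m)) ((\<rho> ^^ m) z) = z"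
  by (simp add: rot_power_fixed_iff flip: funpow_add[THEN fun_cong, unfolded o_apply])

lemma continuous_on_rot_power: "continuous_on S (\<rho> ^^ m)"
proof -
  have "continuous_on S (\<lambda>z j. if j < n then \<omega> j ^ m * z j else 0)"
  proof (rule continuous_on_coordinatewise_then_product)
    fix j show "continuous_on S (\<lambda>z. if j < n then \<omega> j ^ m * z j else 0)"
      by (cases "j < n") (auto intro!: continuous_intros)
  qed
  then show ?thesis
    by (rule continuous_on_eq) (simp add: rot_power sphere_space)
qed

lemma L2_dist_rot_power:
  "\<lbrakk>z \<in> S; w \<in> S\<rbrakk> \<Longrightarrow> L2_dist n ((\<rho> ^^ m) z) ((\<rho> ^^ m) w) = L2_dist n z w"
  unfolding L2_dist_def by (intro L2_set_cong)
    (simp_all add: rot_power sphere_space norm_mult norm_power flip: right_diff_distrib)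

lemma orbit_self: "z \<in> q z"
  unfolding lens_orbit_def by (rule range_eqI[of _ _ 0]) simp

lemma orbit_iff: "w \<in> q z \<longleftrightarrow> (\<exists>m. w = (\<rho> ^^ m) z)"
  by (auto simp: lens_orbit_def)

lemma orbit_bounded: "z \<in> S \<Longrightarrow> w \<in> q z \<Longrightarrow> \<exists>m<r. w = (\<rho> ^^ m) z"
  using rot_power_mod r_pos unfolding orbit_iff by (metis mod_less_divisor)

lemma orbit_subset: "z \<in> S \<Longrightarrow> q z \<subseteq> S"
  using rot_power_sphere by (auto simp: orbit_iff)

lemma orbit_mono: "w \<in> q z \<Longrightarrow> q w \<subseteq> q z"
  by (auto simp: orbit_iff simp flip: funpow_add[THEN fun_cong, unfolded o_apply])

lemma orbit_eq: "z \<in> S \<Longrightarrow> w \<in> q z \<Longrightarrow> q w = q z"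
proof
  assume z: "z \<in> S" and w: "w \<in> q z"
  then show "q w \<subseteq> q z" by (simp add: orbit_mono)
  obtain m where "m < r" "w = (\<rho> ^^ m) z" using orbit_bounded[OF z w] by blast
  then have "z \<in> q w" using rot_power_inverse[OF z, of m] unfolding orbit_iff by (metis less_imp_le)
  then show "q z \<subseteq> q w" by (rule orbit_mono)
qed

lemma orbit_rot_power: "z \<in> S \<Longrightarrow> q ((\<rho> ^^ m) z) = q z"
  by (rule orbit_eq) (auto simp: orbit_iff)

lemma topspace_lens: "topspace L = q ` S"
  by (simp add: lens_space_def topspace_quotient_topology)

lemma quotient_map_orbit: "quotient_map (top_of_set S) L q"
  by (simp add: lens_space_def quotient_map_quotient_topology)

lemma continuous_map_orbit: "continuous_map (top_of_set S) L q"
  using quotient_map_orbit by (rule quotient_imp_continuous_map)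

lemma openin_lens: "openin L U \<longleftrightarrow> U \<subseteq> q ` S \<and> openin (top_of_set S) {z \<in> S. q z \<in> U}"
  by (simp add: lens_space_def openin_quotient_topology)

lemma open_map_orbit:
  assumes U: "openin (top_of_set S) U"
  shows "openin L (q ` U)"
proof -
  have US: "U \<subseteq> S" using openin_imp_subset[OF U] .
  have "{z \<in> S. q z \<in> q ` U} = (\<Union>m. S \<inter> (\<rho> ^^ m) -` U)"
  proof (intro equalityI subsetI)
    fix z assume "z \<in> {z \<in> S. q z \<in> q ` U}"
    then obtain u where "z \<in> S" "u \<in> U" "q z = q u" by auto
    then have "u \<in> q z" using orbit_self by metis
    then show "z \<in> (\<Union>m. S \<inter> (\<rho> ^^ m) -` U)"
      using \<open>u \<in> U\<close> \<open>z \<in> S\<close> by (auto simp: orbit_iff)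
  next
    fix z assume "z \<in> (\<Union>m. S \<inter> (\<rho> ^^ m) -` U)"
    then obtain m where "z \<in> S" "(\<rho> ^^ m) z \<in> U" by blast
    then show "z \<in> {z \<in> S. q z \<in> q ` U}"
      using imageI[of "(\<rho> ^^ m) z" U q] orbit_rot_power[of z m] by simp
  qed
  moreover have "openin (top_of_set S) (S \<inter> (\<rho> ^^ m) -` U)" for m
    by (rule continuous_openin_preimage[OF continuous_on_rot_power _ U]) (auto simp: rot_power_sphere)
  ultimately have "openin (top_of_set S) {z \<in> S. q z \<in> q ` U}"
    by (metis (no_types, lifting) openin_Union imageE)
  then show ?thesis
    using US by (simp add: openin_lens image_mono)
qed

text \<open>A lower bound for the distance of two points in the same orbit. The element \<open>1\<close> only makes the set
  nonempty when the group is trivial.\<close>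

definition sep :: real where
  "sep = Min (insert 1 ((\<lambda>(j, m). cmod (\<omega> j ^ m - 1)) ` ({..<n} \<times> {0<..<r})))"

lemma sep_pos: "sep > 0"
  using \<omega>_power_eq_1_iff unfolding sep_def by (subst Min_gr_iff) (auto dest: nat_dvd_not_less)

lemma sep_le: "\<lbrakk>j < n; 0 < m; m < r\<rbrakk> \<Longrightarrow> sep \<le> cmod (\<omega> j ^ m - 1)"
  unfolding sep_def by (intro Min_le) auto

lemma separated:
  assumes z: "z \<in> S" and w: "w \<in> q z" "w \<noteq> z"
  shows "sep \<le> L2_dist n z w"
proof -
  obtain m where m: "m < r" "w = (\<rho> ^^ m) z" using orbit_bounded[OF z w(1)] by blast
  then have "m > 0" using w(2) by (cases m) auto
  have "sep = sep * L2_dist n z (\<lambda>_. 0)" using L2_dist_0_sphere[OF z] by simp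
  also have "\<dots> = L2_set (\<lambda>j. sep * cmod (z j)) {..<n}"
    using sep_pos by (simp add: L2_dist_def L2_set_right_distrib)
  also have "\<dots> \<le> L2_dist n z w"
    unfolding L2_dist_def
  proof (rule L2_set_mono)
    fix j assume j: "j \<in> {..<n}"
    have "z j - w j = - ((\<omega> j ^ m - 1) * z j)"
      using j z by (simp add: m(2) rot_power sphere_space algebra_simps)
    then have "cmod (z j - w j) = cmod (\<omega> j ^ m - 1) * cmod (z j)"
      by (simp only: norm_minus_cancel norm_mult)
    then show "sep * cmod (z j) \<le> cmod (z j - w j)"
      using sep_le[of j m] j m \<open>m > 0\<close> by (simp add: mult_right_mono)
  qed (use sep_pos in simp)
  finally show ?thesis .
qed

lemma orbit_point_unique:
  assumes "a \<in> S" "b \<in> q a" "L2_dist n a b < sep"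
  shows "b = a"
  using separated assms by force

text \<open>The rotation is an isometry, so for orbits it makes no difference whether this is required of one
  point or of all points of \<open>A\<close>; this makes the relation symmetric on orbits.\<close>

definition close :: "real \<Rightarrow> (nat \<Rightarrow> complex) set \<Rightarrow> (nat \<Rightarrow> complex) set \<Rightarrow> bool" where
  "close e A B \<longleftrightarrow> (\<forall>a\<in>A. \<exists>b\<in>B. L2_dist n a b < e)"

lemma close_orbits:
  assumes z: "z \<in> S" and w: "w \<in> S" and ab: "a \<in> q z" "b \<in> q w" "L2_dist n a b < e"
  shows "close e (q z) (q w)"
  unfolding close_def
proof
  fix a' assume "a' \<in> q z"
  moreover have a: "a \<in> S" "q a = q z" using orbit_subset[OF z] orbit_eq[OF z ab(1)] ab(1) by blast+
  moreover have b: "b \<in> S" "q b = q w" using orbit_subset[OF w] orbit_eq[OF w ab(2)] ab(2) by blast+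
  ultimately have "a' \<in> q a" by simp
  then obtain m where "a' = (\<rho> ^^ m) a" by (auto simp: orbit_iff)
  then have "L2_dist n a' ((\<rho> ^^ m) b) < e" using L2_dist_rot_power a b ab by simp
  moreover have "(\<rho> ^^ m) b \<in> q w" using b(2) orbit_iff by blast
  ultimately show "\<exists>b\<in>q w. L2_dist n a' b < e" by blast
qed

lemma close_sym: "\<lbrakk>A \<in> topspace L; B \<in> topspace L; close e A B\<rbrakk> \<Longrightarrow> close e B A"
proof -
  assume A: "A \<in> topspace L" and B: "B \<in> topspace L" and c: "close e A B"
  obtain z w where z: "z \<in> S" "A = q z" and w: "w \<in> S" "B = q w"
    using A B by (auto simp: topspace_lens)
  obtain b where "b \<in> q w" "L2_dist n z b < e" using c z w orbit_self by (auto simp: close_def)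
  then show ?thesis
    using close_orbits[OF w(1) z(1), of b z e] orbit_self by (simp add: z w L2_dist_commute)
qed

lemma close_trans: "\<lbrakk>close d A B; close e B C\<rbrakk> \<Longrightarrow> close (d + e) A C"
  unfolding close_def
proof
  fix a assume AB: "\<forall>a\<in>A. \<exists>b\<in>B. L2_dist n a b < d" and BC: "\<forall>a\<in>B. \<exists>b\<in>C. L2_dist n a b < e"
    and "a \<in> A"
  then obtain b where b: "b \<in> B" "L2_dist n a b < d" by blast
  then obtain c where c: "c \<in> C" "L2_dist n b c < e" using BC by blast
  have "L2_dist n a c < d + e" using L2_dist_triangle[of n a c b] b c by simp
  then show "\<exists>b\<in>C. L2_dist n a b < d + e" using c by blast
qed

lemma close_refl: "e > 0 \<Longrightarrow> close e A A"
  unfolding close_def by (metis L2_dist_self)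

lemma openin_close:
  assumes "A \<in> topspace L"
  shows "openin L {B \<in> topspace L. close e A B}"
proof -
  obtain z where z: "z \<in> S" "A = q z" using assms by (auto simp: topspace_lens)
  have "{B \<in> topspace L. close e A B} = q ` (S \<inter> L2_dist n z -` {..<e})"
  proof (intro equalityI subsetI)
    fix B assume "B \<in> {B \<in> topspace L. close e A B}"
    then obtain w where w: "w \<in> S" "B = q w" "close e (q z) (q w)" by (auto simp: topspace_lens z)
    then obtain b where "b \<in> q w" "L2_dist n z b < e" using orbit_self by (auto simp: close_def)
    moreover have "b \<in> S" "q b = q w" using w \<open>b \<in> q w\<close> orbit_eq orbit_subset by blast+
    ultimately show "B \<in> q ` (S \<inter> L2_dist n z -` {..<e})"
      using w(2) by (intro image_eqI[of _ _ b]) auto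
  next
    fix B assume "B \<in> q ` (S \<inter> L2_dist n z -` {..<e})"
    then obtain w where "w \<in> S" "L2_dist n z w < e" "B = q w" by auto
    then show "B \<in> {B \<in> topspace L. close e A B}"
      using close_orbits[OF z(1), of w z w e] orbit_self by (simp add: topspace_lens z)
  qed
  moreover have "openin (top_of_set S) (S \<inter> L2_dist n z -` {..<e})"
    by (intro continuous_openin_preimage_gen continuous_on_L2_dist) simp
  ultimately show ?thesis using open_map_orbit by simp
qed

section \<open>Lifting along the orbit projection\<close>

text \<open>Different points of an orbit are far apart. So an orbit that is close to a given point has only one
  point nearby, and this point varies continuously with the orbit.\<close>

lemma lift_nearby:
  fixes K :: "'a::topological_space set"
  assumes \<phi>: "continuous_on K \<phi>" "\<phi> ` K \<subseteq> S"
    and A: "continuous_map (top_of_set K) L A"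
    and near: "\<And>x. x \<in> K \<Longrightarrow> close (sep / 4) (q (\<phi> x)) (A x)"
  shows "\<exists>\<psi>. continuous_on K \<psi> \<and> \<psi> ` K \<subseteq> S \<and> (\<forall>x\<in>K. q (\<psi> x) = A x)"
proof -
  have AL: "A x \<in> topspace L" if "x \<in> K" for x
    using continuous_map_image_subset_topspace[OF A] that by auto
  then have sub: "A x \<subseteq> S" if "x \<in> K" for x
    using that orbit_subset by (fastforce simp: topspace_lens)
  have Aeq: "q b = A x" if "x \<in> K" "b \<in> A x" for x b
    using AL[OF that(1)] that(2) orbit_eq by (auto simp: topspace_lens)
  have "\<forall>x\<in>K. \<exists>b\<in>A x. L2_dist n (\<phi> x) b < sep / 4"
    using near orbit_self by (auto simp: close_def)
  then obtain \<psi> where \<psi>: "\<And>x. x \<in> K \<Longrightarrow> \<psi> x \<in> A x" "\<And>x. x \<in> K \<Longrightarrow> L2_dist n (\<phi> x) (\<psi> x) < sep / 4"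
    by metis
  have "continuous_on K \<psi>"
  proof (rule continuous_on_if_eventually_L2_dist[where n = n])
    fix x assume "x \<in> K"
    then show "\<psi> x \<in> complex_space n" using \<psi> sub sphere_space by blast
  next
    fix x and e :: real assume x: "x \<in> K" and "e > 0"
    define e' where "e' = min e (sep / 4)"
    have e': "e' > 0" "e' \<le> e" "e' \<le> sep / 4" using \<open>e > 0\<close> sep_pos by (auto simp: e'_def)
    have "openin (top_of_set K) {y \<in> K. A y \<in> {B \<in> topspace L. close e' (A x) B}}"
      using openin_continuous_map_preimage[OF A openin_close[OF AL[OF x]]] by simp
    moreover have "x \<in> {y \<in> K. A y \<in> {B \<in> topspace L. close e' (A x) B}}"
      using x AL close_refl[OF e'(1)] by simp
    ultimately obtain G where "open G" "x \<in> G" "\<And>y. y \<in> K \<Longrightarrow> y \<in> G \<Longrightarrow> close e' (A x) (A y)"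
      unfolding openin_open by blast
    then have ev1: "\<forall>\<^sub>F y in at x within K. y \<in> K \<and> close e' (A x) (A y)"
      unfolding eventually_at_topological by blast
    have ev2: "\<forall>\<^sub>F y in at x within K. L2_dist n (\<phi> x) (\<phi> y) < sep / 4"
      using sep_pos by (intro continuous_imp_eventually_L2_dist[OF \<phi>(1) x]) simp
    show "\<forall>\<^sub>F y in at x within K. L2_dist n (\<psi> x) (\<psi> y) < e"
      using ev1 ev2
    proof eventually_elim
      case (elim y)
      then obtain b where b: "b \<in> A y" "L2_dist n (\<psi> x) b < e'"
        using \<psi>(1)[OF x] by (auto simp: close_def)
      have "L2_dist n (\<psi> y) b \<le> L2_dist n (\<psi> y) (\<phi> y) + L2_dist n (\<phi> y) b"
        by (rule L2_dist_triangle)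
      also have "L2_dist n (\<phi> y) b \<le> L2_dist n (\<phi> y) (\<phi> x) + L2_dist n (\<phi> x) b"
        by (rule L2_dist_triangle)
      also have "L2_dist n (\<phi> x) b \<le> L2_dist n (\<phi> x) (\<psi> x) + L2_dist n (\<psi> x) b"
        by (rule L2_dist_triangle)
      finally have "L2_dist n (\<psi> y) b < sep"
        using elim b(2) e' \<psi>(2)[OF x] \<psi>(2)[of y]
        by (simp add: L2_dist_commute[of n "\<psi> y"] L2_dist_commute[of n "\<phi> y" "\<phi> x"])
      then have "b = \<psi> y"
        using orbit_point_unique[of "\<psi> y" b] Aeq[of y "\<psi> y"] \<psi>(1)[of y] sub[of y] elim b by auto
      then show ?case using b e' by simp
    qed
  qed
  moreover have "\<psi> ` K \<subseteq> S" using \<psi>(1) sub by blast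
  ultimately show ?thesis using \<psi>(1) Aeq by blast
qed

text \<open>The proof is that of uniform continuity, by a Lebesgue number of a finite cover; closeness takes
  the place of a metric on the space of orbits.\<close>

lemma uniformly_close:
  fixes K :: "'a::metric_space set"
  assumes K: "compact K" and h: "continuous_map (top_of_set K) L h" and "e > 0"
  shows "\<exists>\<delta>>0. \<forall>u\<in>K. \<forall>v\<in>K. dist u v < \<delta> \<longrightarrow> close e (h u) (h v)"
proof -
  have hL: "h u \<in> topspace L" if "u \<in> K" for u
    using continuous_map_image_subset_topspace[OF h] that by auto
  have "\<exists>G. open G \<and> (\<forall>v\<in>K. v \<in> G \<longleftrightarrow> close (e / 2) (h u) (h v))" if u: "u \<in> K" for u
  proof -
    have "openin (top_of_set K) {v \<in> K. h v \<in> {B \<in> topspace L. close (e / 2) (h u) B}}"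
      using openin_continuous_map_preimage[OF h openin_close[OF hL[OF u]]] by simp
    then show ?thesis unfolding openin_open using hL by blast
  qed
  then obtain G where G: "\<And>u. u \<in> K \<Longrightarrow> open (G u)"
    "\<And>u v. u \<in> K \<Longrightarrow> v \<in> K \<Longrightarrow> v \<in> G u \<longleftrightarrow> close (e / 2) (h u) (h v)" by metis
  obtain \<delta> where \<delta>: "\<delta> > 0" "\<And>x. x \<in> K \<Longrightarrow> \<exists>V \<in> G ` K. ball x \<delta> \<subseteq> V"
  proof (rule Heine_Borel_lemma[OF K, of "G ` K"])
    show "K \<subseteq> \<Union> (G ` K)" using G(2) close_refl[of "e/2"] \<open>e > 0\<close> by fastforce
  qed (use G(1) in auto)
  have "close e (h u) (h v)" if uv: "u \<in> K" "v \<in> K" "dist u v < \<delta>" for u v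
  proof -
    obtain w where w: "w \<in> K" "ball u \<delta> \<subseteq> G w" using \<delta>(2)[OF uv(1)] by blast
    then have "u \<in> G w" "v \<in> G w"
      using uv \<delta>(1) by (auto simp: subset_iff)
    then have "close (e / 2) (h w) (h u)" "close (e / 2) (h w) (h v)"
      using G(2)[OF w(1)] uv by blast+
    then show ?thesis using close_sym[of "h w" "h u"] close_trans[of "e/2" "h u" "h w" "e/2" "h v"] hL uv w by auto
  qed
  then show ?thesis using \<delta>(1) by blast
qed

text \<open>By uniform closeness the time interval splits into finitely many steps during which every orbit moves
  by little, and \<open>lift_nearby\<close> carries the lift across one step. Only the final map is recorded.\<close>

lemma homotopy_lifting:
  fixes K :: "'a::metric_space set" and \<Phi> :: "real \<times> 'a \<Rightarrow> (nat \<Rightarrow> complex) set"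
  assumes K: "compact K" and \<Phi>: "continuous_map (top_of_set ({0..1} \<times> K)) L \<Phi>"
    and \<phi>0: "continuous_on K \<phi>0" "\<phi>0 ` K \<subseteq> S" "\<And>x. x \<in> K \<Longrightarrow> q (\<phi>0 x) = \<Phi> (0, x)"
  shows "\<exists>\<psi>. continuous_on K \<psi> \<and> \<psi> ` K \<subseteq> S \<and> (\<forall>x\<in>K. q (\<psi> x) = \<Phi> (1, x))"
proof -
  have "compact ({0..1::real} \<times> K)" using K by (intro compact_Times) auto
  from uniformly_close[OF this \<Phi>, of "sep / 4"] obtain \<delta> where \<delta>: "\<delta> > 0"
    "\<And>u v. \<lbrakk>u \<in> {0..1} \<times> K; v \<in> {0..1} \<times> K; dist u v < \<delta>\<rbrakk> \<Longrightarrow> close (sep / 4) (\<Phi> u) (\<Phi> v)"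
    using sep_pos by (metis divide_pos_pos zero_less_numeral)
  obtain M where M: "M > 0" "inverse (real M) < \<delta>"
    using reals_Archimedean[OF \<delta>(1)] by (metis of_nat_Suc zero_less_Suc)
  have "\<exists>\<psi>. continuous_on K \<psi> \<and> \<psi> ` K \<subseteq> S \<and> (\<forall>x\<in>K. q (\<psi> x) = \<Phi> (real i / real M, x))" if "i \<le> M" for i
    using that
  proof (induction i)
    case 0
    then show ?case using \<phi>0 by auto
  next
    case (Suc i)
    then obtain \<phi> where \<phi>: "continuous_on K \<phi>" "\<phi> ` K \<subseteq> S" "\<And>x. x\<in>K \<Longrightarrow> q (\<phi> x) = \<Phi> (real i / real M, x)"
      by auto
    have mem: "(real j / real M, x) \<in> {0..1} \<times> K" if "x \<in> K" "j \<le> M" for x j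
      using that M(1) by (auto simp: divide_le_eq)
    have "continuous_map (top_of_set K) (top_of_set ({0..1} \<times> K)) (\<lambda>x. (real (Suc i) / real M, x))"
      using mem Suc.prems by (auto intro!: continuous_intros simp: continuous_map_in_subtopology)
    from continuous_map_compose[OF this \<Phi>]
    have 1: "continuous_map (top_of_set K) L (\<lambda>x. \<Phi> (real (Suc i) / real M, x))" by (simp add: o_def)
    have 2: "close (sep / 4) (q (\<phi> x)) (\<Phi> (real (Suc i) / real M, x))" if x: "x \<in> K" for x
    proof -
      have "dist (real i / real M, x) (real (Suc i) / real M, x) = dist (real i / real M) (real (Suc i) / real M)"
        by (simp add: dist_Pair_Pair)
      also have "\<dots> = inverse (real M)"
        using M(1) by (simp add: dist_real_def divide_simps)
      finally have "dist (real i / real M, x) (real (Suc i) / real M, x) = inverse (real M)" .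
      then show ?thesis
        using \<delta>(2)[OF mem[OF x, of i] mem[OF x, of "Suc i"]] M Suc.prems
        by (simp add: \<phi>(3) x del: of_nat_Suc)
    qed
    show ?case by (rule lift_nearby[OF \<phi>(1,2) 1 2])
  qed
  from this[of M] M(1) show ?thesis by auto
qed

lemma lifts_differ_by_rotation:
  fixes K :: "'a::topological_space set"
  assumes K: "connected K" and f: "continuous_on K f" "f ` K \<subseteq> S" and g: "continuous_on K g" "g ` K \<subseteq> S"
    and eq: "\<And>x. x \<in> K \<Longrightarrow> q (f x) = q (g x)"
  shows "\<exists>m<r. \<forall>x\<in>K. g x = (\<rho> ^^ m) (f x)"
proof (cases "K = {}")
  case False
  then obtain x0 where x0: "x0 \<in> K" by blast
  \<comment> \<open>These finitely many closed sets are disjoint and cover \<open>K\<close>.\<close>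
  define E where "E m = {x \<in> K. g x = (\<rho> ^^ m) (f x)}" for m
  have ex: "\<exists>m<r. x \<in> E m" if "x \<in> K" for x
  proof -
    have "g x \<in> q (f x)" using eq[OF that] orbit_self[of "g x"] by simp
    then show ?thesis using orbit_bounded[of "f x" "g x"] f(2) that by (auto simp: E_def)
  qed
  then obtain m0 where m0: "m0 < r" "x0 \<in> E m0" using x0 by blast
  have closed: "closedin (top_of_set K) (E m)" for m
  proof -
    have "continuous_on K (\<lambda>x. (\<rho> ^^ m) (f x))"
      by (rule continuous_on_compose2[OF continuous_on_rot_power f(1)]) (use f(2) in auto)
    then show ?thesis
      using closedin_continuous_maps_eq[of euclidean "top_of_set K" g "\<lambda>x. (\<rho> ^^ m) (f x)"] g(1)
      by (simp add: E_def Hausdorff_space_euclidean)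
  qed
  have disj: "E m \<inter> E m' = {}" if "m < r" "m' < r" "m \<noteq> m'" for m m'
  proof (rule ccontr)
    assume "E m \<inter> E m' \<noteq> {}"
    then obtain x where "x \<in> E m" "x \<in> E m'" by blast
    then have "x \<in> K" "(\<rho> ^^ m) (f x) = (\<rho> ^^ m') (f x)" by (simp_all add: E_def)
    then have "[m = m'] (mod r)" using rot_power_eq_iff[of "f x" m m'] f(2) by blast
    then show False using that cong_less_modulus_unique_nat by blast
  qed
  let ?B = "\<Union>m\<in>{..<r}-{m0}. E m"
  have "closedin (top_of_set K) ?B" using closed by (intro closedin_Union) auto
  moreover have "E m0 \<inter> ?B = {}"
    using disj[OF m0(1)] by blast
  moreover have "K \<subseteq> E m0 \<union> ?B" using ex by blast
  ultimately have "?B = {}"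
    using K closed[of m0] m0(2) unfolding connected_closedin by blast
  then have "K \<subseteq> E m0" using \<open>K \<subseteq> E m0 \<union> ?B\<close> by blast
  then show ?thesis using m0(1) by (auto simp: E_def)
qed (use r_pos in auto)

end

section \<open>Singular chains of the sphere and of the lens space\<close>

lemma lookup_frag_extend_inj:
  assumes "Poly_Mapping.keys c \<subseteq> A" and inj: "inj_on f A" and x: "x \<in> A"
  shows "Poly_Mapping.lookup (frag_extend (frag_of \<circ> f) c) (f x) = Poly_Mapping.lookup c x"
  using assms(1)
proof (induction c rule: frag_induction)
  case (one y)
  then show ?case using inj x by (auto simp: inj_on_def)
qed (auto simp: frag_extend_diff lookup_minus)

lemma singular_simplex_top_of_set_iff:
  "singular_simplex p (top_of_set A) \<sigma> \<longleftrightarrow>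
     continuous_on (standard_simplex p) \<sigma> \<and> \<sigma> ` standard_simplex p \<subseteq> A \<and> \<sigma> \<in> extensional (standard_simplex p)"
  unfolding singular_simplex_def euclidean_product_topology
  by (auto simp: continuous_map_in_subtopology continuous_map_iff_continuous)

lemma simplex_map_eq_iff:
  "simplex_map p f \<sigma> = simplex_map p g \<tau> \<longleftrightarrow> (\<forall>x\<in>standard_simplex p. f (\<sigma> x) = g (\<tau> x))"
  unfolding simplex_map_def fun_eq_iff restrict_def by auto

context lens_action
begin

abbreviation SS :: "(nat \<Rightarrow> complex) topology" where "SS \<equiv> top_of_set S"

text \<open>A map on a contractible compact set is the end of a homotopy that starts at a constant map, and a
  constant map can be lifted.\<close>

lemma lift_of_contraction:
  fixes K :: "'a::metric_space set" and H :: "real \<times> 'a \<Rightarrow> 'a"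
  assumes K: "compact K" and a: "a \<in> K"
    and H: "continuous_on ({0..1} \<times> K) H" "H ` ({0..1} \<times> K) \<subseteq> K"
    and H0: "\<And>x. x \<in> K \<Longrightarrow> H (0, x) = a" and H1: "\<And>x. x \<in> K \<Longrightarrow> H (1, x) = x"
    and f: "continuous_map (top_of_set K) L f"
  shows "\<exists>\<psi>. continuous_on K \<psi> \<and> \<psi> ` K \<subseteq> S \<and> (\<forall>x\<in>K. q (\<psi> x) = f x)"
proof -
  have "f a \<in> q ` S"
    using continuous_map_image_subset_topspace[OF f] a by (auto simp: topspace_lens)
  then obtain z where z: "z \<in> S" "q z = f a" by auto
  have "continuous_map (top_of_set ({0..1} \<times> K)) (top_of_set K) H"
    using H by (auto simp: continuous_map_in_subtopology)
  from continuous_map_compose[OF this f]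
  have "\<exists>\<psi>. continuous_on K \<psi> \<and> \<psi> ` K \<subseteq> S \<and> (\<forall>x\<in>K. q (\<psi> x) = (f \<circ> H) (1, x))"
    by (rule homotopy_lifting[OF K, where ?\<phi>0.0 = "\<lambda>_. z"]) (use z H0 in auto)
  then show ?thesis using H1 by simp
qed

lemma simplex_lift:
  assumes \<tau>: "singular_simplex p L \<tau>"
  shows "\<exists>\<sigma>. singular_simplex p SS \<sigma> \<and> simplex_map p q \<sigma> = \<tau>"
proof -
  let ?K = "standard_simplex p"
  define v :: "nat \<Rightarrow> real" where "v = (\<lambda>j. if j = 0 then 1 else 0)"
  have v: "v \<in> ?K" by (simp add: v_def)
  define H where "H = (\<lambda>(t::real, x::nat \<Rightarrow> real) i. (1 - t) * v i + t * x i)"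
  have K: "compact ?K"
    using compactin_standard_simplex by (simp add: euclidean_product_topology)
  have H1: "continuous_on ({0..1} \<times> ?K) H"
  proof (rule continuous_on_coordinatewise_then_product)
    fix i
    have "continuous_on ({0..1} \<times> ?K) (\<lambda>y. snd y i)"
      by (rule continuous_on_product_then_coordinatewise[OF continuous_on_snd[OF continuous_on_id]])
    then show "continuous_on ({0..1} \<times> ?K) (\<lambda>y. H y i)"
      unfolding H_def case_prod_beta by (intro continuous_intros)
  qed
  have H2: "H ` ({0..1} \<times> ?K) \<subseteq> ?K"
    using convex_standard_simplex[OF v] by (auto simp: H_def)
  have \<tau>': "continuous_map (top_of_set ?K) L \<tau>"
    using \<tau> by (simp add: singular_simplex_def euclidean_product_topology)
  have "\<exists>\<psi>. continuous_on ?K \<psi> \<and> \<psi> ` ?K \<subseteq> S \<and> (\<forall>x\<in>?K. q (\<psi> x) = \<tau> x)"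
    by (rule lift_of_contraction[OF K v H1 H2 _ _ \<tau>']) (auto simp: H_def)
  then obtain \<psi> where \<psi>: "continuous_on ?K \<psi>" "\<psi> ` ?K \<subseteq> S" "\<And>x. x \<in> ?K \<Longrightarrow> q (\<psi> x) = \<tau> x" by blast
  have "continuous_on ?K (restrict \<psi> ?K)"
    by (rule continuous_on_eq[OF \<psi>(1)]) simp
  then have "singular_simplex p SS (restrict \<psi> ?K)"
    using \<psi>(2) by (simp add: singular_simplex_top_of_set_iff)
  moreover have "simplex_map p q (restrict \<psi> ?K) = \<tau>"
  proof
    fix x show "simplex_map p q (restrict \<psi> ?K) x = \<tau> x"
      using \<tau> \<psi>(3)[of x] by (cases "x \<in> ?K") (auto simp: simplex_map_def singular_simplex_def extensional_def)
  qed
  ultimately show ?thesis by blast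
qed

lemma simplex_lifts_differ_by_rotation:
  assumes \<sigma>: "singular_simplex p SS \<sigma>" and \<sigma>': "singular_simplex p SS \<sigma>'"
    and eq: "simplex_map p q \<sigma> = simplex_map p q \<sigma>'"
  shows "\<exists>m<r. \<sigma>' = simplex_map p (\<rho> ^^ m) \<sigma>"
proof -
  have "connected (standard_simplex p)"
    using connectedin_standard_simplex by (simp add: euclidean_product_topology)
  then obtain m where m: "m < r" "\<And>x. x \<in> standard_simplex p \<Longrightarrow> \<sigma>' x = (\<rho> ^^ m) (\<sigma> x)"
    using lifts_differ_by_rotation[of "standard_simplex p" \<sigma> \<sigma>'] \<sigma> \<sigma>' eq
    by (auto simp: singular_simplex_top_of_set_iff simplex_map_eq_iff)
  then have "\<sigma>' = simplex_map p (\<rho> ^^ m) \<sigma>"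
    using \<sigma>' unfolding simplex_map_def singular_simplex_def extensional_def by force
  then show ?thesis using m(1) by blast
qed

lemma continuous_map_rot_power: "continuous_map SS SS (\<rho> ^^ m)"
  using continuous_on_rot_power rot_power_sphere by (auto simp: continuous_map_in_subtopology)

lemma continuous_map_rot: "continuous_map SS SS \<rho>"
  using continuous_map_rot_power[of 1] by simp

lemma inj_on_simplex_rot: "inj_on (simplex_map p \<rho>) (singular_simplex_set p SS)"
proof (rule inj_onI)
  fix \<sigma> \<tau> assume "\<sigma> \<in> singular_simplex_set p SS" "\<tau> \<in> singular_simplex_set p SS"
    and eq: "simplex_map p \<rho> \<sigma> = simplex_map p \<rho> \<tau>"
  then have \<sigma>: "singular_simplex p SS \<sigma>" and \<tau>: "singular_simplex p SS \<tau>" by auto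
  have "\<sigma> x = \<tau> x" if x: "x \<in> standard_simplex p" for x
  proof -
    have "\<rho> (\<sigma> x) = \<rho> (\<tau> x)" using eq x by (simp add: simplex_map_eq_iff)
    then have "(\<rho> ^^ (r - 1)) (\<rho> (\<sigma> x)) = (\<rho> ^^ (r - 1)) (\<rho> (\<tau> x))" by simp
    then show ?thesis
      using rot_power_inverse[of "\<sigma> x" 1] rot_power_inverse[of "\<tau> x" 1] \<sigma> \<tau> x r_pos
      by (auto simp: singular_simplex_top_of_set_iff image_subset_iff)
  qed
  then show "\<sigma> = \<tau>"
    using \<sigma> \<tau> by (auto simp: singular_simplex_def extensional_def fun_eq_iff) metis
qed

lemma simplex_rot_power_inj:
  assumes \<sigma>: "singular_simplex p SS \<sigma>" and "m < r" "m' < r"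
    and eq: "simplex_map p (\<rho> ^^ m) \<sigma> = simplex_map p (\<rho> ^^ m') \<sigma>"
  shows "m = m'"
proof -
  obtain x where x: "x \<in> standard_simplex p" using nonempty_standard_simplex by blast
  then have S: "\<sigma> x \<in> S" using \<sigma> by (auto simp: singular_simplex_top_of_set_iff)
  have "(\<rho> ^^ m) (\<sigma> x) = (\<rho> ^^ m') (\<sigma> x)" using eq x by (simp add: simplex_map_eq_iff)
  then show ?thesis using rot_power_eq_iff[OF S] assms(2,3) cong_less_modulus_unique_nat by blast
qed

definition rot_diff :: "nat \<Rightarrow> (nat \<Rightarrow> complex) chain \<Rightarrow> (nat \<Rightarrow> complex) chain" where
  "rot_diff p c = c - chain_map p \<rho> c"

text \<open>On the sphere this chain depends only on the image of \<open>c\<close> in the lens space, because the norm kills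
  \<open>rot_diff\<close>. It is the transfer of that image.\<close>

definition rot_norm :: "nat \<Rightarrow> (nat \<Rightarrow> complex) chain \<Rightarrow> (nat \<Rightarrow> complex) chain" where
  "rot_norm p c = (\<Sum>m<r. chain_map p (\<rho> ^^ m) c)"

lemma chain_rot_power: "chain_map p (\<rho> ^^ Suc m) c = chain_map p \<rho> (chain_map p (\<rho> ^^ m) c)"
  by (simp add: chain_map_compose)

lemma singular_chain_rot_power: "singular_chain p SS c \<Longrightarrow> singular_chain p SS (chain_map p (\<rho> ^^ m) c)"
  by (rule singular_chain_chain_map[OF _ continuous_map_rot_power])

lemma chain_rot_power_r: "singular_chain p SS c \<Longrightarrow> chain_map p (\<rho> ^^ r) c = c"
  using chain_map_id_gen[of p SS c "\<rho> ^^ r"] by (simp add: rot_power_fixed_iff)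

lemma rot_diff_add: "rot_diff p (a + b) = rot_diff p a + rot_diff p b"
  by (simp add: rot_diff_def chain_map_add)

lemma rot_diff_sum:
  assumes "singular_chain p SS c"
  shows "rot_diff p (\<Sum>i<m. chain_map p (\<rho> ^^ i) c) = c - chain_map p (\<rho> ^^ m) c"
proof (induction m)
  case 0
  have "chain_map p id c = c" using assms by (rule chain_map_ident)
  then show ?case by (simp add: rot_diff_def id_def)
next
  case (Suc m)
  have "rot_diff p (\<Sum>i<Suc m. chain_map p (\<rho> ^^ i) c)
      = c - chain_map p (\<rho> ^^ m) c + rot_diff p (chain_map p (\<rho> ^^ m) c)"
    by (simp only: sum.lessThan_Suc rot_diff_add Suc)
  also have "\<dots> = c - chain_map p (\<rho> ^^ Suc m) c"
    by (simp only: chain_rot_power rot_diff_def) simp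
  finally show ?case .
qed

lemma rot_diff_minus: "rot_diff p (- c) = - rot_diff p c"
  by (simp add: rot_diff_def chain_map_minus)

lemma rot_norm_diff_commute:
  "rot_norm p (rot_diff p c) = rot_diff p (rot_norm p c)"
proof -
  have "chain_map p (\<rho> ^^ m) (chain_map p \<rho> c) = chain_map p \<rho> (chain_map p (\<rho> ^^ m) c)" for m
    by (metis chain_map_compose chain_rot_power comp_apply funpow_Suc_right)
  then show ?thesis
    unfolding rot_norm_def rot_diff_def
    by (simp add: chain_map_diff chain_map_sum sum_subtractf o_def)
qed

lemma orbit_chain_rot_power:
  assumes "singular_chain p SS c"
  shows "chain_map p q (chain_map p (\<rho> ^^ m) c) = chain_map p q c"
  using chain_map_eq[OF assms, of "q \<circ> (\<rho> ^^ m)" q] orbit_rot_power by (simp add: chain_map_compose)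

lemma orbit_chain_rot_diff:
  "singular_chain p SS c \<Longrightarrow> chain_map p q (rot_diff p c) = 0"
  using orbit_chain_rot_power[of p c 1] by (simp add: rot_diff_def chain_map_diff)

lemma orbit_chain_rot_norm:
  assumes "singular_chain p SS c"
  shows "chain_map p q (rot_norm p c) = frag_cmul (int r) (chain_map p q c)"
proof -
  have "chain_map p q (\<Sum>m<k. chain_map p (\<rho> ^^ m) c) = frag_cmul (int k) (chain_map p q c)" for k
    by (induction k) (simp_all add: chain_map_add orbit_chain_rot_power[OF assms] frag_cmul_distrib)
  then show ?thesis by (simp add: rot_norm_def)
qed

text \<open>A choice of lifts for all simplices of the lens space, one for each orbit of simplices of the sphere.\<close>

definition simplex_section :: "nat \<Rightarrow> ((nat \<Rightarrow> real) \<Rightarrow> (nat \<Rightarrow> complex) set) \<Rightarrow> (nat \<Rightarrow> real) \<Rightarrow> nat \<Rightarrow> complex" where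
  "simplex_section p \<tau> = (SOME \<sigma>. singular_simplex p SS \<sigma> \<and> simplex_map p q \<sigma> = \<tau>)"

lemma simplex_section:
  assumes "singular_simplex p L \<tau>"
  shows "singular_simplex p SS (simplex_section p \<tau>)" "simplex_map p q (simplex_section p \<tau>) = \<tau>"
  using someI_ex[OF simplex_lift[OF assms]] by (simp_all add: simplex_section_def)

definition chain_section :: "nat \<Rightarrow> (nat \<Rightarrow> complex) set chain \<Rightarrow> (nat \<Rightarrow> complex) chain" where
  "chain_section p = frag_extend (frag_of \<circ> simplex_section p)"

lemma singular_chain_section: "singular_chain p L c \<Longrightarrow> singular_chain p SS (chain_section p c)"
  unfolding chain_section_def
  by (rule singular_chain_extend) (auto simp: singular_chain_def singular_chain_of intro!: simplex_section(1))

lemma orbit_chain_section: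
  assumes "singular_chain p L c" shows "chain_map p q (chain_section p c) = c"
  using assms unfolding singular_chain_def
proof (induction c rule: frag_induction)
  case (one \<tau>)
  then show ?case by (simp add: chain_section_def simplex_section)
qed (auto simp: chain_section_def frag_extend_diff chain_map_diff)

text \<open>A simplex of the sphere differs from the chosen simplex in its orbit by a rotation, and the
  difference of a chain and its rotation by any power of \<open>\<rho>\<close> telescopes (\<open>rot_diff_sum\<close>).\<close>

lemma diff_chain_section:
  assumes "singular_chain p SS c"
  shows "\<exists>b. singular_chain p SS b \<and> c - chain_section p (chain_map p q c) = rot_diff p b"
  using assms unfolding singular_chain_def
proof (induction c rule: frag_induction)
  case zero
  show ?case by (intro exI[of _ 0]) (simp add: chain_section_def rot_diff_def)
next
  case (one \<sigma>)
  then have \<sigma>: "singular_simplex p SS \<sigma>" by simp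
  then have \<tau>: "singular_simplex p L (simplex_map p q \<sigma>)"
    by (rule singular_simplex_simplex_map) (rule continuous_map_orbit)
  let ?s = "simplex_section p (simplex_map p q \<sigma>)"
  obtain m where m: "\<sigma> = simplex_map p (\<rho> ^^ m) ?s"
    using simplex_lifts_differ_by_rotation[OF simplex_section(1)[OF \<tau>] \<sigma>] simplex_section(2)[OF \<tau>] by auto
  have s: "singular_chain p SS (frag_of ?s)" using simplex_section(1)[OF \<tau>] by (simp add: singular_chain_of)
  let ?b = "- (\<Sum>i<m. chain_map p (\<rho> ^^ i) (frag_of ?s))"
  have "rot_diff p ?b = - (frag_of ?s - chain_map p (\<rho> ^^ m) (frag_of ?s))"
    using rot_diff_sum[OF s, of m] by (simp only: rot_diff_minus)
  also have "\<dots> = frag_of \<sigma> - frag_of ?s" using m by simp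
  finally have "frag_of \<sigma> - chain_section p (chain_map p q (frag_of \<sigma>)) = rot_diff p ?b"
    by (simp add: chain_section_def)
  moreover have "singular_chain p SS ?b"
    using s by (simp add: singular_chain_minus singular_chain_sum singular_chain_rot_power del: chain_map_of)
  ultimately show ?case unfolding singular_chain_def by blast
next
  case (diff a b)
  then obtain a' b' where a': "singular_chain p SS a'" "a - chain_section p (chain_map p q a) = rot_diff p a'"
    and b': "singular_chain p SS b'" "b - chain_section p (chain_map p q b) = rot_diff p b'"
    unfolding singular_chain_def by blast
  have "a - b - chain_section p (chain_map p q (a - b))
      = (a - chain_section p (chain_map p q a)) - (b - chain_section p (chain_map p q b))"
    by (simp add: chain_section_def chain_map_diff frag_extend_diff)
  also have "\<dots> = rot_diff p (a' - b')"
    unfolding a'(2) b'(2) by (simp add: rot_diff_def chain_map_diff)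
  finally show ?case using singular_chain_diff[OF a'(1) b'(1)] unfolding singular_chain_def by blast
qed

lemma orbit_chain_eq_0:
  assumes "singular_chain p SS c" "chain_map p q c = 0"
  shows "\<exists>b. singular_chain p SS b \<and> c = rot_diff p b"
  using diff_chain_section[OF assms(1)] assms(2) by (simp add: chain_section_def)

text \<open>The image in the lens space of \<open>rot_norm p c\<close> is \<open>r\<close> times the image of \<open>c\<close>, and chain groups have no
  torsion.\<close>

lemma rot_norm_eq_0:
  assumes c: "singular_chain p SS c" and 0: "rot_norm p c = 0"
  shows "\<exists>b. singular_chain p SS b \<and> c = rot_diff p b"
proof (rule orbit_chain_eq_0[OF c])
  have "frag_cmul (int r) (chain_map p q c) = 0" using orbit_chain_rot_norm[OF c] 0 by simp
  then show "chain_map p q c = 0" using r_pos by (simp add: frag_cmul_eq_0_iff)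
qed

lemma lookup_rot_norm_of:
  assumes \<sigma>: "singular_simplex p SS \<sigma>"
  shows "Poly_Mapping.lookup (rot_norm p (frag_of \<sigma>)) \<sigma>' = (if \<exists>m<r. \<sigma>' = simplex_map p (\<rho> ^^ m) \<sigma> then 1 else 0)"
proof (cases "\<exists>m<r. \<sigma>' = simplex_map p (\<rho> ^^ m) \<sigma>")
  case False
  then show ?thesis by (auto simp: rot_norm_def lookup_sum intro!: sum.neutral)
next
  case True
  then obtain m where m: "m < r" "\<sigma>' = simplex_map p (\<rho> ^^ m) \<sigma>" by blast
  have "Poly_Mapping.lookup (rot_norm p (frag_of \<sigma>)) \<sigma>' = (\<Sum>i<r. if i = m then 1 else 0)"
    unfolding rot_norm_def lookup_sum
    by (rule sum.cong) (use simplex_rot_power_inj[OF \<sigma>] m in auto)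
  also have "\<dots> = 1" using m(1) by simp
  finally show ?thesis using True by simp
qed

text \<open>An invariant chain has constant coefficients along each orbit of simplices, and orbits have exactly
  \<open>r\<close> elements. So the norm of one simplex can be split off, and the support becomes smaller.\<close>

lemma rot_diff_eq_0:
  assumes "singular_chain p SS c" and "rot_diff p c = 0"
  shows "\<exists>b. singular_chain p SS b \<and> c = rot_norm p b"
  using assms
proof (induction "card (Poly_Mapping.keys c)" arbitrary: c rule: less_induct)
  case less
  show ?case
  proof (cases "c = 0")
    case True
    then show ?thesis by (intro exI[of _ 0]) (simp add: rot_norm_def)
  next
    case False
    then obtain \<sigma> where \<sigma>c: "\<sigma> \<in> Poly_Mapping.keys c" by fastforce
    then have \<sigma>: "singular_simplex p SS \<sigma>" using less.prems(1) by (auto simp: singular_chain_def)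
    define a where "a = Poly_Mapping.lookup c \<sigma>"
    let ?N = "rot_norm p (frag_of \<sigma>)"
    define c' where "c' = c - frag_cmul a ?N"
    have inv: "chain_map p \<rho> c = c" using less.prems(2) by (simp add: rot_diff_def)
    have rotinv: "Poly_Mapping.lookup c (simplex_map p \<rho> \<tau>) = Poly_Mapping.lookup c \<tau>"
      if "singular_simplex p SS \<tau>" for \<tau>
      using lookup_frag_extend_inj[OF _ inj_on_simplex_rot, of c p \<tau>] less.prems(1) that
      by (simp add: singular_chain_def inv flip: chain_map_def)
    have lk: "Poly_Mapping.lookup c (simplex_map p (\<rho> ^^ m) \<sigma>) = a" for m
    proof (induction m)
      case 0
      then show ?case
        using simplex_map_id_gen[OF \<sigma>, of "\<lambda>x. x"] by (simp add: a_def id_def)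
    next
      case (Suc m)
      have "simplex_map p (\<rho> ^^ Suc m) \<sigma> = simplex_map p \<rho> (simplex_map p (\<rho> ^^ m) \<sigma>)"
        by (simp add: simplex_map_compose)
      with Suc show ?case
        using rotinv[OF singular_simplex_simplex_map[OF \<sigma> continuous_map_rot_power[of m]]]
        by (simp del: funpow.simps)
    qed
    have c': "singular_chain p SS c'"
      unfolding c'_def rot_norm_def using less.prems(1) \<sigma>
      by (intro singular_chain_diff singular_chain_cmul singular_chain_sum singular_chain_rot_power)
        (auto simp: singular_chain_of)
    have "chain_map p \<rho> ?N = ?N"
      using rot_norm_diff_commute[of p "frag_of \<sigma>"] rot_diff_sum[of p "frag_of \<sigma>" r] chain_rot_power_r[of p "frag_of \<sigma>"] \<sigma>
      by (simp add: rot_diff_def rot_norm_def singular_chain_of)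
    then have "rot_diff p c' = 0"
      by (simp add: rot_diff_def c'_def chain_map_diff inv)
    moreover have "Poly_Mapping.keys c' \<subset> Poly_Mapping.keys c"
    proof -
      have "\<tau> \<in> Poly_Mapping.keys c" if "\<tau> \<in> Poly_Mapping.keys c'" for \<tau>
        using that lk lookup_rot_norm_of[OF \<sigma>, of \<tau>]
        by (auto simp: in_keys_iff c'_def lookup_minus split: if_splits)
      moreover have "\<exists>m<r. \<sigma> = simplex_map p (\<rho> ^^ m) \<sigma>"
        using simplex_map_id_gen[OF \<sigma>, of "\<lambda>x. x"] r_pos by (intro exI[of _ 0]) (simp add: id_def)
      then have "\<sigma> \<notin> Poly_Mapping.keys c'"
        using lookup_rot_norm_of[OF \<sigma>, of \<sigma>] by (simp add: in_keys_iff c'_def lookup_minus a_def)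
      ultimately show ?thesis using \<sigma>c by blast
    qed
    then have "card (Poly_Mapping.keys c') < card (Poly_Mapping.keys c)"
      by (simp add: psubset_card_mono)
    ultimately obtain b where b: "singular_chain p SS b" "c' = rot_norm p b"
      using less.hyps c' by blast
    have "c = rot_norm p (b + frag_cmul a (frag_of \<sigma>))"
      using b(2) unfolding c'_def rot_norm_def
      by (simp add: chain_map_add sum.distrib frag_cmul_sum del: chain_map_of) (simp add: algebra_simps o_def)
    moreover have "singular_chain p SS (b + frag_cmul a (frag_of \<sigma>))"
      using b(1) \<sigma> by (intro singular_chain_add singular_chain_cmul) (auto simp: singular_chain_of)
    ultimately show ?thesis by blast
  qed
qed

sublocale periodic_complex "\<lambda>p. singular_chain_set p SS" chain_boundary rot_diff rot_norm
proof
  fix p a b assume "a \<in> singular_chain_set p SS" "b \<in> singular_chain_set p SS"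
  then show "a - b \<in> singular_chain_set p SS" by (simp add: singular_chain_diff)
next
  show "chain_boundary p (a + b) = chain_boundary p a + chain_boundary p b" for p and a b :: "(nat \<Rightarrow> complex) chain"
    by (rule chain_boundary_add)
  show "rot_diff p (a + b) = rot_diff p a + rot_diff p b" for p a b
    by (rule rot_diff_add)
  show "rot_norm p (a + b) = rot_norm p a + rot_norm p b" for p a b
    by (simp add: rot_norm_def chain_map_add sum.distrib)
next
  fix p a assume a: "a \<in> singular_chain_set (Suc p) SS"
  then show "chain_boundary (Suc p) a \<in> singular_chain_set p SS"
    by (simp add: singular_chain_boundary_alt)
  show "chain_boundary p (chain_boundary (Suc p) a) = 0"
    using a by (simp add: chain_boundary_boundary_alt)
  have comm: "chain_boundary (Suc p) (chain_map (Suc p) f a) = chain_map p f (chain_boundary (Suc p) a)"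
    for f :: "_ \<Rightarrow> nat \<Rightarrow> complex"
    using a chain_boundary_chain_map[of "Suc p" SS a f] by simp
  then show "chain_boundary (Suc p) (rot_diff (Suc p) a) = rot_diff p (chain_boundary (Suc p) a)"
    by (simp add: rot_diff_def chain_boundary_diff)
  show "chain_boundary (Suc p) (rot_norm (Suc p) a) = rot_norm p (chain_boundary (Suc p) a)"
    using comm by (simp add: rot_norm_def chain_boundary_sum o_def)
next
  fix p a assume a: "a \<in> singular_chain_set p SS"
  then show "rot_diff p a \<in> singular_chain_set p SS" "rot_norm p a \<in> singular_chain_set p SS"
    using singular_chain_rot_power[of p a] singular_chain_rot_power[of p a 1]
    by (auto simp: rot_diff_def rot_norm_def intro!: singular_chain_diff singular_chain_sum)
  have 0: "rot_diff p (rot_norm p a) = 0"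
    using rot_diff_sum[of p a r] chain_rot_power_r[of p a] a by (simp add: rot_norm_def)
  then show "rot_diff p (rot_norm p a) = 0" .
  show "rot_norm p (rot_diff p a) = 0" using 0 by (simp add: rot_norm_diff_commute)
  show "\<exists>b\<in>singular_chain_set p SS. a = rot_norm p b" if "rot_diff p a = 0"
    using rot_diff_eq_0[of p a] a that by auto
  show "\<exists>b\<in>singular_chain_set p SS. a = rot_diff p b" if "rot_norm p a = 0"
    using rot_norm_eq_0[of p a] a that by auto
qed simp_all

end

section \<open>Star-shaped subsets of the sphere\<close>

abbreviation L2_norm :: "nat \<Rightarrow> (nat \<Rightarrow> complex) \<Rightarrow> real" where
  "L2_norm n v \<equiv> L2_dist n v (\<lambda>_. 0)"

definition segment_point :: "(nat \<Rightarrow> complex) \<Rightarrow> real \<times> (nat \<Rightarrow> complex) \<Rightarrow> nat \<Rightarrow> complex" where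
  "segment_point a y = (\<lambda>j. of_real (1 - fst y) * a j + of_real (fst y) * snd y j)"

definition radial_projection :: "nat \<Rightarrow> (nat \<Rightarrow> complex) \<Rightarrow> nat \<Rightarrow> complex" where
  "radial_projection n v = (\<lambda>j. v j / of_real (L2_norm n v))"

lemma L2_norm_square: "(L2_norm n v)\<^sup>2 = (\<Sum>j<n. (cmod (v j))\<^sup>2)"
  by (simp add: L2_dist_def L2_set_def sum_nonneg)

lemma L2_norm_nonneg: "0 \<le> L2_norm n v"
  by (simp add: L2_dist_def)

lemma L2_norm_pos:
  assumes "v \<in> complex_space n" "v j \<noteq> 0" shows "0 < L2_norm n v"
proof -
  have "\<not> n \<le> j" using assms unfolding complex_space_def by blast
  then have "j < n" by simp
  then have "cmod (v j - 0) \<le> L2_norm n v" by (rule coordinate_le_L2_dist)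
  then show ?thesis using assms(2) by (metis diff_zero norm_le_zero_iff not_le order_trans)
qed

lemma complex_sphere_iff: "v \<in> complex_sphere n \<longleftrightarrow> v \<in> complex_space n \<and> L2_norm n v = 1"
  using L2_norm_nonneg[of n v] L2_norm_square[of n v]
  by (auto simp: complex_sphere_def power2_eq_1_iff)

lemma radial_projection_sphere:
  assumes "v \<in> complex_space n" "v j \<noteq> 0" shows "radial_projection n v \<in> complex_sphere n"
proof -
  have "(\<Sum>j<n. (cmod (radial_projection n v j))\<^sup>2) = (\<Sum>j<n. (cmod (v j))\<^sup>2) / (L2_norm n v)\<^sup>2"
    by (simp add: radial_projection_def norm_divide power_divide sum_divide_distrib)
  also have "\<dots> = 1" using L2_norm_pos[OF assms] by (simp flip: L2_norm_square)
  finally show ?thesis using assms(1)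
    by (simp add: complex_sphere_def complex_space_def radial_projection_def)
qed

lemma segment_point_space:
  "\<lbrakk>a \<in> complex_space n; x \<in> complex_space n\<rbrakk> \<Longrightarrow> segment_point a (t, x) \<in> complex_space n"
  by (simp add: segment_point_def complex_space_def)

text \<open>Straight segments from \<open>a\<close>, pushed to the sphere by radial projection, stay in \<open>W\<close>. Excluding the
  origin keeps the projection continuous.\<close>

definition star_about :: "nat \<Rightarrow> (nat \<Rightarrow> complex) \<Rightarrow> (nat \<Rightarrow> complex) set \<Rightarrow> bool" where
  "star_about n a W \<longleftrightarrow> a \<in> W \<and> W \<subseteq> complex_sphere n \<and>
     (\<forall>x\<in>W. \<forall>t\<in>{0..1}. (\<exists>j. segment_point a (t, x) j \<noteq> 0) \<and>
        radial_projection n (segment_point a (t, x)) \<in> W)"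

lemma continuous_on_segment_point_coordinate: "continuous_on A (\<lambda>y. segment_point a y j)"
  unfolding segment_point_def
  by (intro continuous_intros continuous_on_product_then_coordinatewise[OF continuous_on_snd[OF continuous_on_id]])

lemma continuous_on_radial_projection:
  fixes f :: "'a::topological_space \<Rightarrow> nat \<Rightarrow> complex"
  assumes f: "\<And>j. continuous_on A (\<lambda>y. f y j)" and sp: "\<And>y. y \<in> A \<Longrightarrow> f y \<in> complex_space n"
    and nz: "\<And>y. y \<in> A \<Longrightarrow> \<exists>j. f y j \<noteq> 0"
  shows "continuous_on A (\<lambda>y. radial_projection n (f y))"
proof (rule continuous_on_coordinatewise_then_product)
  fix j
  have "continuous_on A (\<lambda>y. L2_norm n (f y))"
    unfolding L2_dist_def L2_set_def by (intro continuous_intros f)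
  moreover have "L2_norm n (f y) \<noteq> 0" if "y \<in> A" for y
    using nz[OF that] L2_norm_pos[OF sp[OF that]] by force
  ultimately show "continuous_on A (\<lambda>y. radial_projection n (f y) j)"
    unfolding radial_projection_def by (intro continuous_intros f) auto
qed

lemma radial_projection_sphere_id: "x \<in> complex_sphere n \<Longrightarrow> radial_projection n x = x"
  by (simp add: radial_projection_def complex_sphere_iff)

lemma star_contraction:
  assumes "star_about n a W"
  shows "\<exists>H. continuous_on ({0..1::real} \<times> W) H \<and> H ` ({0..1} \<times> W) \<subseteq> W \<and>
     (\<forall>x\<in>W. H (0, x) = a \<and> H (1, x) = x)"
proof -
  let ?H = "\<lambda>y. radial_projection n (segment_point a y)"
  have W: "a \<in> W" "W \<subseteq> complex_sphere n" using assms by (auto simp: star_about_def)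
  then have sp: "a \<in> complex_space n" "\<And>x. x \<in> W \<Longrightarrow> x \<in> complex_space n"
    by (auto simp: complex_sphere_def)
  have "continuous_on ({0..1} \<times> W) ?H"
    by (rule continuous_on_radial_projection[OF continuous_on_segment_point_coordinate])
      (use assms sp segment_point_space in \<open>auto simp: star_about_def\<close>)
  moreover have "?H ` ({0..1} \<times> W) \<subseteq> W" using assms by (auto simp: star_about_def)
  moreover have "?H (0, x) = a \<and> ?H (1, x) = x" if "x \<in> W" for x
    using that W radial_projection_sphere_id[of a n] radial_projection_sphere_id[of x n]
    by (auto simp: segment_point_def)
  ultimately show ?thesis by - (rule exI[of _ ?H], blast)
qed

lemma contractible_space_star:
  assumes "star_about n a W" shows "contractible_space (top_of_set W)"
proof -
  obtain H where H: "continuous_on ({0..1::real} \<times> W) H" "H ` ({0..1} \<times> W) \<subseteq> W"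
    "\<And>x. x \<in> W \<Longrightarrow> H (0, x) = a" "\<And>x. x \<in> W \<Longrightarrow> H (1, x) = x"
    using star_contraction[OF assms] by blast
  have "continuous_map (prod_topology (top_of_set {0..1}) (top_of_set W)) (top_of_set W) H"
    using H(1,2) by (auto simp: image_subset_iff)
  then have "homotopic_with (\<lambda>x. True) (top_of_set W) (top_of_set W) (\<lambda>x. a) id"
    by (subst homotopic_with) (use H(3,4) in \<open>auto intro: exI[of _ H]\<close>)
  then show ?thesis unfolding contractible_space_def using homotopic_with_sym by blast
qed

text \<open>For \<open>m = 0\<close> and \<open>\<sigma> = 1, - 1\<close> these are two opposite hemispheres; they meet in the equator, which is
  the union of the two sets for \<open>m = 1\<close>. So the same lemmas give the contractibility of the
  hemispheres and the connectedness of sphere and equator.\<close>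

definition hemisphere :: "nat \<Rightarrow> nat \<Rightarrow> real \<Rightarrow> (nat \<Rightarrow> complex) set" where
  "hemisphere n m \<sigma> = {x \<in> complex_sphere n. (\<forall>j<m. Re (x j) = 0) \<and> 0 \<le> \<sigma> * Re (x m)}"

definition pole :: "nat \<Rightarrow> complex \<Rightarrow> nat \<Rightarrow> complex" where
  "pole m c = (\<lambda>j. if j = m then c else 0)"

lemma pole_sphere: "\<lbrakk>m < n; cmod c = 1\<rbrakk> \<Longrightarrow> pole m c \<in> complex_sphere n"
proof -
  assume "m < n" "cmod c = 1"
  then have "(cmod (pole m c j))\<^sup>2 = (if j = m then 1 else 0)" for j by (simp add: pole_def)
  then show ?thesis using \<open>m < n\<close> by (auto simp: pole_def complex_sphere_def complex_space_def)
qed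

lemma star_hemisphere:
  assumes "m < n" and \<sigma>: "\<sigma> = 1 \<or> \<sigma> = - 1"
  shows "star_about n (pole m (of_real \<sigma>)) (hemisphere n m \<sigma>)"
  unfolding star_about_def
proof (intro conjI ballI)
  let ?a = "pole m (of_real \<sigma>)"
  have a: "?a \<in> complex_sphere n" by (rule pole_sphere) (use assms in auto)
  then show "?a \<in> hemisphere n m \<sigma>" using \<sigma> by (auto simp: hemisphere_def pole_def)
  show "hemisphere n m \<sigma> \<subseteq> complex_sphere n" by (auto simp: hemisphere_def)
  fix x t assume x: "x \<in> hemisphere n m \<sigma>" and t: "t \<in> {0..1::real}"
  let ?v = "segment_point ?a (t, x)"
  have re: "\<sigma> * Re (?v m) = (1 - t) + t * (\<sigma> * Re (x m))"
    using \<sigma> by (auto simp: segment_point_def pole_def)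
  have "\<exists>j. x j \<noteq> 0"
    using x by (auto simp: hemisphere_def complex_sphere_def intro: ccontr)
  then show nz: "\<exists>j. ?v j \<noteq> 0"
  proof (cases "t = 1")
    case False
    then have "0 < \<sigma> * Re (?v m)" using t x unfolding re by (auto simp: hemisphere_def intro!: add_pos_nonneg)
    then show ?thesis by (intro exI[of _ m]) auto
  qed (auto simp: segment_point_def)
  have sp: "?v \<in> complex_space n"
    using a x by (intro segment_point_space) (auto simp: hemisphere_def complex_sphere_def)
  have "Re (radial_projection n ?v j) = Re (?v j) / L2_norm n ?v" for j
    by (simp add: radial_projection_def)
  moreover have "0 \<le> \<sigma> * Re (?v m)" using t x unfolding re by (auto simp: hemisphere_def)
  moreover have "Re (?v j) = 0" if "j < m" for j
    using x that by (auto simp: segment_point_def pole_def hemisphere_def)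
  ultimately show "radial_projection n ?v \<in> hemisphere n m \<sigma>"
    using radial_projection_sphere[OF sp] nz L2_norm_nonneg[of n ?v] by (auto simp: hemisphere_def)
qed

lemma path_connectedin_hemispheres:
  assumes "m < n"
  shows "path_connectedin euclidean (hemisphere n m 1 \<union> hemisphere n m (- 1))"
proof (rule path_connectedin_Un)
  have "path_connectedin euclidean (hemisphere n m \<sigma>)" if "\<sigma> = 1 \<or> \<sigma> = - 1" for \<sigma>
    using contractible_imp_path_connected_space[OF contractible_space_star[OF star_hemisphere[OF assms that]]]
    by (simp add: path_connectedin_def)
  then show "path_connectedin euclidean (hemisphere n m 1)" "path_connectedin euclidean (hemisphere n m (- 1))"
    by auto
  have "pole m \<i> \<in> hemisphere n m 1 \<inter> hemisphere n m (- 1)"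
    using pole_sphere[OF assms, of \<i>] by (auto simp: hemisphere_def pole_def)
  then show "hemisphere n m 1 \<inter> hemisphere n m (- 1) \<noteq> {}" by blast
qed

lemma sphere_eq_hemispheres: "complex_sphere n = hemisphere n 0 1 \<union> hemisphere n 0 (- 1)"
  by (auto simp: hemisphere_def)

lemma equator_eq_hemispheres:
  "hemisphere n 0 1 \<inter> hemisphere n 0 (- 1) = hemisphere n 1 1 \<union> hemisphere n 1 (- 1)"
  by (auto simp: hemisphere_def)

lemma path_connected_space_sphere:
  "0 < n \<Longrightarrow> path_connected_space (top_of_set (complex_sphere n))"
  using path_connectedin_hemispheres[of 0 n] unfolding sphere_eq_hemispheres path_connectedin_def by simp

lemma connected_sphere: "0 < n \<Longrightarrow> connected (complex_sphere n)"
  using path_connectedin_imp_connectedin[OF path_connectedin_hemispheres[of 0 n]]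
  by (simp add: sphere_eq_hemispheres)

lemma connected_equator: "1 < n \<Longrightarrow> connected (hemisphere n 0 1 \<inter> hemisphere n 0 (- 1))"
  using path_connectedin_imp_connectedin[OF path_connectedin_hemispheres[of 1 n]]
  by (simp add: equator_eq_hemispheres)

lemma closed_complex_space: "closed (complex_space n)"
proof -
  have "complex_space n = (\<Inter>j\<in>{n..}. {z. z j = 0})" by (auto simp: complex_space_def)
  then show ?thesis by (auto intro!: closed_Collect_eq continuous_intros)
qed

lemma compact_sphere: "compact (complex_sphere n)"
proof -
  have "compactin (product_topology (\<lambda>_. euclidean) UNIV) (UNIV \<rightarrow>\<^sub>E cball (0::complex) 1)"
    by (simp add: compactin_PiE)
  then have "compact ((UNIV::nat set) \<rightarrow>\<^sub>E cball (0::complex) 1)"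
    by (simp add: euclidean_product_topology)
  moreover have "closed (complex_sphere n)"
  proof -
    have "complex_sphere n = complex_space n \<inter> {z. (\<Sum>j<n. (cmod (z j))\<^sup>2) = 1}"
      by (auto simp: complex_sphere_def)
    then show ?thesis
      by (auto intro!: closed_Int closed_complex_space closed_Collect_eq continuous_intros)
  qed
  moreover have "complex_sphere n \<subseteq> (UNIV \<rightarrow>\<^sub>E cball 0 1)"
  proof
    fix z assume z: "z \<in> complex_sphere n"
    have "cmod (z j) \<le> 1" for j
    proof (cases "j < n")
      case True
      then show ?thesis using coordinate_le_L2_dist[of j n z "\<lambda>_. 0"] z by (simp add: complex_sphere_iff)
    qed (use z in \<open>simp add: complex_sphere_def complex_space_def\<close>)
    then show "z \<in> UNIV \<rightarrow>\<^sub>E cball 0 1" by auto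
  qed
  ultimately show ?thesis using compact_Int_closed by (metis inf.absorb_iff2)
qed

lemma compact_hemisphere: "compact (hemisphere n m \<sigma>)"
proof -
  have "hemisphere n m \<sigma> = complex_sphere n \<inter> ((\<Inter>j\<in>{..<m}. {z. Re (z j) = 0}) \<inter> {z. 0 \<le> \<sigma> * Re (z m)})"
    by (auto simp: hemisphere_def)
  moreover have "closed ((\<Inter>j\<in>{..<m}. {z::nat \<Rightarrow> complex. Re (z j) = 0}) \<inter> {z. 0 \<le> \<sigma> * Re (z m)})"
    by (auto intro!: closed_Int closed_INT closed_Collect_eq closed_Collect_le continuous_intros)
  ultimately show ?thesis using compact_Int_closed[OF compact_sphere] by metis
qed

definition re_inner :: "nat \<Rightarrow> (nat \<Rightarrow> complex) \<Rightarrow> (nat \<Rightarrow> complex) \<Rightarrow> real" where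
  "re_inner n c v = (\<Sum>j<n. Re (cnj (c j) * v j))"

lemma L2_dist_square: "(L2_dist n c v)\<^sup>2 = (L2_norm n c)\<^sup>2 + (L2_norm n v)\<^sup>2 - 2 * re_inner n c v"
proof -
  have "(cmod (c j - v j))\<^sup>2 = (cmod (c j))\<^sup>2 + (cmod (v j))\<^sup>2 - 2 * Re (cnj (c j) * v j)" for j
    unfolding cmod_power2 by (simp add: power2_eq_square algebra_simps)
  then have "(\<Sum>j<n. (cmod (c j - v j))\<^sup>2) = (\<Sum>j<n. (cmod (c j))\<^sup>2) + (\<Sum>j<n. (cmod (v j))\<^sup>2) - 2 * re_inner n c v"
    by (simp add: re_inner_def sum.distrib sum_subtractf sum_distrib_left)
  moreover have "(L2_dist n c v)\<^sup>2 = (\<Sum>j<n. (cmod (c j - v j))\<^sup>2)"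
    unfolding L2_dist_def L2_set_def by (simp add: sum_nonneg)
  ultimately show ?thesis by (simp only: L2_norm_square)
qed

lemma L2_dist_less_iff:
  assumes "c \<in> complex_sphere n" "v \<in> complex_sphere n" "e > 0"
  shows "L2_dist n c v < e \<longleftrightarrow> 1 - e\<^sup>2 / 2 < re_inner n c v"
proof -
  have "L2_dist n c v < e \<longleftrightarrow> (L2_dist n c v)\<^sup>2 < e\<^sup>2"
    using power_mono_iff[of e "L2_dist n c v" 2] assms(3) by (auto simp: L2_dist_def simp flip: not_le)
  then show ?thesis 
    using L2_dist_square[of n c v] assms(1,2) unfolding complex_sphere_iff by auto
qed

lemma re_inner_segment_point:
  "re_inner n c (segment_point a (t, x)) = (1 - t) * re_inner n c a + t * re_inner n c x"
proof -
  have "Re (cnj (c j) * segment_point a (t, x) j) = (1 - t) * Re (cnj (c j) * a j) + t * Re (cnj (c j) * x j)" for j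
    by (simp add: segment_point_def algebra_simps)
  then show ?thesis by (simp only: re_inner_def sum.distrib sum_distrib_left)
qed

lemma L2_norm_segment_point_le:
  assumes "a \<in> complex_sphere n" "x \<in> complex_sphere n" "0 \<le> t" "t \<le> 1"
  shows "L2_norm n (segment_point a (t, x)) \<le> 1"
proof -
  have "L2_norm n (segment_point a (t, x)) \<le> L2_set (\<lambda>j. (1 - t) * cmod (a j) + t * cmod (x j)) {..<n}"
    unfolding L2_dist_def
  proof (rule L2_set_mono)
    fix j
    have "cmod (segment_point a (t, x) j) \<le> cmod (of_real (1 - t) * a j) + cmod (of_real t * x j)"
      unfolding segment_point_def fst_conv snd_conv by (rule norm_triangle_ineq)
    then show "cmod (segment_point a (t, x) j - 0) \<le> (1 - t) * cmod (a j) + t * cmod (x j)"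
      using assms by (simp only: norm_mult norm_of_real) simp
  qed simp
  also have "\<dots> \<le> L2_set (\<lambda>j. (1 - t) * cmod (a j)) {..<n} + L2_set (\<lambda>j. t * cmod (x j)) {..<n}"
    by (rule L2_set_triangle_ineq)
  also have "\<dots> = (1 - t) * L2_norm n a + t * L2_norm n x"
    using assms by (simp add: L2_set_right_distrib L2_dist_def)
  also have "\<dots> = 1" using assms by (simp add: complex_sphere_iff)
  finally show ?thesis .
qed

text \<open>A cap of radius \<open>e \<le> 1\<close> is cut out of the sphere by a linear inequality with a positive bound. Such an
  inequality holds along segments. The points of a segment have norm at most \<open>1\<close>, so the radial
  projection only increases the left-hand side.\<close>

lemma star_caps:
  assumes e: "0 < e" "e \<le> 1" and F: "F \<subseteq> complex_sphere n" "F \<noteq> {}"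
    and a: "a \<in> {v \<in> complex_sphere n. \<forall>c\<in>F. L2_dist n c v < e}"
  shows "star_about n a {v \<in> complex_sphere n. \<forall>c\<in>F. L2_dist n c v < e}"
  unfolding star_about_def
proof (intro conjI ballI)
  let ?W = "{v \<in> complex_sphere n. \<forall>c\<in>F. L2_dist n c v < e}"
  show "a \<in> ?W" by (rule a)
  show "?W \<subseteq> complex_sphere n" by auto
  fix x t assume x: "x \<in> ?W" and t: "t \<in> {0..1::real}"
  let ?v = "segment_point a (t, x)"
  have "e\<^sup>2 \<le> 1" using e by (simp add: power_le_one)
  then have \<kappa>: "0 < 1 - e\<^sup>2 / 2" by simp
  have ip: "1 - e\<^sup>2 / 2 < re_inner n c ?v" if c: "c \<in> F" for c
  proof -
    have "c \<in> complex_sphere n" using c F(1) by blast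
    then have "1 - e\<^sup>2 / 2 < re_inner n c a" "1 - e\<^sup>2 / 2 < re_inner n c x"
      using a x c L2_dist_less_iff[of c n a e] L2_dist_less_iff[of c n x e] e(1) by blast+
    then show ?thesis
      using t convex_bound_lt[of "- re_inner n c a" "- (1 - e\<^sup>2 / 2)" "- re_inner n c x" "1 - t" t]
      by (simp add: re_inner_segment_point)
  qed
  obtain c where c: "c \<in> F" using F(2) by blast
  show nz: "\<exists>j. ?v j \<noteq> 0"
  proof (rule ccontr)
    assume "\<nexists>j. ?v j \<noteq> 0"
    then have "re_inner n c ?v = 0" by (simp add: re_inner_def)
    then show False using ip[OF c] \<kappa> by simp
  qed
  then obtain j where j: "?v j \<noteq> 0" by blast
  have sp: "?v \<in> complex_space n"
    using a x by (intro segment_point_space) (auto simp: complex_sphere_def)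
  have pos: "0 < L2_norm n ?v" by (rule L2_norm_pos[OF sp j])
  have le: "L2_norm n ?v \<le> 1" using a x t by (intro L2_norm_segment_point_le) auto
  have proj: "radial_projection n ?v \<in> complex_sphere n" by (rule radial_projection_sphere[OF sp j])
  moreover have "L2_dist n c (radial_projection n ?v) < e" if c: "c \<in> F" for c
  proof -
    have "re_inner n c (radial_projection n ?v) = re_inner n c ?v / L2_norm n ?v"
      by (simp add: re_inner_def radial_projection_def sum_divide_distrib flip: of_real_divide)
    moreover have "re_inner n c ?v \<le> re_inner n c ?v / L2_norm n ?v"
      using pos le ip[OF c] \<kappa> by (simp add: le_divide_eq mult_left_le)
    ultimately have "1 - e\<^sup>2 / 2 < re_inner n c (radial_projection n ?v)" using ip[OF c] by linarith
    then show ?thesis using L2_dist_less_iff[of c n] proj F(1) c e(1) by auto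
  qed
  ultimately show "radial_projection n ?v \<in> ?W" by blast
qed

section \<open>The degree of a self-map of the sphere\<close>

lemma homology_class_int_pow:
  assumes c: "singular_relcycle p X {} c"
  shows "homologous_rel_set p X {} c [^]\<^bsub>homology_group (int p) X\<^esub> (k::int)
       = homologous_rel_set p X {} (frag_cmul k c)"
proof -
  have sc: "singular_chain p X c" using c by (simp add: singular_cycle)
  have "c \<in> carrier (subgroup_generated (free_Abelian_group (singular_simplex_set p X)) (singular_relcycle_set p X {}))"
    by (metis c carrier_relcycle_group chain_group_def mem_Collect_eq relcycle_group_def)
  then have pow: "c [^]\<^bsub>relcycle_group p X {}\<^esub> k = frag_cmul k c"
    using sc by (simp add: relcycle_group_def chain_group_def group.int_pow_subgroup_generated singular_chain_def)
  show ?thesis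
    by (rule subst[OF right_coset_singular_relboundary])
      (simp add: pow normal.FactGroup_int_pow normal_subgroup_singular_relboundary_relcycle
        relative_homology_group_def c)
qed

definition real_coordinates :: "(nat \<Rightarrow> complex) \<Rightarrow> nat \<Rightarrow> real" where
  "real_coordinates z i = (if even i then Re (z (i div 2)) else Im (z (i div 2)))"

definition complex_coordinates :: "(nat \<Rightarrow> real) \<Rightarrow> nat \<Rightarrow> complex" where
  "complex_coordinates x j = Complex (x (2 * j)) (x (2 * j + 1))"

lemma complex_real_coordinates [simp]: "complex_coordinates (real_coordinates z) = z"
  by (simp add: complex_coordinates_def real_coordinates_def fun_eq_iff complex_eq_iff)

lemma real_complex_coordinates [simp]: "real_coordinates (complex_coordinates x) = x"
proof
  fix i show "real_coordinates (complex_coordinates x) i = x i"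
    by (cases "even i") (auto simp: real_coordinates_def complex_coordinates_def elim!: oddE evenE)
qed

lemma sum_pairs: "(\<Sum>i<2 * n. f i) = (\<Sum>j<n. f (2 * j) + f (2 * j + 1))"
  for f :: "nat \<Rightarrow> 'a::comm_monoid_add"
  by (induction n) (simp_all add: add.assoc)

lemma nsphere_top_of_set:
  "nsphere d = top_of_set {x. (\<Sum>i\<le>d. (x i)\<^sup>2) = 1 \<and> (\<forall>i>d. x i = 0)}"
  by (simp add: nsphere euclidean_product_topology)

lemma homeomorphic_maps_coordinates:
  assumes "0 < n"
  shows "homeomorphic_maps (top_of_set (complex_sphere n)) (nsphere (2 * n - 1))
           real_coordinates complex_coordinates"
proof -
  let ?N = "{x. (\<Sum>i\<le>2 * n - 1. (x i)\<^sup>2) = 1 \<and> (\<forall>i>2 * n - 1. x i = (0::real))}"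
  have d: "{..2 * n - 1} = {..<2 * n}" using assms by auto
  have mem: "real_coordinates z \<in> ?N \<longleftrightarrow> z \<in> complex_sphere n" for z
  proof -
    have "(\<Sum>i\<le>2 * n - 1. (real_coordinates z i)\<^sup>2) = (\<Sum>j<n. (cmod (z j))\<^sup>2)"
      unfolding d sum_pairs by (simp add: real_coordinates_def cmod_power2)
    moreover have "(\<forall>i>2 * n - 1. real_coordinates z i = 0) \<longleftrightarrow> z \<in> complex_space n"
    proof
      assume h: "\<forall>i>2 * n - 1. real_coordinates z i = 0"
      have "z j = 0" if "n \<le> j" for j
        using h[rule_format, of "2 * j"] h[rule_format, of "2 * j + 1"] that assms
        by (simp add: real_coordinates_def complex_eq_iff)
      then show "z \<in> complex_space n" by (simp add: complex_space_def)
    next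
      assume h: "z \<in> complex_space n"
      show "\<forall>i>2 * n - 1. real_coordinates z i = 0"
      proof (intro allI impI)
        fix i assume "2 * n - 1 < i"
        then have "n \<le> i div 2" by linarith
        then show "real_coordinates z i = 0" using h by (simp add: complex_space_def real_coordinates_def)
      qed
    qed
    ultimately show ?thesis by (auto simp: complex_sphere_def)
  qed
  have mem': "complex_coordinates x \<in> complex_sphere n \<longleftrightarrow> x \<in> ?N" for x
    using mem[of "complex_coordinates x"] by simp
  have "continuous_on (complex_sphere n) real_coordinates"
  proof (rule continuous_on_coordinatewise_then_product)
    fix i show "continuous_on (complex_sphere n) (\<lambda>x. real_coordinates x i)"
      by (cases "even i") (auto simp: real_coordinates_def intro!: continuous_intros)
  qed
  moreover have "continuous_on ?N complex_coordinates"
  proof (rule continuous_on_coordinatewise_then_product)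
    fix j show "continuous_on ?N (\<lambda>x. complex_coordinates x j)"
      unfolding complex_coordinates_def Complex_eq by (intro continuous_intros)
  qed
  ultimately show ?thesis
    unfolding homeomorphic_maps_def nsphere_top_of_set
    using mem mem' by (auto simp: continuous_map_in_subtopology)
qed

definition conjugate_first :: "(nat \<Rightarrow> complex) \<Rightarrow> nat \<Rightarrow> complex" where
  "conjugate_first z = z(0 := cnj (z 0))"

context
  fixes n :: nat
  assumes n: "0 < n"
begin

lemma homeomorphic_sphere_nsphere: "top_of_set (complex_sphere n) homeomorphic_space nsphere (2 * n - 1)"
  using homeomorphic_maps_coordinates[OF n] unfolding homeomorphic_space_def by blast

lemma trivial_homology_sphere:
  assumes "p \<noteq> 0" "p \<noteq> 2 * n - 1"
  shows "trivial_group (homology_group (int p) (top_of_set (complex_sphere n)))"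
proof -
  have "trivial_group (reduced_homology_group (int p) (nsphere (2 * n - 1)))"
    using assms(2) by (intro reduced_homology_group_nsphere(2)) simp
  then have "trivial_group (homology_group (int p) (nsphere (2 * n - 1)))"
    using assms(1) by (simp add: un_reduced_homology_group)
  then show ?thesis
    using isomorphic_group_triviality[OF homeomorphic_space_imp_isomorphic_homology_groups[OF homeomorphic_sphere_nsphere]]
    by simp
qed

lemma homology_sphere_top:
  "homology_group (int (2 * n - 1)) (top_of_set (complex_sphere n)) \<cong> integer_group"
proof -
  have "homology_group (int (2 * n - 1)) (nsphere (2 * n - 1)) \<cong> integer_group"
    using reduced_homology_group_nsphere(1)[of "2 * n - 1"] n by (simp add: un_reduced_homology_group)
  then show ?thesis
    using homeomorphic_space_imp_isomorphic_homology_groups[OF homeomorphic_sphere_nsphere, of "int (2 * n - 1)"]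
    by (rule iso_trans[rotated])
qed

text \<open>Brouwer's degree for the unit sphere of \<open>\<real>\<close>-dimension \<open>2 n - 1\<close>, transported along the identification
  of \<open>n\<close> complex coordinates with \<open>2 n\<close> real ones.\<close>

definition sphere_degree :: "((nat \<Rightarrow> complex) \<Rightarrow> nat \<Rightarrow> complex) \<Rightarrow> int" where
  "sphere_degree f = Brouwer_degree2 (2 * n - 1) (real_coordinates \<circ> f \<circ> complex_coordinates)"

abbreviation (input) sphere where "sphere \<equiv> top_of_set (complex_sphere n)"

lemma continuous_map_coordinates:
  "continuous_map sphere (nsphere (2 * n - 1)) real_coordinates"
  "continuous_map (nsphere (2 * n - 1)) sphere complex_coordinates"
  using homeomorphic_maps_coordinates[OF n] by (auto simp: homeomorphic_maps_def)

lemma continuous_map_conjugated: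
  "continuous_map sphere sphere f \<Longrightarrow>
   continuous_map (nsphere (2 * n - 1)) (nsphere (2 * n - 1)) (real_coordinates \<circ> f \<circ> complex_coordinates)"
  by (intro continuous_map_compose[OF _ continuous_map_coordinates(1)] continuous_map_compose[OF continuous_map_coordinates(2)])

lemma hom_induced_sphere:
  assumes f: "continuous_map sphere sphere f"
    and x: "x \<in> carrier (homology_group (int (2 * n - 1)) sphere)"
  shows "hom_induced (int (2 * n - 1)) sphere {} sphere {} f x
       = x [^]\<^bsub>homology_group (int (2 * n - 1)) sphere\<^esub> sphere_degree f"
proof -
  let ?d = "int (2 * n - 1)" and ?N = "nsphere (2 * n - 1)"
  let ?g = "real_coordinates \<circ> f \<circ> complex_coordinates"
  let ?\<phi> = "hom_induced ?d sphere {} ?N {} real_coordinates"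
  let ?\<psi> = "hom_induced ?d ?N {} sphere {} complex_coordinates"
  have rh: "reduced_homology_group ?d ?N = homology_group ?d ?N"
    using n by (intro un_reduced_homology_group) simp
  have \<phi>x: "?\<phi> x \<in> carrier (homology_group ?d ?N)" by (rule hom_induced_carrier)
  note c = continuous_map_coordinates
  have "hom_induced ?d sphere {} sphere {} f x = hom_induced ?d sphere {} sphere {} (complex_coordinates \<circ> (?g \<circ> real_coordinates)) x"
    by (simp add: o_def)
  also have "\<dots> = ?\<psi> (hom_induced ?d ?N {} ?N {} ?g (?\<phi> x))"
    using hom_induced_compose_empty[OF c(1) continuous_map_conjugated[OF f]]
      hom_induced_compose_empty[OF continuous_map_compose[OF c(1) continuous_map_conjugated[OF f]] c(2)]
    by simp
  also have "\<dots> = ?\<psi> (?\<phi> x [^]\<^bsub>homology_group ?d ?N\<^esub> sphere_degree f)"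
    using Brouwer_degree2[of "?\<phi> x" "2 * n - 1" ?g] \<phi>x by (simp only: rh sphere_degree_def)
  also have "\<dots> = ?\<psi> (?\<phi> x) [^]\<^bsub>homology_group ?d sphere\<^esub> sphere_degree f"
    using hom_int_pow[OF hom_induced_empty_hom \<phi>x] by simp
  also have "?\<psi> (?\<phi> x) = hom_induced ?d sphere {} sphere {} id x"
    using hom_induced_compose_empty[OF c] by (simp add: o_def id_def fun_eq_iff)
  also have "\<dots> = x" by (rule hom_induced_id[OF x])
  finally show ?thesis .
qed

lemma homologous_chain_map_sphere:
  assumes f: "continuous_map sphere sphere f" and y: "singular_relcycle (2 * n - 1) sphere {} y"
  shows "homologous_rel (2 * n - 1) sphere {} (chain_map (2 * n - 1) f y) (frag_cmul (sphere_degree f) y)"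
proof -
  have "homologous_rel_set (2 * n - 1) sphere {} y \<in> carrier (homology_group (int (2 * n - 1)) sphere)"
    using y unfolding carrier_relative_homology_group by blast
  from hom_induced_sphere[OF f this] hom_induced_chain_map[OF f _ y, of "{}"] homology_class_int_pow[OF y]
  show ?thesis by (simp flip: homologous_rel_set_eq)
qed

lemma sphere_degree_cong:
  "(\<And>x. x \<in> complex_sphere n \<Longrightarrow> f x = g x) \<Longrightarrow> sphere_degree f = sphere_degree g"
  unfolding sphere_degree_def
  using continuous_map_coordinates(2) by (intro Brouwer_degree2_eq) (auto simp: continuous_map_def Pi_iff)

lemma sphere_degree_compose:
  assumes "continuous_map sphere sphere f" "continuous_map sphere sphere g"
  shows "sphere_degree (g \<circ> f) = sphere_degree g * sphere_degree f"
proof -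
  have "real_coordinates \<circ> (g \<circ> f) \<circ> complex_coordinates
      = (real_coordinates \<circ> g \<circ> complex_coordinates) \<circ> (real_coordinates \<circ> f \<circ> complex_coordinates)"
    by (simp add: o_def)
  then show ?thesis
    unfolding sphere_degree_def using assms by (simp only: Brouwer_degree2_compose continuous_map_conjugated)
qed

lemma sphere_degree_id: "sphere_degree id = 1"
proof -
  have "real_coordinates \<circ> id \<circ> complex_coordinates = id" by (simp add: o_def id_def)
  then show ?thesis by (simp add: sphere_degree_def)
qed

lemma sphere_degree_funpow:
  assumes f: "continuous_map sphere sphere f"
  shows "continuous_map sphere sphere (f ^^ m) \<and> sphere_degree (f ^^ m) = sphere_degree f ^ m"
proof (induction m)
  case 0
  then show ?case using sphere_degree_id by (simp add: id_def)
next
  case (Suc m)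
  then have fm: "continuous_map sphere sphere (f ^^ m)" by blast
  have "sphere_degree (f \<circ> f ^^ m) = sphere_degree f ^ Suc m"
    using Suc sphere_degree_compose[OF fm f] by simp
  then show ?case
    unfolding funpow.simps(2) using continuous_map_compose[OF fm f] by blast
qed

lemma sphere_degree_homotopic:
  assumes "homotopic_with (\<lambda>x. True) sphere sphere f g"
  shows "sphere_degree f = sphere_degree g"
proof -
  have "homotopic_with (\<lambda>x. True) (nsphere (2 * n - 1)) sphere (f \<circ> complex_coordinates) (g \<circ> complex_coordinates)"
    by (rule homotopic_with_compose_continuous_map_right[OF assms continuous_map_coordinates(2)]) simp
  then have "homotopic_with (\<lambda>x. True) (nsphere (2 * n - 1)) (nsphere (2 * n - 1))
      (real_coordinates \<circ> (f \<circ> complex_coordinates)) (real_coordinates \<circ> (g \<circ> complex_coordinates))"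
    by (rule homotopic_with_compose_continuous_map_left[OF _ continuous_map_coordinates(1)]) simp
  then show ?thesis
    unfolding sphere_degree_def o_assoc by (rule Brouwer_degree2_homotopic)
qed

lemma sphere_degree_homotopyI:
  assumes cont: "\<And>j. j < n \<Longrightarrow> continuous_on ({0..1} \<times> complex_sphere n) (\<lambda>y. h (fst y) (snd y) j)"
    and im: "\<And>t x. \<lbrakk>t \<in> {0..1::real}; x \<in> complex_sphere n\<rbrakk> \<Longrightarrow> h t x \<in> complex_sphere n"
  shows "sphere_degree (h 0) = sphere_degree (h 1)"
proof (rule sphere_degree_homotopic)
  have "continuous_on ({0..1} \<times> complex_sphere n) (\<lambda>y. h (fst y) (snd y))"
  proof (rule continuous_on_coordinatewise_then_product)
    fix j show "continuous_on ({0..1} \<times> complex_sphere n) (\<lambda>y. h (fst y) (snd y) j)"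
    proof (cases "j < n")
      case False
      then have "h (fst y) (snd y) j = 0" if "y \<in> {0..1} \<times> complex_sphere n" for y
        using that im[of "fst y" "snd y"] by (auto simp: complex_sphere_def complex_space_def)
      then show ?thesis by (simp cong: continuous_on_cong)
    qed (rule cont)
  qed
  then have "continuous_map (prod_topology (top_of_set {0..1}) sphere) sphere (\<lambda>y. h (fst y) (snd y))"
    using im by (auto simp: continuous_map_in_subtopology)
  then show "homotopic_with (\<lambda>x. True) sphere sphere (h 0) (h 1)"
    by (subst homotopic_with) (auto intro: exI[of _ "\<lambda>y. h (fst y) (snd y)"])
qed

lemma continuous_on_snd_coordinate: "continuous_on A (\<lambda>y. snd y j)"
  for A :: "('a::topological_space \<times> (nat \<Rightarrow> 'b::topological_space)) set"
  by (rule continuous_on_product_then_coordinatewise[OF continuous_on_snd[OF continuous_on_id]])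

lemma fun_upd_sphere:
  assumes "z \<in> complex_sphere n" "cmod c = cmod (z 0)"
  shows "z(0 := c) \<in> complex_sphere n"
proof -
  have "(\<Sum>j<n. (cmod ((z(0 := c)) j))\<^sup>2) = (\<Sum>j<n. (cmod (z j))\<^sup>2)"
    by (rule sum.cong) (use assms(2) in auto)
  then show ?thesis using assms(1) n by (auto simp: complex_sphere_def complex_space_def)
qed

lemma sphere_degree_conjugate_first: "sphere_degree conjugate_first = -1"
proof -
  \<comment> \<open>Half a turn changes \<open>cnj\<close> into its negative, which reflects the first real coordinate.\<close>
  define h where "h t z = z(0 := exp (pi * \<i> * of_real t) * cnj (z 0))" for t and z :: "nat \<Rightarrow> complex"
  have "h 0 = conjugate_first" by (simp add: h_def conjugate_first_def fun_eq_iff)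
  moreover have "sphere_degree (h 0) = sphere_degree (h 1)"
  proof (rule sphere_degree_homotopyI)
    fix j
    show "continuous_on ({0..1} \<times> complex_sphere n) (\<lambda>y. h (fst y) (snd y) j)"
      by (cases "j = 0") (auto simp: h_def intro!: continuous_intros continuous_on_snd_coordinate)
  next
    fix t :: real and z assume "z \<in> complex_sphere n"
    then show "h t z \<in> complex_sphere n"
      unfolding h_def by (rule fun_upd_sphere) (simp add: norm_mult)
  qed
  moreover have "sphere_degree (h 1) = -1"
  proof -
    have "(real_coordinates \<circ> h 1 \<circ> complex_coordinates) x i = (if i = 0 then - x i else x i)" for x i
    proof (cases "i < 2")
      case True
      then consider "i = 0" | "i = 1" by linarith
      then show ?thesis by cases (simp_all add: real_coordinates_def h_def complex_coordinates_def)
    next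
      case False
      then have "i div 2 \<noteq> 0" by simp
      then have "(real_coordinates \<circ> h 1 \<circ> complex_coordinates) x i = real_coordinates (complex_coordinates x) i"
        by (simp add: real_coordinates_def h_def del: real_complex_coordinates)
      then show ?thesis using False by simp
    qed
    then have "real_coordinates \<circ> h 1 \<circ> complex_coordinates = (\<lambda>x i. if i = 0 then - x i else x i)"
      by (simp add: fun_eq_iff)
    then show ?thesis unfolding sphere_degree_def by (simp only: Brouwer_degree2_reflection)
  qed
  ultimately show ?thesis by simp
qed

lemma permute_sphere:
  assumes "\<pi> permutes {..<n}" and z: "z \<in> complex_sphere n"
  shows "z \<circ> \<pi> \<in> complex_sphere n"
proof -
  have "(\<Sum>j<n. (cmod (z (\<pi> j)))\<^sup>2) = (\<Sum>j<n. (cmod (z j))\<^sup>2)"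
    using sum.permute[OF assms(1), of "\<lambda>j. (cmod (z j))\<^sup>2"] by (simp add: o_def)
  moreover have "\<pi> j = j" if "n \<le> j" for j using assms(1) that by (simp add: permutes_def)
  ultimately show ?thesis using z by (auto simp: complex_sphere_def complex_space_def)
qed

lemma continuous_map_permute:
  assumes "\<pi> permutes {..<n}"
  shows "continuous_map sphere sphere (\<lambda>z. z \<circ> \<pi>)"
proof -
  have "continuous_on (complex_sphere n) (\<lambda>z. z \<circ> \<pi>)"
    by (rule continuous_on_coordinatewise_then_product) (simp add: continuous_on_coordinate)
  then show ?thesis using permute_sphere[OF assms] by (auto simp: continuous_map_in_subtopology)
qed

text \<open>The coordinates \<open>z\<^sub>a + z\<^sub>b\<close> and \<open>z\<^sub>a - z\<^sub>b\<close> are orthogonal, and the exchange changes only the sign of the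
  second. Multiplication of the second one by a unit complex number that moves from \<open>1\<close> to \<open>-1\<close> is a path
  of unitary maps from the identity to the exchange.\<close>

lemma sphere_degree_transpose:
  assumes ab: "a < n" "b < n" "a \<noteq> b"
  shows "sphere_degree (\<lambda>z. z \<circ> Transposition.transpose a b) = 1"
proof -
  define h where "h t z = (\<lambda>j. if j = a then ((z a + z b) + exp (pi * \<i> * of_real t) * (z a - z b)) / 2
      else if j = b then ((z a + z b) - exp (pi * \<i> * of_real t) * (z a - z b)) / 2 else z j)" for t and z :: "nat \<Rightarrow> complex"
  have "h 0 = id" using ab by (auto simp: h_def fun_eq_iff)
  moreover have "h 1 = (\<lambda>z. z \<circ> Transposition.transpose a b)"
    using ab by (auto simp: h_def fun_eq_iff Transposition.transpose_def)
  moreover have "sphere_degree (h 0) = sphere_degree (h 1)"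
  proof (rule sphere_degree_homotopyI)
    fix j
    show "continuous_on ({0..1} \<times> complex_sphere n) (\<lambda>y. h (fst y) (snd y) j)"
      unfolding h_def
      by (cases "j = a"; cases "j = b") (auto intro!: continuous_intros continuous_on_snd_coordinate)
  next
    fix t :: real and z assume z: "z \<in> complex_sphere n"
    have para: "(cmod (x + y))\<^sup>2 + (cmod (x - y))\<^sup>2 = 2 * (cmod x)\<^sup>2 + 2 * (cmod y)\<^sup>2" for x y
      unfolding cmod_power2 by (simp add: power2_eq_square algebra_simps)
    define u where "u = exp (pi * \<i> * of_real t)"
    have u: "cmod (u * y) = cmod y" for y by (simp add: u_def norm_mult)
    have "(cmod (h t z a))\<^sup>2 + (cmod (h t z b))\<^sup>2 = (cmod (z a))\<^sup>2 + (cmod (z b))\<^sup>2"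
      using para[of "z a + z b" "u * (z a - z b)"] para[of "z a" "z b"] ab
      unfolding u by (simp add: h_def norm_divide power_divide flip: u_def)
    moreover have "(\<Sum>j<n. (cmod (v j))\<^sup>2) = (cmod (v a))\<^sup>2 + (cmod (v b))\<^sup>2 + (\<Sum>j\<in>{..<n} - {a,b}. (cmod (v j))\<^sup>2)"
      for v :: "nat \<Rightarrow> complex"
      using ab by (simp add: sum.remove[of "{..<n}" a] sum.remove[of "{..<n} - {a}" b] flip: Diff_insert2)
    moreover have "(\<Sum>j\<in>{..<n} - {a,b}. (cmod (h t z j))\<^sup>2) = (\<Sum>j\<in>{..<n} - {a,b}. (cmod (z j))\<^sup>2)"
      by (rule sum.cong) (auto simp: h_def)
    ultimately have "(\<Sum>j<n. (cmod (h t z j))\<^sup>2) = (\<Sum>j<n. (cmod (z j))\<^sup>2)" by simp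
    then show "h t z \<in> complex_sphere n"
      using z ab by (auto simp: complex_sphere_def complex_space_def h_def)
  qed
  ultimately show ?thesis using sphere_degree_id by simp
qed

lemma sphere_degree_permute:
  assumes "\<pi> permutes {..<n}"
  shows "sphere_degree (\<lambda>z. z \<circ> \<pi>) = 1"
  using assms finite_lessThan
proof (induction rule: permutes_induct)
  case id
  then show ?case using sphere_degree_id by (simp add: id_def)
next
  case (swap a b p)
  have "Transposition.transpose a b permutes {..<n}" using swap by (intro permutes_swap_id) auto
  moreover have "(\<lambda>z. z \<circ> (Transposition.transpose a b \<circ> p)) = (\<lambda>z. z \<circ> p) \<circ> (\<lambda>z::nat \<Rightarrow> complex. z \<circ> Transposition.transpose a b)"
    by (auto simp: fun_eq_iff)
  ultimately have "sphere_degree (\<lambda>z. z \<circ> (Transposition.transpose a b \<circ> p))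
      = sphere_degree (\<lambda>z. z \<circ> p) * sphere_degree (\<lambda>z. z \<circ> Transposition.transpose a b)"
    using sphere_degree_compose[OF continuous_map_permute continuous_map_permute] swap by (simp only:)
  also have "\<dots> = 1"
    using swap sphere_degree_transpose[of a b] by (simp only: lessThan_iff) simp
  finally show ?case .
qed

end

section \<open>Vanishing of homology above the length of a good cover\<close>

lemma exact_seq_trivial_middle:
  assumes ex: "exact_seq ([C, B, A], [g, f])" and A: "trivial_group A" and C: "trivial_group C"
  shows "trivial_group B"
proof -
  from ex have hom: "group_hom B C g" "group_hom A B f" and eq: "f ` carrier A = kernel B C g"
    by (auto simp: group_hom_def group_hom_axioms_def)
  then have "f ` carrier A = carrier B"
    using group_hom.kernel_to_trivial_group[OF hom(1) C] by simp
  moreover have "f ` carrier A = {\<one>\<^bsub>B\<^esub>}"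
    using group_hom.image_from_trivial_group[OF hom(2) A] .
  ultimately show ?thesis
    using hom(1) by (simp add: trivial_group_def group_hom_def)
qed

text \<open>Excision replaces the pair of the union and \<open>U\<close> by the pair of \<open>V\<close> and \<open>U \<inter> V\<close>; the long exact
  sequences of the two pairs do the rest.\<close>

lemma trivial_homology_Un:
  assumes U: "openin X U" and V: "openin X V"
    and HU: "trivial_group (homology_group p (subtopology X U))"
    and HV: "trivial_group (homology_group p (subtopology X V))"
    and HUV: "trivial_group (homology_group (p - 1) (subtopology X (U \<inter> V)))"
  shows "trivial_group (homology_group p (subtopology X (U \<union> V)))"
proof -
  define Y where "Y = subtopology X (U \<union> V)"
  have top: "topspace Y = U \<union> V"
    using openin_subset[OF U] openin_subset[OF V] by (auto simp: Y_def)
  have subU: "subtopology Y U = subtopology X U" and subV: "subtopology Y V = subtopology X V"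
    and subUV: "subtopology (subtopology X V) (U \<inter> V) = subtopology X (U \<inter> V)"
    by (simp_all add: Y_def subtopology_subtopology inf.absorb2 Int_absorb1 inf.absorb1 Int_commute Int_left_absorb)
  have "openin Y U" "openin Y V"
    using U V by (auto simp: Y_def openin_subtopology)
  then have "closedin Y (topspace Y - V)" by (intro closedin_diff) auto
  moreover have "topspace Y - V = U - V" using top by auto
  ultimately have "Y closure_of (U - V) = U - V" by (simp add: closure_of_closedin)
  moreover have "Y interior_of U = U" using \<open>openin Y U\<close> by (simp add: interior_of_openin)
  ultimately have "Y closure_of (U - V) \<subseteq> Y interior_of U" by blast
  from homology_excision_axiom[OF this, of "U \<union> V" p]
  have "relative_homology_group p (subtopology Y (U \<union> V - (U - V))) (U - (U - V))
      \<cong> relative_homology_group p (subtopology Y (U \<union> V)) U"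
    unfolding is_iso_def by blast
  moreover have "U \<union> V - (U - V) = V" "U - (U - V) = U \<inter> V" by auto
  moreover have "subtopology Y (U \<union> V) = Y" using top by (metis subtopology_topspace)
  ultimately have exc: "relative_homology_group p (subtopology Y V) (U \<inter> V) \<cong> relative_homology_group p Y U"
    by simp
  have "trivial_group (relative_homology_group p (subtopology Y V) (U \<inter> V))"
    by (rule exact_seq_trivial_middle[OF homology_exactness_axiom_1[of p "subtopology Y V" "U \<inter> V"]])
      (simp_all add: HV HUV subV subUV)
  then have "trivial_group (relative_homology_group p Y U)"
    using isomorphic_group_triviality[OF exc] by simp
  then show ?thesis
    using exact_seq_trivial_middle[OF homology_exactness_axiom_3[of p Y U]] HU
    by (simp add: subU flip: Y_def)
qed

text \<open>Induction on the number of sets: the intersection of one of them with the union of the others is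
  covered by fewer sets, whose intersections are again intersections of the original ones.\<close>

lemma trivial_homology_good_cover:
  assumes "finite \<U>" and "\<And>U. U \<in> \<U> \<Longrightarrow> openin X U"
    and "\<And>\<F> p. \<lbrakk>\<F> \<subseteq> \<U>; \<F> \<noteq> {}; 0 < p\<rbrakk> \<Longrightarrow> trivial_group (homology_group (int p) (subtopology X (\<Inter>\<F>)))"
    and "card \<U> \<le> p"
  shows "trivial_group (homology_group (int p) (subtopology X (\<Union>\<U>)))"
  using assms
proof (induction "card \<U>" arbitrary: \<U> p rule: less_induct)
  case less
  show ?case
  proof (cases "\<U> = {}")
    case True
    then show ?thesis by (simp add: trivial_homology_group_empty)
  next
    case False
    then obtain V where V: "V \<in> \<U>" by blast
    define \<U>' where "\<U>' = \<U> - {V}"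
    have \<U>': "finite \<U>'" "card \<U>' < card \<U>" "\<U>' \<subseteq> \<U>"
      using less.prems(1) V by (auto simp: \<U>'_def card_Diff1_less simp del: card_Diff_insert)
    have W: "trivial_group (homology_group (int p) (subtopology X (\<Union>\<U>')))"
      using less.prems \<U>' by (intro less.hyps) auto
    have VV: "trivial_group (homology_group (int p) (subtopology X V))"
      using less.prems(3)[of "{V}" p] V less.prems(1,4) \<U>'(2) by auto
    have int: "trivial_group (homology_group (int p - 1) (subtopology X (\<Union>\<U>' \<inter> V)))"
    proof -
      let ?I = "(\<lambda>U. U \<inter> V) ` \<U>'"
      have card: "card ?I \<le> card \<U>'" by (rule card_image_le[OF \<U>'(1)])
      have "trivial_group (homology_group (int (p - 1)) (subtopology X (\<Union>?I)))"
      proof (rule less.hyps)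
        show "card ?I < card \<U>" "card ?I \<le> p - 1" using card \<U>'(2) less.prems(4) by auto
        show "openin X U" if "U \<in> ?I" for U using that less.prems(2) \<U>'(3) V by auto
        fix \<F> p' assume "\<F> \<subseteq> ?I" "\<F> \<noteq> {}" "0 < (p'::nat)"
        then obtain \<G> where \<G>: "\<G> \<subseteq> \<U>'" "\<F> = (\<lambda>U. U \<inter> V) ` \<G>" by (meson subset_imageE)
        then have "\<Inter>\<F> = \<Inter>(insert V \<G>)" using \<open>\<F> \<noteq> {}\<close> by auto
        then show "trivial_group (homology_group (int p') (subtopology X (\<Inter>\<F>)))"
          using less.prems(3)[of "insert V \<G>" p'] \<G>(1) \<U>'(3) V \<open>0 < p'\<close> by auto
      qed (use \<U>'(1) in auto)
      moreover have "\<Union>?I = \<Union>\<U>' \<inter> V" by auto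
      moreover have "int (p - 1) = int p - 1" using \<U>'(2) less.prems(4) by auto
      ultimately show ?thesis by simp
    qed
    have "\<Union>\<U> = \<Union>\<U>' \<union> V" using V by (auto simp: \<U>'_def)
    moreover have "openin X (\<Union>\<U>')" "openin X V" using less.prems(2) \<U>'(3) V by auto
    ultimately show ?thesis using trivial_homology_Un[OF _ _ W VV int] by simp
  qed
qed

lemma trivial_homology_contractible:
  assumes "contractible_space X" "0 < p"
  shows "trivial_group (homology_group (int p) X)"
  using trivial_reduced_homology_group_contractible_space[OF assms(1), of "int p"] assms(2)
  by (simp add: un_reduced_homology_group)

lemma trivial_homology_iff:
  "trivial_group (homology_group (int p) X) \<longleftrightarrow> (\<forall>c. singular_relcycle p X {} c \<longrightarrow> singular_relboundary p X {} c)"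
proof -
  have "carrier (homology_group (int p) X) = {singular_relboundary_set p X {}} \<longleftrightarrow>
      (\<forall>c. singular_relcycle p X {} c \<longrightarrow> homologous_rel_set p X {} c = singular_relboundary_set p X {})"
  proof -
    have gen: "f ` Z = {b} \<longleftrightarrow> (\<forall>c\<in>Z. f c = b)" if "z \<in> Z" for f :: "'b \<Rightarrow> 'c" and Z b z
      using that by auto
    have "0 \<in> singular_relcycle_set p X {}" by simp
    from gen[OF this] show ?thesis unfolding carrier_relative_homology_group by simp
  qed
  then show ?thesis by (simp add: trivial_group_def homologous_rel_set_eq_relboundary)
qed

context lens_action
begin

definition cap :: "real \<Rightarrow> (nat \<Rightarrow> complex) \<Rightarrow> (nat \<Rightarrow> complex) set" where
  "cap e c = {v \<in> S. L2_dist n c v < e}"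

lemma openin_cap: "openin SS (cap e c)"
proof -
  have "cap e c = S \<inter> L2_dist n c -` {..<e}" by (auto simp: cap_def)
  then show ?thesis
    using continuous_openin_preimage_gen[OF continuous_on_L2_dist[of S n c], of "{..<e}"] by simp
qed

lemma orbit_cap_iff:
  assumes c: "c \<in> S" and w: "w \<in> S"
  shows "q w \<in> q ` cap e c \<longleftrightarrow> (\<exists>g\<in>q c. L2_dist n g w < e)"
proof
  assume "q w \<in> q ` cap e c"
  then obtain v where v: "v \<in> S" "L2_dist n c v < e" "q v = q w" by (auto simp: cap_def)
  then have "w \<in> q v" using orbit_self[of w] by simp
  then obtain m where "w = (\<rho> ^^ m) v" by (auto simp: orbit_iff)
  then show "\<exists>g\<in>q c. L2_dist n g w < e"
    using L2_dist_rot_power[OF c v(1), of m] v(2) by (intro bexI[of _ "(\<rho> ^^ m) c"]) (auto simp: orbit_iff)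
next
  assume "\<exists>g\<in>q c. L2_dist n g w < e"
  then obtain g where g: "g \<in> q c" "L2_dist n g w < e" by blast
  then have gS: "g \<in> S" "c \<in> q g" using orbit_subset[OF c] orbit_eq[OF c g(1)] orbit_self[of c] by auto
  then obtain m where m: "c = (\<rho> ^^ m) g" by (auto simp: orbit_iff)
  then have "(\<rho> ^^ m) w \<in> cap e c"
    using L2_dist_rot_power[OF gS(1) w, of m] g(2) rot_power_sphere[OF w] by (simp add: cap_def)
  then show "q w \<in> q ` cap e c" using orbit_rot_power[OF w, of m] by (metis imageI)
qed

text \<open>The images of the caps are evenly covered, so their intersection is the image of an intersection of
  caps upstairs: the rotated caps that contain one chosen preimage \<open>w\<close>. Other rotated caps do not
  contribute. If two rotations of one cap were involved, the distance of their centres would be less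
  than \<open>4 * e\<close>, which is at most \<open>sep\<close>.\<close>

lemma orbit_caps_Int:
  assumes F: "F \<subseteq> S" "F \<noteq> {}" "finite F" and e: "0 < e" "4 * e \<le> sep"
    and w: "w \<in> S" "q w \<in> (\<Inter>c\<in>F. q ` cap e c)"
  obtains G where "G \<subseteq> S" "G \<noteq> {}" "w \<in> (\<Inter>g\<in>G. cap e g)" "(\<Inter>c\<in>F. q ` cap e c) = q ` (\<Inter>g\<in>G. cap e g)" "finite G"
proof -
  have "\<forall>c\<in>F. \<exists>g\<in>q c. L2_dist n g w < e"
  proof
    fix c assume "c \<in> F"
    then have "c \<in> S" "q w \<in> q ` cap e c" using F(1) w(2) by auto
    then show "\<exists>g\<in>q c. L2_dist n g w < e" using orbit_cap_iff[of c w e] w(1) by simp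
  qed
  then obtain g where g: "\<And>c. c \<in> F \<Longrightarrow> g c \<in> q c" "\<And>c. c \<in> F \<Longrightarrow> L2_dist n (g c) w < e" by metis
  have gS: "g c \<in> S" "q (g c) = q c" if "c \<in> F" for c
    using that F g(1) orbit_subset orbit_eq by blast+
  have "(\<Inter>c\<in>F. q ` cap e c) = q ` (\<Inter>c\<in>F. cap e (g c))"
  proof (intro equalityI subsetI)
    fix B assume B: "B \<in> (\<Inter>c\<in>F. q ` cap e c)"
    obtain c0 where c0: "c0 \<in> F" using F(2) by blast
    have "B \<in> q ` S" using B c0 by (auto simp: cap_def)
    then obtain v where v: "v \<in> S" "B = q v" by blast
    have near: "\<exists>h\<in>q c. L2_dist n h v < e" if "c \<in> F" for c
      using orbit_cap_iff[of c v e] that B F(1) v by blast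
    obtain h0 where h0: "h0 \<in> q c0" "L2_dist n h0 v < e" using near[OF c0] by blast
    have "h0 \<in> q (g c0)" "g c0 \<in> q h0"
      using gS[OF c0] h0 orbit_eq[of c0 h0] c0 F(1) orbit_self[of "g c0"] by auto
    then obtain m where m: "g c0 = (\<rho> ^^ m) h0" by (auto simp: orbit_iff)
    define w' where "w' = (\<rho> ^^ m) v"
    have w': "w' \<in> S" "B = q w'" using v rot_power_sphere orbit_rot_power by (auto simp: w'_def)
    have "h0 \<in> S" using h0(1) c0 F(1) orbit_subset by blast
    then have 0: "L2_dist n (g c0) w' < e" using L2_dist_rot_power[of h0 v m] h0 v by (simp add: m w'_def)
    have "L2_dist n (g c) w' < e" if c: "c \<in> F" for c
    proof -
      obtain h where h: "h \<in> q c" "L2_dist n h w' < e"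
        using orbit_cap_iff[of c w' e] c B F(1) w' by blast
      have "L2_dist n (g c) h \<le> L2_dist n (g c) w + (L2_dist n w (g c0) + (L2_dist n (g c0) w' + L2_dist n w' h))"
        using L2_dist_triangle[of n "g c" h w] L2_dist_triangle[of n w h "g c0"] L2_dist_triangle[of n "g c0" h w']
        by linarith
      also have "\<dots> < sep"
        using g(2)[OF c] g(2)[OF c0] 0 h(2) e(2) by (simp add: L2_dist_commute[of n w "g c0"] L2_dist_commute[of n w' h])
      finally have "h = g c" using orbit_point_unique[of "g c" h] gS[OF c] h(1) by simp
      then show ?thesis using h by simp
    qed
    then have "w' \<in> (\<Inter>c\<in>F. cap e (g c))" using w'(1) by (auto simp: cap_def)
    then show "B \<in> q ` (\<Inter>c\<in>F. cap e (g c))" using w'(2) by blast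
  next
    fix B assume "B \<in> q ` (\<Inter>c\<in>F. cap e (g c))"
    then obtain v where v: "B = q v" "\<And>c. c \<in> F \<Longrightarrow> v \<in> cap e (g c)" by blast
    then have "B \<in> q ` cap e c" if "c \<in> F" for c
      using orbit_cap_iff[of c v e] that F(1) g(1)[OF that] by (auto simp: cap_def)
    then show "B \<in> (\<Inter>c\<in>F. q ` cap e c)" by blast
  qed
  moreover have "w \<in> (\<Inter>c\<in>F. cap e (g c))" using g(2) w(1) by (auto simp: cap_def)
  ultimately show ?thesis using that[of "g ` F"] gS(1) F(2,3) by (simp add: image_image image_subset_iff)
qed

lemma trivial_homology_orbit_patch:
  assumes W: "openin SS W" and star: "star_about n a W" and inj: "inj_on q W" and "0 < p"
  shows "trivial_group (homology_group (int p) (subtopology L (q ` W)))"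
proof -
  have WS: "W \<subseteq> S" using openin_imp_subset[OF W] .
  have "homeomorphic_map (top_of_set W) (subtopology L (q ` W)) q"
  proof (rule bijective_open_imp_homeomorphic_map)
    have "continuous_map (top_of_set W) L q"
      using continuous_map_from_subtopology_mono[OF continuous_map_orbit WS] .
    then show "continuous_map (top_of_set W) (subtopology L (q ` W)) q"
      by (auto simp: continuous_map_in_subtopology)
    show "open_map (top_of_set W) (subtopology L (q ` W)) q"
      unfolding open_map_def
    proof (intro allI impI)
      fix U assume U: "openin (top_of_set W) U"
      have "openin L (q ` U)" by (rule open_map_orbit[OF openin_trans[OF U W]])
      then show "openin (subtopology L (q ` W)) (q ` U)"
        using openin_imp_subset[OF U] by (metis image_mono inf.absorb_iff1 openin_subtopology)
    qed
    show "q ` topspace (top_of_set W) = topspace (subtopology L (q ` W))"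
      using WS by (auto simp: topspace_lens)
  qed (use inj in simp)
  then have hs: "top_of_set W homeomorphic_space subtopology L (q ` W)"
    by (rule homeomorphic_map_imp_homeomorphic_space)
  have "trivial_group (homology_group (int p) (top_of_set W))"
    by (rule trivial_homology_contractible[OF contractible_space_star[OF star] \<open>0 < p\<close>])
  then show ?thesis
    using isomorphic_group_triviality[OF homeomorphic_space_imp_isomorphic_homology_groups[OF hs]] by simp
qed

text \<open>The images of finitely many small caps form a good cover: a nonempty intersection of them is
  homeomorphic to an intersection of caps, which is contractible.\<close>

lemma trivial_homology_lens_eventually:
  "\<exists>M. \<forall>p\<ge>M. trivial_group (homology_group (int p) L)"
proof -
  define e where "e = min 1 (sep / 4)"
  \<comment> \<open>The bound \<open>1\<close> makes the caps star-shaped, the bound \<open>sep / 4\<close> serves \<open>orbit_caps_Int\<close>.\<close>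
  have e: "0 < e" "e \<le> 1" "4 * e \<le> sep" using sep_pos by (auto simp: e_def)
  have "S \<subseteq> (\<Union>c\<in>S. {v. L2_dist n c v < e})" using e(1) by auto
  moreover have "open {v. L2_dist n c v < e}" for c
    using continuous_on_L2_dist by (intro open_Collect_less continuous_intros) auto
  ultimately obtain F where F: "F \<subseteq> S" "finite F" "S \<subseteq> (\<Union>c\<in>F. {v. L2_dist n c v < e})"
    using compactE_image[OF compact_sphere, of S "\<lambda>c. {v. L2_dist n c v < e}"] by metis
  let ?\<U> = "(\<lambda>c. q ` cap e c) ` F"
  have "trivial_group (homology_group (int p) (subtopology L (\<Union>?\<U>)))" if "card F \<le> p" for p
  proof (rule trivial_homology_good_cover)
    show "finite ?\<U>" using F(2) by simp
    show "openin L U" if "U \<in> ?\<U>" for U using that open_map_orbit[OF openin_cap] by auto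
    show "card ?\<U> \<le> p" using card_image_le[OF F(2)] that by (rule order_trans)
    fix \<F> p' assume "\<F> \<subseteq> ?\<U>" "\<F> \<noteq> {}" and p': "0 < (p'::nat)"
    then obtain F' where F': "F' \<subseteq> F" "F' \<noteq> {}" "\<F> = (\<lambda>c. q ` cap e c) ` F'" by (metis image_empty subset_imageE)
    show "trivial_group (homology_group (int p') (subtopology L (\<Inter>\<F>)))"
    proof (cases "\<Inter>\<F> = {}")
      case True
      then show ?thesis by (simp add: trivial_homology_group_empty)
    next
      case False
      then obtain B where B: "B \<in> (\<Inter>c\<in>F'. q ` cap e c)" using F'(3) by blast
      then have "B \<in> q ` S" using F'(2) by (auto simp: cap_def)
      then obtain w where w: "w \<in> S" "q w \<in> (\<Inter>c\<in>F'. q ` cap e c)" using B by blast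
      have "F' \<subseteq> S" "finite F'" using F'(1) F(1,2) finite_subset by auto
      from orbit_caps_Int[OF this(1) F'(2) this(2) e(1,3) w] obtain G where G: "G \<subseteq> S" "G \<noteq> {}" "w \<in> (\<Inter>g\<in>G. cap e g)"
        "(\<Inter>c\<in>F'. q ` cap e c) = q ` (\<Inter>g\<in>G. cap e g)" "finite G"
        by blast
      let ?W = "\<Inter>g\<in>G. cap e g"
      have Weq: "?W = {v \<in> S. \<forall>g\<in>G. L2_dist n g v < e}" using G(2) by (auto simp: cap_def)
      have star: "star_about n w ?W"
        unfolding Weq using star_caps[OF e(1,2) G(1,2)] G(3) Weq by simp
      have inj: "inj_on q ?W"
      proof (rule inj_onI)
        fix x y assume x: "x \<in> ?W" and y: "y \<in> ?W" and "q x = q y"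
        obtain g where g: "g \<in> G" using G(2) by blast
        have "L2_dist n x y \<le> L2_dist n x g + L2_dist n g y" by (rule L2_dist_triangle)
        also have "\<dots> < sep" using x y g e by (auto simp: cap_def L2_dist_commute[of n x g] dest!: bspec[of G _ g])
        finally show "x = y"
          using orbit_point_unique[of x y] x g \<open>q x = q y\<close> orbit_self[of y] by (auto simp: cap_def)
      qed
      have "openin SS ?W"
        using G(2,5) openin_cap by (intro openin_Inter) auto
      then show ?thesis
        using trivial_homology_orbit_patch[OF _ star inj p'] F'(3) G(4) by simp
    qed
  qed
  moreover have "\<Union>?\<U> = topspace L"
    using F(3) by (force simp: topspace_lens cap_def)
  ultimately show ?thesis by (metis subtopology_topspace)
qed

end

section \<open>The top homology of the lens space\<close>

text \<open>A fundamental class at the level of cycles, which is the form that suits computations with chains.\<close>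

definition generating_cycle :: "nat \<Rightarrow> 'a topology \<Rightarrow> 'a chain \<Rightarrow> bool" where
  "generating_cycle p X z \<longleftrightarrow> singular_relcycle p X {} z \<and>
     (\<forall>y. singular_relcycle p X {} y \<longrightarrow> (\<exists>j. homologous_rel p X {} y (frag_cmul j z))) \<and>
     (\<forall>j. singular_relboundary p X {} (frag_cmul j z) \<longrightarrow> j = 0)"

lemma fundamental_class_homologous_rel_set_iff:
  assumes z: "singular_relcycle p X {} z"
  shows "fundamental_class p X (homologous_rel_set p X {} z) \<longleftrightarrow> generating_cycle p X z"
proof -
  let ?H = "homology_group (int p) X" and ?A = "homologous_rel_set p X {} z"
  have A: "?A \<in> carrier ?H" using z unfolding carrier_relative_homology_group by blast
  interpret GH: group_hom integer_group ?H "\<lambda>m::int. ?A [^]\<^bsub>?H\<^esub> m"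
    using group.hom_integer_group_pow[OF group_relative_homology_group A]
    by (simp add: group_hom_def group_hom_axioms_def)
  have "fundamental_class p X ?A \<longleftrightarrow> (\<lambda>m::int. ?A [^]\<^bsub>?H\<^esub> m) \<in> iso integer_group ?H"
    using A by (simp add: fundamental_class_def)
  also have "\<dots> \<longleftrightarrow> carrier ?H \<subseteq> range (\<lambda>m::int. ?A [^]\<^bsub>?H\<^esub> m) \<and> (\<forall>m::int. ?A [^]\<^bsub>?H\<^esub> m = \<one>\<^bsub>?H\<^esub> \<longrightarrow> m = 0)"
    unfolding GH.iso_iff by simp
  also have "carrier ?H \<subseteq> range (\<lambda>m::int. ?A [^]\<^bsub>?H\<^esub> m) \<longleftrightarrow>
      (\<forall>y. singular_relcycle p X {} y \<longrightarrow> (\<exists>j. homologous_rel p X {} y (frag_cmul j z)))"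
    unfolding homology_class_int_pow[OF z] carrier_relative_homology_group
    by (auto simp: image_subset_iff image_iff homologous_rel_set_eq)
  also have "(\<forall>m::int. ?A [^]\<^bsub>?H\<^esub> m = \<one>\<^bsub>?H\<^esub> \<longrightarrow> m = 0) \<longleftrightarrow>
      (\<forall>j. singular_relboundary p X {} (frag_cmul j z) \<longrightarrow> j = 0)"
    unfolding homology_class_int_pow[OF z] one_relative_homology_group homologous_rel_set_eq_relboundary ..
  finally show ?thesis using z by (simp add: generating_cycle_def)
qed

lemma fundamental_class_imp_generating_cycle:
  assumes "fundamental_class p X a"
  obtains z where "a = homologous_rel_set p X {} z" "generating_cycle p X z"
proof -
  have "a \<in> carrier (homology_group (int p) X)" using assms by (simp add: fundamental_class_def)
  then obtain z where z: "singular_relcycle p X {} z" "a = homologous_rel_set p X {} z"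
    unfolding carrier_relative_homology_group by auto
  then show ?thesis using that assms fundamental_class_homologous_rel_set_iff[OF z(1)] by simp
qed

lemma iso_integer_group_imp_fundamental_class:
  assumes "homology_group (int p) X \<cong> integer_group"
  shows "\<exists>a. fundamental_class p X a"
proof -
  let ?H = "homology_group (int p) X"
  obtain h where h: "h \<in> iso integer_group ?H"
    using group.iso_sym[OF _ assms] by (auto simp: is_iso_def)
  then have hom: "h \<in> hom integer_group ?H" by (simp add: iso_def)
  then have h1: "h 1 \<in> carrier ?H" by (auto simp: hom_def)
  have "h m = h 1 [^]\<^bsub>?H\<^esub> m" for m :: int
    using hom_int_pow[OF hom _ group_integer_group group_relative_homology_group, of 1 m] by simp
  then have "h = (\<lambda>m. h 1 [^]\<^bsub>?H\<^esub> m)" by blast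
  then show ?thesis using h h1 unfolding fundamental_class_def by metis
qed

lemma singular_chain_frag_cmul_diff:
  "\<lbrakk>singular_chain p X a; singular_chain p X b\<rbrakk> \<Longrightarrow> singular_chain p X (a - frag_cmul k b)"
  by (intro singular_chain_diff singular_chain_cmul)

lemma frag_cmul_diff_right: "frag_cmul k (a - b) = frag_cmul k a - frag_cmul k b"
  by (simp add: poly_mapping_eqI lookup_minus right_diff_distrib)

context lens_action
begin

abbreviation d :: nat where "d \<equiv> 2 * n - 1"

lemma d_pos: "0 < d"
  using n_pos by linarith

lemma acyclic_at_iff: "acyclic_at p \<longleftrightarrow> trivial_group (homology_group (int p) SS)"
  unfolding trivial_homology_iff acyclic_at_def singular_cycle singular_boundary by auto

lemma acyclic_at_sphere: "\<lbrakk>p \<noteq> 0; p \<noteq> d\<rbrakk> \<Longrightarrow> acyclic_at p"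
  unfolding acyclic_at_iff by (rule trivial_homology_sphere[OF n_pos])

lemma orbit_chain_boundary:
  "singular_chain p SS c \<Longrightarrow> chain_boundary p (chain_map p q c) = chain_map (p - 1) q (chain_boundary p c)"
  using chain_boundary_chain_map[of p SS c q] by simp

lemma singular_chain_orbit: "singular_chain p SS c \<Longrightarrow> singular_chain p L (chain_map p q c)"
  by (rule singular_chain_chain_map[OF _ continuous_map_orbit])

lemma orbit_cycle_iff:
  assumes "0 < p" and c: "singular_chain p SS c"
  shows "singular_relcycle p L {} (chain_map p q c) \<longleftrightarrow> (\<exists>e. singular_chain (p - 1) SS e \<and> chain_boundary p c = rot_diff (p - 1) e)"
proof -
  have bc: "singular_chain (p - 1) SS (chain_boundary p c)" using singular_chain_boundary[OF c] by simp
  show ?thesis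
    using orbit_chain_eq_0[OF bc] orbit_chain_rot_diff[of "p - 1"] singular_chain_orbit[OF c]
    by (auto simp: singular_cycle orbit_chain_boundary[OF c])
qed

lemma orbit_boundary_iff:
  assumes c: "singular_chain p SS c"
  shows "singular_relboundary p L {} (chain_map p q c) \<longleftrightarrow>
    (\<exists>u w. singular_chain (Suc p) SS u \<and> singular_chain p SS w \<and> c = chain_boundary (Suc p) u + rot_diff p w)"
proof
  assume "singular_relboundary p L {} (chain_map p q c)"
  then obtain v where v: "singular_chain (Suc p) L v" "chain_boundary (Suc p) v = chain_map p q c"
    by (auto simp: singular_boundary)
  define u where "u = chain_section (Suc p) v"
  have u: "singular_chain (Suc p) SS u" "chain_map (Suc p) q u = v"
    using singular_chain_section[OF v(1)] orbit_chain_section[OF v(1)] by (auto simp: u_def)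
  have "chain_map p q (c - chain_boundary (Suc p) u) = 0"
    using orbit_chain_boundary[OF u(1)] v(2) by (simp add: chain_map_diff u(2))
  moreover have "singular_chain p SS (c - chain_boundary (Suc p) u)"
    by (rule singular_chain_diff[OF c singular_chain_boundary_alt[OF u(1)]])
  ultimately obtain w where "singular_chain p SS w" "c - chain_boundary (Suc p) u = rot_diff p w"
    using orbit_chain_eq_0 by blast
  then show "\<exists>u w. singular_chain (Suc p) SS u \<and> singular_chain p SS w \<and> c = chain_boundary (Suc p) u + rot_diff p w"
    using u(1) by (intro exI[of _ u] exI[of _ w]) (auto simp: algebra_simps)
next
  assume "\<exists>u w. singular_chain (Suc p) SS u \<and> singular_chain p SS w \<and> c = chain_boundary (Suc p) u + rot_diff p w"
  then obtain u w where u: "singular_chain (Suc p) SS u" and w: "singular_chain p SS w"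
    and "c = chain_boundary (Suc p) u + rot_diff p w" by blast
  then have "chain_map p q c = chain_boundary (Suc p) (chain_map (Suc p) q u)"
    using orbit_chain_boundary[OF u] orbit_chain_rot_diff[OF w] by (simp add: chain_map_add)
  then show "singular_relboundary p L {} (chain_map p q c)"
    using singular_chain_orbit[OF u] by (auto simp: singular_boundary)
qed

lemma lens_chain_lift:
  assumes "singular_chain p L y" obtains c where "singular_chain p SS c" "y = chain_map p q c"
  using singular_chain_section[OF assms] orbit_chain_section[OF assms] by metis

lemma quotient_acyclic_at_iff:
  assumes "0 < p"
  shows "quotient_acyclic_at p \<longleftrightarrow> trivial_group (homology_group (int p) L)"
proof -
  have "trivial_group (homology_group (int p) L) \<longleftrightarrow>
    (\<forall>c. singular_chain p SS c \<longrightarrow> singular_relcycle p L {} (chain_map p q c) \<longrightarrow>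
       singular_relboundary p L {} (chain_map p q c))"
    unfolding trivial_homology_iff by (metis lens_chain_lift singular_cycle)
  then show ?thesis
    unfolding quotient_acyclic_at_def
    using orbit_cycle_iff[OF assms] orbit_boundary_iff by (simp add: Bex_def)
qed

interpretation swapped: periodic_complex "\<lambda>p. singular_chain_set p SS" chain_boundary rot_norm rot_diff
  by (rule swap)

text \<open>The homology of the lens space vanishes in large degrees, and periodicity above the dimension of the
  sphere carries this down to \<open>Suc d\<close>.\<close>

lemma quotient_acyclic_above:
  assumes "d < p"
  shows "quotient_acyclic_at p \<and> swapped.quotient_acyclic_at p"
proof -
  obtain M where M: "\<And>p. M \<le> p \<Longrightarrow> trivial_group (homology_group (int p) L)"
    using trivial_homology_lens_eventually by blast
  have quot: "quotient_acyclic_at p" if "M \<le> p" "0 < p" for p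
    using M[OF that(1)] quotient_acyclic_at_iff[OF that(2)] by simp
  have ac: "acyclic_at p" if "d < p" for p using acyclic_at_sphere[of p] that by simp
  have high: "quotient_acyclic_at p \<and> swapped.quotient_acyclic_at p" if "M \<le> p" "d < p" for p
    using quot[of p] quotient_acyclic_at_descend[OF quot[of "Suc p"] ac[OF that(2)]] that by simp
  show ?thesis
  proof (cases "M \<le> p")
    case False
    then have "p \<le> M" by simp
    then show ?thesis
      using assms
    proof (induction rule: inc_induct)
      case base
      then show ?case using high[of M] by simp
    next
      case (step k)
      then have "quotient_acyclic_at (Suc k) \<and> swapped.quotient_acyclic_at (Suc k)" by simp
      then show ?case
        using quotient_acyclic_at_descend[of k] swapped.quotient_acyclic_at_descend[of k] ac[of k] step.prems by simp
    qed
  qed (use high assms in simp)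
qed

lemma trivial_homology_lens_above:
  "d < p \<Longrightarrow> trivial_group (homology_group (int p) L)"
  using quotient_acyclic_above[of p] quotient_acyclic_at_iff[of p] by simp

lemma sphere_degree_rot: "sphere_degree n \<rho> = 1"
proof -
  define h where "h t z = (\<lambda>j. if j < n then exp (of_real t * (2 * pi * \<i> * of_int (ks ! j) / of_nat r)) * z j else 0)"
    for t and z :: "nat \<Rightarrow> complex"
  have "sphere_degree n (h 0) = sphere_degree n (h 1)"
  proof (rule sphere_degree_homotopyI[OF n_pos])
    fix j assume "j < n"
    then show "continuous_on ({0..1} \<times> S) (\<lambda>y. h (fst y) (snd y) j)"
      unfolding h_def using r_pos by (auto intro!: continuous_intros continuous_on_snd_coordinate)
  next
    fix t :: real and z assume "z \<in> S"
    moreover have "cmod (exp (of_real t * (2 * pi * \<i> * of_int k / of_nat r))) = 1" for k :: int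
      by simp
    ultimately show "h t z \<in> S"
      by (simp add: h_def complex_sphere_def complex_space_def norm_mult del: norm_exp_eq_Re)
  qed
  moreover have "h 1 = \<rho>" by (simp add: h_def lens_rotation_def fun_eq_iff)
  moreover have "sphere_degree n (h 0) = sphere_degree n id"
    by (rule sphere_degree_cong[OF n_pos]) (auto simp: h_def complex_sphere_def complex_space_def)
  ultimately show ?thesis using sphere_degree_id[OF n_pos] by simp
qed

text \<open>The rotation is homotopic to the identity, so each of the \<open>r\<close> summands is homologous to \<open>y\<close>.\<close>

lemma rot_norm_cycle:
  assumes y: "singular_relcycle d SS {} y"
  shows "homologous_rel d SS {} (rot_norm d y) (frag_cmul (int r) y)"
proof -
  have 1: "homologous_rel d SS {} (chain_map d (\<rho> ^^ m) y) y" for m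
    using homologous_chain_map_sphere[OF n_pos continuous_map_rot_power y, of m]
      sphere_degree_funpow[OF n_pos continuous_map_rot, of m] by (simp add: sphere_degree_rot)
  have "homologous_rel d SS {} (\<Sum>m<k. chain_map d (\<rho> ^^ m) y) (frag_cmul (int k) y)" for k
  proof (induction k)
    case (Suc k)
    show ?case using homologous_rel_add[OF Suc 1[of k]] by (simp add: frag_cmul_distrib add.commute)
  qed simp
  then show ?thesis by (simp add: rot_norm_def)
qed

lemma rot_norm_cmul: "rot_norm p (frag_cmul k c) = frag_cmul k (rot_norm p c)"
  by (simp add: rot_norm_def frag_cmul_sum o_def)

text \<open>The transfer of a cycle: the boundary of \<open>c\<close> lies in the image of \<open>rot_diff\<close>, which the norm kills.\<close>

lemma rot_norm_orbit_cycle: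
  assumes "0 < p" and c: "singular_chain p SS c" and "singular_relcycle p L {} (chain_map p q c)"
  shows "singular_relcycle p SS {} (rot_norm p c)"
proof -
  obtain e where "singular_chain (p - 1) SS e" "chain_boundary p c = rot_diff (p - 1) e"
    using assms orbit_cycle_iff by blast
  then have "chain_boundary p (rot_norm p c) = 0"
    using D_N[of c "p - 1"] N_T[of e "p - 1"] c \<open>0 < p\<close> by simp
  then show ?thesis using N_in[of c p] c by (simp add: singular_cycle)
qed

lemma orbit_boundary_imp_rot_norm_boundary:
  assumes c: "singular_chain p SS c" and "singular_relboundary p L {} (chain_map p q c)"
  shows "singular_relboundary p SS {} (rot_norm p c)"
proof -
  obtain u w where u: "singular_chain (Suc p) SS u" and w: "singular_chain p SS w"
    and c_eq: "c = chain_boundary (Suc p) u + rot_diff p w"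
    using assms orbit_boundary_iff by blast
  then have "rot_norm p c = chain_boundary (Suc p) (rot_norm (Suc p) u)"
    using D_N[of u p] N_T[of w p] by (simp add: N_add)
  then show ?thesis using N_in[of u "Suc p"] u by (auto simp: singular_boundary)
qed

text \<open>If the transfer of \<open>c\<close> bounds a chain \<open>u\<close>, then \<open>u\<close> is a cycle of the quotient by the norm, in degree
  \<open>Suc d\<close>, where that quotient is acyclic. So \<open>u\<close> can be replaced by a norm, and the norm can be
  cancelled up to \<open>rot_diff\<close>.\<close>

lemma transfer_injective:
  assumes c: "singular_chain d SS c" and b: "singular_relboundary d SS {} (rot_norm d c)"
  shows "singular_relboundary d L {} (chain_map d q c)"
proof -
  obtain u where u: "singular_chain (Suc d) SS u" "chain_boundary (Suc d) u = rot_norm d c"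
    using b by (auto simp: singular_boundary)
  then obtain v w where v: "singular_chain (Suc (Suc d)) SS v" and w: "singular_chain (Suc d) SS w"
    and uvw: "u = chain_boundary (Suc (Suc d)) v + rot_norm (Suc d) w"
  proof -
    have "swapped.quotient_acyclic_at (Suc d)" using quotient_acyclic_above[of "Suc d"] by simp
    moreover have "\<exists>e\<in>singular_chain_set (Suc d - 1) SS. chain_boundary (Suc d) u = rot_norm (Suc d - 1) e"
      using c u(2) by (intro bexI[of _ c]) simp_all
    ultimately show ?thesis using that u(1) unfolding swapped.quotient_acyclic_at_def by blast
  qed
  have "rot_norm d c = rot_norm d (chain_boundary (Suc d) w)"
    using u(2) D_D[of v "Suc d"] D_N[of w d] v w by (simp add: uvw D_add)
  moreover have "singular_chain d SS (c - chain_boundary (Suc d) w)"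
    by (rule singular_chain_diff[OF c singular_chain_boundary_alt[OF w]])
  ultimately obtain b where "singular_chain d SS b" "c - chain_boundary (Suc d) w = rot_diff d b"
    using ker_N[of "c - chain_boundary (Suc d) w" d] by (auto simp: N_diff)
  then show ?thesis
    using w by (subst orbit_boundary_iff[OF c]) (metis diff_add_cancel add.commute)
qed

definition sphere_cycle :: "(nat \<Rightarrow> complex) chain" where
  "sphere_cycle = (SOME z. generating_cycle d SS z)"

lemma generating_sphere_cycle: "generating_cycle d SS sphere_cycle"
proof -
  have "\<exists>z. generating_cycle d SS z"
    using iso_integer_group_imp_fundamental_class[OF homology_sphere_top[OF n_pos]]
      fundamental_class_imp_generating_cycle by metis
  then show ?thesis unfolding sphere_cycle_def by (rule someI_ex)
qed

lemma sphere_cycle: "singular_relcycle d SS {} sphere_cycle" "singular_chain d SS sphere_cycle"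
  using generating_sphere_cycle by (auto simp: generating_cycle_def singular_cycle)

lemma orbit_sphere_cycle: "singular_relcycle d L {} (chain_map d q sphere_cycle)"
  using sphere_cycle(1) by (rule singular_relcycle_chain_map[OF _ continuous_map_orbit]) simp

lemma homologous_multiple_unique:
  assumes "homologous_rel d SS {} y (frag_cmul i sphere_cycle)" "homologous_rel d SS {} y (frag_cmul j sphere_cycle)"
  shows "i = j"
proof -
  have "homologous_rel d SS {} (frag_cmul i sphere_cycle) (frag_cmul j sphere_cycle)"
    by (rule homologous_rel_trans[OF assms(2) homologous_rel_sym[THEN iffD1, OF assms(1)]])
  then have "singular_relboundary d SS {} (frag_cmul (i - j) sphere_cycle)"
    by (simp add: homologous_rel_def frag_cmul_diff_distrib)
  then have "i - j = 0" using generating_sphere_cycle unfolding generating_cycle_def by blast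
  then show ?thesis by simp
qed

lemma homologous_rel_cmul:
  "homologous_rel p X {} a b \<Longrightarrow> homologous_rel p X {} (frag_cmul k a) (frag_cmul k b)"
  unfolding homologous_rel_def using singular_relboundary_cmul[of p X "{}" "a - b" k]
  by (simp add: frag_cmul_diff_right)

text \<open>The transfer embeds the top homology of the lens space into that of the sphere, which is infinite
  cyclic. The image is a nonzero subgroup of the integers, since it contains \<open>r\<close>, the transfer of
  the image of the sphere. A class whose transfer is least positive is a generator.\<close>

lemma ex_generating_cycle_lens: "\<exists>z. generating_cycle d L z"
proof -
  define tr where "tr c j \<longleftrightarrow> singular_chain d SS c \<and> singular_relcycle d L {} (chain_map d q c) \<and>
      homologous_rel d SS {} (rot_norm d c) (frag_cmul j sphere_cycle)" for c j
  have tr_ex: "\<exists>j. tr c j" if "singular_chain d SS c" "singular_relcycle d L {} (chain_map d q c)" for c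
    using generating_sphere_cycle rot_norm_orbit_cycle[OF d_pos that] that
    unfolding tr_def generating_cycle_def by blast
  have tr_diff: "tr (a - frag_cmul k b) (i - k * j)" if "tr a i" "tr b j" for a b i j k
    using that homologous_rel_diff[of d SS "{}" "rot_norm d a" "frag_cmul i sphere_cycle"
        "frag_cmul k (rot_norm d b)" "frag_cmul (k * j) sphere_cycle"]
      homologous_rel_cmul[of d SS "rot_norm d b" "frag_cmul j sphere_cycle" k]
    by (simp add: tr_def singular_chain_frag_cmul_diff chain_map_diff singular_relcycle_diff singular_relcycle_cmul
        N_diff rot_norm_cmul frag_cmul_diff_distrib)
  define E where "E = {k::nat. 0 < k \<and> (\<exists>c. tr c (int k))}"
  have "tr sphere_cycle (int r)"
    using sphere_cycle orbit_sphere_cycle rot_norm_cycle[OF sphere_cycle(1)] by (simp add: tr_def)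
  then have "r \<in> E" using r_pos by (auto simp: E_def)
  define e where "e = (LEAST k. k \<in> E)"
  have "e \<in> E" unfolding e_def using \<open>r \<in> E\<close> by (rule LeastI)
  then obtain c0 where c0: "tr c0 (int e)" and "0 < e" by (auto simp: E_def)
  have least: "\<not> (0 < k \<and> k < e \<and> tr c (int k))" for k c
    using not_less_Least[of k "\<lambda>k. k \<in> E"] by (auto simp: E_def e_def)
  have "generating_cycle d L (chain_map d q c0)"
    unfolding generating_cycle_def
  proof (intro conjI allI impI)
    show "singular_relcycle d L {} (chain_map d q c0)" using c0 by (simp add: tr_def)
    fix y assume y: "singular_relcycle d L {} y"
    then obtain c where c: "singular_chain d SS c" "y = chain_map d q c"
      by (metis lens_chain_lift singular_cycle)
    then obtain j where j: "tr c j" using tr_ex y by blast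
    \<comment> \<open>Division by the least positive transfer, so that the remainder has to vanish.\<close>
    let ?k = "j div int e"
    have diff: "tr (c - frag_cmul ?k c0) (j - ?k * int e)" by (rule tr_diff[OF j c0])
    have "j - ?k * int e = j mod int e" by (simp add: minus_div_mult_eq_mod)
    then have "tr (c - frag_cmul ?k c0) (int (nat (j mod int e)))" using diff \<open>0 < e\<close> by simp
    then have "nat (j mod int e) = 0" using least[of "nat (j mod int e)"] \<open>0 < e\<close>
      by (metis gr0I nat_less_iff of_nat_0_less_iff pos_mod_bound pos_mod_sign)
    then have "j - ?k * int e = 0"
      using \<open>j - ?k * int e = j mod int e\<close> \<open>0 < e\<close> by (metis nat_eq_iff2 of_nat_0 of_nat_0_less_iff pos_mod_sign)
    then have "tr (c - frag_cmul ?k c0) 0" using diff by simp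
    then have "singular_relboundary d L {} (chain_map d q (c - frag_cmul ?k c0))"
      using transfer_injective by (simp add: tr_def homologous_rel_def)
    then have "homologous_rel d L {} y (frag_cmul ?k (chain_map d q c0))"
      by (simp add: homologous_rel_def c chain_map_diff)
    then show "\<exists>j. homologous_rel d L {} y (frag_cmul j (chain_map d q c0))" ..
  next
    fix j assume "singular_relboundary d L {} (frag_cmul j (chain_map d q c0))"
    then have "singular_relboundary d SS {} (rot_norm d (frag_cmul j c0))"
      using c0 by (intro orbit_boundary_imp_rot_norm_boundary) (auto simp: tr_def singular_chain_cmul)
    then have "homologous_rel d SS {} (rot_norm d (frag_cmul j c0)) (frag_cmul 0 sphere_cycle)"
      by (simp add: homologous_rel_def)
    moreover have "homologous_rel d SS {} (rot_norm d (frag_cmul j c0)) (frag_cmul (j * int e) sphere_cycle)"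
      using homologous_rel_cmul[of d SS "rot_norm d c0" "frag_cmul (int e) sphere_cycle" j] c0
      by (simp add: tr_def rot_norm_cmul)
    ultimately have "0 = j * int e" by (rule homologous_multiple_unique)
    then show "j = 0" using \<open>0 < e\<close> by simp
  qed
  then show ?thesis ..
qed

lemma ex_fundamental_class_lens: "\<exists>a. fundamental_class d L a"
  using ex_generating_cycle_lens fundamental_class_homologous_rel_set_iff unfolding generating_cycle_def by metis

text \<open>The orbit projection has nonzero degree, so degrees can be read off upstairs.\<close>

lemma degree_of_lift:
  assumes g: "continuous_map L L g" and G: "continuous_map SS SS G" and lift: "\<And>z. z \<in> S \<Longrightarrow> g (q z) = q (G z)"
    and a: "fundamental_class d L a"
    and ga: "hom_induced (int d) L {} L {} g a = a [^]\<^bsub>homology_group (int d) L\<^esub> (e::int)"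
  shows "sphere_degree n G = e"
proof -
  let ?H = "homology_group (int d) L"
  obtain z where z: "a = homologous_rel_set d L {} z" "generating_cycle d L z"
    using fundamental_class_imp_generating_cycle[OF a] .
  then have zc: "singular_relcycle d L {} z" by (simp add: generating_cycle_def)
  let ?P = "chain_map d q sphere_cycle"
  obtain j where j: "homologous_rel d L {} ?P (frag_cmul j z)"
    using z(2) orbit_sphere_cycle unfolding generating_cycle_def by blast
  have "j \<noteq> 0"
  proof
    assume "j = 0"
    then have "singular_relboundary d L {} ?P" using j by (simp add: homologous_rel_def)
    then have "singular_relboundary d SS {} (rot_norm d sphere_cycle)"
      by (rule orbit_boundary_imp_rot_norm_boundary[OF sphere_cycle(2)])
    then have "homologous_rel d SS {} (rot_norm d sphere_cycle) (frag_cmul 0 sphere_cycle)"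
      by (simp add: homologous_rel_def)
    from homologous_multiple_unique[OF this rot_norm_cycle[OF sphere_cycle(1)]] show False
      using r_pos by simp
  qed
  have "homologous_rel_set d L {} (chain_map d g z) = homologous_rel_set d L {} (frag_cmul e z)"
    using ga hom_induced_chain_map[OF g _ zc, of "{}"] homology_class_int_pow[OF zc, of e] by (simp add: z(1))
  then have gz: "homologous_rel d L {} (chain_map d g z) (frag_cmul e z)" by (simp add: homologous_rel_set_eq)
  have eq: "chain_map d g ?P = chain_map d q (chain_map d G sphere_cycle)"
  proof -
    have "chain_map d (g \<circ> q) sphere_cycle = chain_map d (q \<circ> G) sphere_cycle"
      using chain_map_eq[OF sphere_cycle(2), of "g \<circ> q" "q \<circ> G"] lift by simp
    then show ?thesis by (simp add: chain_map_compose)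
  qed
  have 1: "homologous_rel d L {} (chain_map d q (chain_map d G sphere_cycle)) (frag_cmul (sphere_degree n G) ?P)"
    using singular_relboundary_chain_map[OF homologous_chain_map_sphere[OF n_pos G sphere_cycle(1), unfolded homologous_rel_def]
        continuous_map_orbit, of "{}"]
    unfolding homologous_rel_def by (simp add: chain_map_diff)
  have 2: "homologous_rel d L {} (frag_cmul (sphere_degree n G) ?P) (frag_cmul (sphere_degree n G * j) z)"
    using homologous_rel_cmul[OF j] by simp
  have 3: "homologous_rel d L {} (chain_map d g ?P) (chain_map d g (frag_cmul j z))"
    using singular_relboundary_chain_map[OF j[unfolded homologous_rel_def] g, of "{}"]
    unfolding homologous_rel_def by (simp add: chain_map_diff)
  have 4: "homologous_rel d L {} (chain_map d g (frag_cmul j z)) (frag_cmul (j * e) z)"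
    using homologous_rel_cmul[OF gz, of j] by simp
  have "homologous_rel d L {} (chain_map d g ?P) (frag_cmul (sphere_degree n G * j) z)"
    unfolding eq by (rule homologous_rel_trans[OF 2 1])
  then have "homologous_rel d L {} (frag_cmul (sphere_degree n G * j) z) (chain_map d g ?P)"
    by (rule homologous_rel_sym[THEN iffD1])
  then have "homologous_rel d L {} (frag_cmul (sphere_degree n G * j) z) (frag_cmul (j * e) z)"
    by (rule homologous_rel_trans[OF homologous_rel_trans[OF 4 3]])
  then have "singular_relboundary d L {} (frag_cmul (sphere_degree n G * j - j * e) z)"
    by (simp add: homologous_rel_def frag_cmul_diff_distrib)
  then have "sphere_degree n G * j - j * e = 0" using z(2) unfolding generating_cycle_def by blast
  then show ?thesis using \<open>j \<noteq> 0\<close> by simp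
qed

end

section \<open>Equivariant self-maps of the sphere\<close>

context lens_action
begin

lemma chain_map_commutes_rot:
  assumes E: "continuous_map SS SS E" and comm: "\<And>z. z \<in> S \<Longrightarrow> E (\<rho> z) = \<rho> (E z)" and c: "singular_chain p SS c"
  shows "chain_map p E (rot_diff p c) = rot_diff p (chain_map p E c)"
    and "chain_map p E (rot_norm p c) = rot_norm p (chain_map p E c)"
proof -
  have "E ((\<rho> ^^ m) z) = (\<rho> ^^ m) (E z)" if "z \<in> S" for m z
    using that by (induction m) (simp_all add: comm rot_power_sphere)
  then have 1: "chain_map p E (chain_map p (\<rho> ^^ m) c) = chain_map p (\<rho> ^^ m) (chain_map p E c)" for m
    using chain_map_eq[OF c, of "E \<circ> (\<rho> ^^ m)" "(\<rho> ^^ m) \<circ> E"] by (simp add: chain_map_compose)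
  then show "chain_map p E (rot_norm p c) = rot_norm p (chain_map p E c)"
    by (simp add: rot_norm_def chain_map_sum o_def)
  show "chain_map p E (rot_diff p c) = rot_diff p (chain_map p E c)"
    using 1[of 1] by (simp add: rot_diff_def chain_map_diff)
qed

lemma zigzag_chain_map:
  assumes E: "continuous_map SS SS E" and comm: "\<And>z. z \<in> S \<Longrightarrow> E (\<rho> z) = \<rho> (E z)" and c: "zigzag c m"
  shows "zigzag (\<lambda>i. chain_map i E (c i)) m"
  unfolding zigzag_def
proof (intro conjI allI impI)
  fix i assume "i \<le> m"
  then show "chain_map i E (c i) \<in> singular_chain_set i SS"
    using c singular_chain_chain_map[OF _ E] by (simp add: zigzag_def)
next
  fix i assume i: "i < m"
  then have ci: "singular_chain i SS (c i)" "singular_chain (Suc i) SS (c (Suc i))"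
    and "chain_boundary (Suc i) (c (Suc i)) = alt i i (c i)"
    using c by (auto simp: zigzag_def)
  then show "chain_boundary (Suc i) (chain_map (Suc i) E (c (Suc i))) = alt i i (chain_map i E (c i))"
    using chain_boundary_chain_map[OF ci(2), of E] chain_map_commutes_rot[OF E comm ci(1)]
    by (simp add: alt_def)
qed

text \<open>The sum of the coefficients. It is read off from the induced chain on one generator, because
  \<open>frag_extend\<close> takes its values in free abelian groups.\<close>

definition augmentation :: "(nat \<Rightarrow> complex) chain \<Rightarrow> int" where
  "augmentation c = Poly_Mapping.lookup (frag_extend (\<lambda>_. frag_of ()) c) ()"

lemma augmentation_add: "augmentation (a + b) = augmentation a + augmentation b"
  by (simp add: augmentation_def frag_extend_add lookup_add)

lemma augmentation_boundary:
  assumes "singular_chain 1 SS u" shows "augmentation (chain_boundary 1 u) = 0"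
proof -
  have "frag_extend (\<lambda>_. frag_of ()) (chain_boundary (Suc 0) u) = 0"
    using assms[unfolded singular_chain_def]
  proof (induction u rule: frag_induction)
    case (one x)
    then show ?case by (simp add: frag_extend_diff chain_boundary_of)
  next
    case (diff a b)
    then show ?case by (simp add: chain_boundary_diff frag_extend_diff)
  qed auto
  then show ?thesis by (simp add: augmentation_def)
qed

lemma augmentation_chain_map: "augmentation (chain_map p f c) = augmentation c"
proof -
  have "frag_extend (\<lambda>_. frag_of ()) (chain_map p f c) = frag_extend (\<lambda>_. frag_of ()) c"
    using subset_UNIV
  proof (induction c rule: frag_induction)
    case (diff a b)
    then show ?case by (simp add: chain_map_diff frag_extend_diff)
  qed (auto simp: chain_map_def)
  then show ?thesis by (simp add: augmentation_def)
qed

lemma augmentation_rot_norm: "augmentation (rot_norm p c) = int r * augmentation c"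
proof -
  have "augmentation 0 = 0" by (simp add: augmentation_def)
  then have "augmentation (\<Sum>m<k. chain_map p (\<rho> ^^ m) c) = int k * augmentation c" for k
    by (induction k) (simp_all add: augmentation_add augmentation_chain_map algebra_simps)
  then show ?thesis by (simp add: rot_norm_def)
qed

lemma point_chains_homologous:
  assumes "singular_simplex 0 SS \<sigma>" "singular_simplex 0 SS \<tau>"
  shows "\<exists>u\<in>singular_chain_set 1 SS. frag_of \<sigma> - frag_of \<tau> = chain_boundary 1 u"
proof -
  have "singular_relboundary 0 SS {} (frag_of \<sigma> - frag_of \<tau>)"
    using iso_integer_zeroth_homology_group_aux[OF path_connected_space_sphere[OF n_pos] assms]
    by (simp add: homologous_rel_def)
  then show ?thesis by (auto simp: singular_boundary)
qed

text \<open>Let \<open>c\<close> be a zigzag that starts at a point and ends in degree \<open>d\<close>. The norm of its last entry is a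
  multiple, say by \<open>l\<close>, of the fundamental cycle. The image of \<open>c\<close> under \<open>E\<close> is again such a zigzag, and
  the two are homotopic up to a cycle of the sphere in the top degree. On that cycle the norm acts as
  multiplication by \<open>r\<close>; hence \<open>l\<close> times the degree agrees with \<open>l\<close> modulo \<open>r\<close>. If \<open>l\<close> were divisible by
  \<open>r\<close>, the zigzag could be descended to degree \<open>0\<close>, where the augmentation of a point would be divisible
  by \<open>r\<close>.\<close>

lemma degree_of_equivariant_map:
  assumes r: "prime r" and E: "continuous_map SS SS E" and comm: "\<And>z. z \<in> S \<Longrightarrow> E (\<rho> z) = \<rho> (E z)"
  shows "int r dvd sphere_degree n E - 1"
proof -
  define m where "m = 2 * (n - 1)"
  have m: "d = Suc m" using n_pos unfolding m_def by linarith
  have "even m" by (simp add: m_def)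
  then have alt_m: "alt m = rot_diff" by (simp add: alt_def)
  have acyclic: "acyclic_at i" if "0 < i" "i \<le> m" for i
    using acyclic_at_sphere[of i] that m by simp
  obtain x where x: "x \<in> S" using pole_sphere[OF n_pos, of 1] by auto
  define \<sigma> where "\<sigma> = restrict (\<lambda>_. x) (standard_simplex 0)"
  have \<sigma>: "singular_simplex 0 SS \<sigma>"
    using x by (auto simp: \<sigma>_def singular_simplex_def)
  note map = singular_simplex_simplex_map[OF \<sigma>]
  have "rot_diff 0 (frag_of \<sigma>) = frag_of \<sigma> - frag_of (simplex_map 0 \<rho> \<sigma>)" by (simp add: rot_diff_def)
  then have "\<exists>u\<in>singular_chain_set 1 SS. rot_diff 0 (frag_of \<sigma>) = chain_boundary 1 u"
    using point_chains_homologous[OF \<sigma> map[OF continuous_map_rot]] by simp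
  moreover have "frag_of \<sigma> \<in> singular_chain_set 0 SS" using \<sigma> by (simp add: singular_chain_of)
  ultimately obtain c where c0: "c 0 = frag_of \<sigma>" and c: "zigzag c d"
    using zigzag_exists[of "frag_of \<sigma>" d] acyclic m by auto
  then have cd: "singular_chain d SS (c d)" and cm: "singular_chain m SS (c m)"
    and bd: "chain_boundary d (c d) = rot_diff m (c m)"
    using m by (auto simp: zigzag_def alt_m)
  let ?c' = "\<lambda>i. chain_map i E (c i)"
  have c': "zigzag ?c' d" by (rule zigzag_chain_map[OF E comm c])
  have lift_cycle: "singular_relcycle d L {} (chain_map d q (c d))"
  proof -
    have "d - 1 = m" using m by simp
    then show ?thesis using orbit_cycle_iff[OF d_pos cd] bd cm by metis
  qed
  have Nc: "singular_relcycle d SS {} (rot_norm d (c d))"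
    by (rule rot_norm_orbit_cycle[OF d_pos cd lift_cycle])
  then obtain l where l: "homologous_rel d SS {} (rot_norm d (c d)) (frag_cmul l sphere_cycle)"
    using generating_sphere_cycle unfolding generating_cycle_def by blast
  \<comment> \<open>The descent of the zigzag to its first entry shows that \<open>l\<close> is a unit modulo \<open>r\<close>.\<close>
  have "\<not> int r dvd l"
  proof
    assume "int r dvd l"
    then obtain l' where l': "l = int r * l'" by blast
    let ?y = "frag_cmul l' sphere_cycle"
    have y: "singular_relcycle d SS {} ?y" by (rule singular_relcycle_cmul[OF sphere_cycle(1)])
    have "homologous_rel d SS {} (rot_norm d ?y) (frag_cmul l sphere_cycle)"
      using rot_norm_cycle[OF y] by (simp add: l')
    then have "singular_relboundary d SS {} (rot_norm d (c d - ?y))"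
      using homologous_rel_diff[OF l] by (fastforce simp: homologous_rel_def N_diff)
    moreover have cy: "singular_chain d SS (c d - ?y)" by (rule singular_chain_frag_cmul_diff[OF cd sphere_cycle(2)])
    ultimately obtain u w where u: "singular_chain (Suc d) SS u" and w: "singular_chain d SS w"
      and "c d - ?y = chain_boundary (Suc d) u + rot_diff d w"
      using transfer_injective[OF cy] orbit_boundary_iff[OF cy] by blast
    then have "c d = ?y + chain_boundary (Suc d) u + rot_diff d w" by (simp add: algebra_simps)
    then have "\<exists>u\<in>singular_chain_set 1 SS. \<exists>w\<in>singular_chain_set 0 SS. c 0 = chain_boundary 1 u + rot_norm 0 w"
      using y u w c zigzag_descend[of c m ?y u w] m by (simp add: alt_m singular_cycle)
    then obtain u w where "singular_chain 1 SS u" "frag_of \<sigma> = chain_boundary 1 u + rot_norm 0 w"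
      using c0 by auto
    then have "augmentation (frag_of \<sigma>) = int r * augmentation w"
      using augmentation_boundary[of u] by (simp add: augmentation_add augmentation_rot_norm)
    moreover have "augmentation (frag_of \<sigma>) = 1" by (simp add: augmentation_def)
    ultimately have "int r dvd 1" by (metis dvd_triv_left)
    then show False using r by (auto dest: prime_gt_1_nat)
  qed
  \<comment> \<open>The comparison of the zigzag with its image computes the degree.\<close>
  have "\<exists>u\<in>singular_chain_set 1 SS. c 0 - ?c' 0 = chain_boundary 1 u"
    using point_chains_homologous[OF \<sigma> map[OF E]] by (simp add: c0)
  then obtain y e where y: "singular_chain d SS y" "chain_boundary d y = 0" and e: "singular_chain d SS e"
    and ye: "c d - ?c' d = y + rot_diff d e"
    using zigzag_compare[of c m ?c'] c c' acyclic m by (auto simp: alt_m)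
  have ycyc: "singular_relcycle d SS {} y" using y by (simp add: singular_cycle)
  then obtain j where j: "homologous_rel d SS {} y (frag_cmul j sphere_cycle)"
    using generating_sphere_cycle unfolding generating_cycle_def by blast
  let ?D = "sphere_degree n E"
  have "rot_norm d (c d) - chain_map d E (rot_norm d (c d)) = rot_norm d y"
    using chain_map_commutes_rot(2)[OF E comm cd] N_T[of e d] e arg_cong[OF ye, of "rot_norm d"]
    by (simp add: N_diff N_add)
  moreover have "homologous_rel d SS {} (rot_norm d y) (frag_cmul (int r * j) sphere_cycle)"
    using homologous_rel_trans[OF homologous_rel_cmul[OF j, of "int r"] rot_norm_cycle[OF ycyc]] by simp
  moreover have "homologous_rel d SS {} (rot_norm d (c d) - chain_map d E (rot_norm d (c d))) (frag_cmul (l - ?D * l) sphere_cycle)"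
    using homologous_rel_diff[OF l homologous_rel_trans[OF homologous_rel_cmul[OF l, of ?D] homologous_chain_map_sphere[OF n_pos E Nc]]]
    by (simp add: frag_cmul_diff_distrib)
  ultimately have "l - ?D * l = int r * j" using homologous_multiple_unique by metis
  then have "int r * (- j) = l * (?D - 1)" by (simp add: algebra_simps)
  then have "int r dvd l * (?D - 1)" by (metis dvd_triv_left)
  moreover have "prime (int r)" using r by simp
  ultimately show ?thesis using \<open>\<not> int r dvd l\<close> prime_dvd_mult_iff by blast
qed

section \<open>Self-maps of the lens space\<close>

lemma lift_on_star:
  assumes K: "compact K" and star: "star_about n a K" and f: "continuous_map SS L f"
  shows "\<exists>\<psi>. continuous_on K \<psi> \<and> \<psi> ` K \<subseteq> S \<and> (\<forall>x\<in>K. q (\<psi> x) = f x)"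
proof -
  obtain H where H: "continuous_on ({0..1::real} \<times> K) H" "H ` ({0..1} \<times> K) \<subseteq> K"
    "\<And>x. x \<in> K \<Longrightarrow> H (0, x) = a" "\<And>x. x \<in> K \<Longrightarrow> H (1, x) = x"
    using star_contraction[OF star] by blast
  have "a \<in> K" "K \<subseteq> S" using star by (auto simp: star_about_def)
  then show ?thesis
    using lift_of_contraction[OF K _ H] continuous_map_from_subtopology_mono[OF f] by blast
qed

text \<open>The map lifts on each of two opposite hemispheres, since they are contractible. On the equator, which
  is connected as \<open>n > 1\<close>, the two lifts differ by one rotation, and correcting one of them by this
  rotation makes them fit.\<close>

lemma lift_of_self_map:
  assumes n2: "1 < n" and g: "continuous_map L L g"
  obtains G where "continuous_map SS SS G" "\<And>z. z \<in> S \<Longrightarrow> q (G z) = g (q z)"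
proof -
  let ?P = "hemisphere n 0 1" and ?M = "hemisphere n 0 (- 1)"
  have gq: "continuous_map SS L (g \<circ> q)" by (rule continuous_map_compose[OF continuous_map_orbit g])
  have lift: "\<exists>\<psi>. continuous_on (hemisphere n 0 s) \<psi> \<and> \<psi> ` hemisphere n 0 s \<subseteq> S \<and>
      (\<forall>x\<in>hemisphere n 0 s. q (\<psi> x) = g (q x))" if "s = 1 \<or> s = - 1" for s
    using lift_on_star[OF compact_hemisphere star_hemisphere[OF n_pos that] gq] by simp
  obtain \<psi>P where P: "continuous_on ?P \<psi>P" "\<psi>P ` ?P \<subseteq> S" "\<And>x. x \<in> ?P \<Longrightarrow> q (\<psi>P x) = g (q x)"
    using lift[of 1] by auto
  obtain \<psi>M where M: "continuous_on ?M \<psi>M" "\<psi>M ` ?M \<subseteq> S" "\<And>x. x \<in> ?M \<Longrightarrow> q (\<psi>M x) = g (q x)"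
    using lift[of "- 1"] by auto
  have "\<exists>m<r. \<forall>x\<in>?P \<inter> ?M. \<psi>M x = (\<rho> ^^ m) (\<psi>P x)"
  proof (rule lifts_differ_by_rotation[OF connected_equator[OF n2]])
    show "continuous_on (?P \<inter> ?M) \<psi>P" by (rule continuous_on_subset[OF P(1)]) simp
    show "continuous_on (?P \<inter> ?M) \<psi>M" by (rule continuous_on_subset[OF M(1)]) simp
    show "q (\<psi>P x) = q (\<psi>M x)" if "x \<in> ?P \<inter> ?M" for x using P(3) M(3) that by simp
  qed (use P(2) M(2) in blast)+
  then obtain m where m: "m < r" "\<And>x. x \<in> ?P \<inter> ?M \<Longrightarrow> \<psi>M x = (\<rho> ^^ m) (\<psi>P x)" by blast
  define G where "G x = (if x \<in> ?P then \<psi>P x else (\<rho> ^^ (r - m)) (\<psi>M x))" for x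
  have "continuous_on (?P \<union> ?M) (\<lambda>x. if x \<in> ?P then \<psi>P x else (\<rho> ^^ (r - m)) (\<psi>M x))"
  proof (rule continuous_on_cases)
    show "closed ?P" "closed ?M" using compact_hemisphere compact_imp_closed by blast+
    show "continuous_on ?M (\<lambda>x. (\<rho> ^^ (r - m)) (\<psi>M x))"
      by (rule continuous_on_compose2[OF continuous_on_rot_power M(1,2)])
    show "\<forall>x. x \<in> ?P \<and> x \<notin> ?P \<or> x \<in> ?M \<and> x \<in> ?P \<longrightarrow> \<psi>P x = (\<rho> ^^ (r - m)) (\<psi>M x)"
    proof (intro allI impI)
      fix x assume "x \<in> ?P \<and> x \<notin> ?P \<or> x \<in> ?M \<and> x \<in> ?P"
      then have x: "x \<in> ?P \<inter> ?M" by blast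
      then have "\<psi>P x \<in> S" using P(2) by blast
      then show "\<psi>P x = (\<rho> ^^ (r - m)) (\<psi>M x)" using m(2)[OF x] rot_power_inverse[of "\<psi>P x" m] m(1) by simp
    qed
  qed (rule P(1))
  then have "continuous_on S G" unfolding sphere_eq_hemispheres G_def .
  moreover have PM: "x \<in> ?M" if "x \<in> S" "x \<notin> ?P" for x using that sphere_eq_hemispheres[of n] by blast
  have "G ` S \<subseteq> S"
    using P(2) M(2) PM rot_power_sphere by (auto simp: G_def image_subset_iff)
  ultimately have "continuous_map SS SS G" by (auto simp: continuous_map_in_subtopology)
  moreover have "q (G z) = g (q z)" if z: "z \<in> S" for z
  proof (cases "z \<in> ?P")
    case False
    then have "z \<in> ?M" using PM[OF z] by simp
    then have "\<psi>M z \<in> S" "q (\<psi>M z) = g (q z)" using M(2,3) by auto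
    then show ?thesis using False orbit_rot_power[of "\<psi>M z" "r - m"] by (simp add: G_def)
  qed (simp add: G_def P(3))
  ultimately show ?thesis using that by blast
qed

text \<open>The equivariance of a lift: \<open>b\<close> describes the endomorphism that the self-map of the lens space induces
  on the fundamental group.\<close>

definition twisted :: "nat \<Rightarrow> ((nat \<Rightarrow> complex) \<Rightarrow> nat \<Rightarrow> complex) \<Rightarrow> bool" where
  "twisted b G \<longleftrightarrow> continuous_map SS SS G \<and> (\<forall>z\<in>S. G (\<rho> z) = (\<rho> ^^ b) (G z))"

lemma twisted_sphere: "\<lbrakk>twisted b G; z \<in> S\<rbrakk> \<Longrightarrow> G z \<in> S"
  unfolding twisted_def by (auto simp: continuous_map_def)

lemma twisted_rot_power:
  assumes "twisted b G" "z \<in> S" shows "G ((\<rho> ^^ m) z) = (\<rho> ^^ (b * m)) (G z)"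
proof (induction m)
  case (Suc m)
  have "G ((\<rho> ^^ Suc m) z) = (\<rho> ^^ b) (G ((\<rho> ^^ m) z))"
    using assms rot_power_sphere[OF assms(2), of m] by (simp add: twisted_def)
  then show ?case using Suc funpow_add[of b "b * m" \<rho>] by simp
qed simp

lemma twisted_compose: "\<lbrakk>twisted b G; twisted c H\<rbrakk> \<Longrightarrow> twisted (b * c) (G \<circ> H)"
proof -
  assume G: "twisted b G" and H: "twisted c H"
  have "continuous_map SS SS (G \<circ> H)"
    using G H by (intro continuous_map_compose[of SS SS]) (simp_all add: twisted_def)
  moreover have "(G \<circ> H) (\<rho> z) = (\<rho> ^^ (b * c)) ((G \<circ> H) z)" if "z \<in> S" for z
    using H that twisted_rot_power[OF G twisted_sphere[OF H that], of c] by (simp add: twisted_def)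
  ultimately show ?thesis by (simp add: twisted_def)
qed

lemma twisted_funpow: "twisted b G \<Longrightarrow> twisted (b ^ m) (G ^^ m)"
proof (induction m)
  case 0
  then show ?case by (simp add: twisted_def id_def)
next
  case (Suc m)
  then show ?case unfolding funpow.simps(2) power_Suc by (intro twisted_compose) auto
qed

lemma twisted_cong: "\<lbrakk>twisted b G; [b = c] (mod r)\<rbrakk> \<Longrightarrow> twisted c G"
  using rot_power_eq_iff[OF twisted_sphere, of b G] unfolding twisted_def by metis

lemma lift_twisted:
  assumes G: "continuous_map SS SS G" and lift: "\<And>z. z \<in> S \<Longrightarrow> q (G z) = g (q z)"
  shows "\<exists>b. twisted b G"
proof -
  have c: "continuous_on S G" "G ` S \<subseteq> S" using G by (auto simp: continuous_map_in_subtopology)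
  have "continuous_on S (G \<circ> \<rho>)" "(G \<circ> \<rho>) ` S \<subseteq> S"
    using continuous_map_compose[OF continuous_map_rot G] by (auto simp: continuous_map_in_subtopology)
  moreover have "q (G z) = q ((G \<circ> \<rho>) z)" if "z \<in> S" for z
    using lift[OF that] lift[OF rot_sphere[OF that]] orbit_rot_power[OF that, of 1] by simp
  ultimately show ?thesis
    using lifts_differ_by_rotation[OF connected_sphere[OF n_pos] c, of "G \<circ> \<rho>"] G by (auto simp: twisted_def)
qed

text \<open>A lift of the identity is a rotation and commutes with rotations, so a lift of a map of
  order dividing \<open>m\<close> has a twist of order dividing \<open>m\<close>.\<close>

lemma twist_power_eq_1:
  assumes G: "twisted b G" and id: "\<And>z. z \<in> S \<Longrightarrow> q ((G ^^ m) z) = q z"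
  shows "[b ^ m = 1] (mod r)"
proof -
  have Gm: "twisted (b ^ m) (G ^^ m)" by (rule twisted_funpow[OF G])
  then have "continuous_on S (G ^^ m)" "(G ^^ m) ` S \<subseteq> S"
    by (auto simp: twisted_def continuous_map_in_subtopology)
  then obtain c where c: "\<And>z. z \<in> S \<Longrightarrow> (G ^^ m) z = (\<rho> ^^ c) z"
    using lifts_differ_by_rotation[OF connected_sphere[OF n_pos], of "\<lambda>z. z" "G ^^ m"] id by fastforce
  obtain x where x: "x \<in> S" using pole_sphere[OF n_pos, of 1] by auto
  have "(\<rho> ^^ c) (\<rho> x) = (\<rho> ^^ (b ^ m)) ((\<rho> ^^ c) x)"
    using Gm x c[OF x] c[OF rot_sphere[OF x]] by (simp add: twisted_def)
  then have "(\<rho> ^^ (c + 1)) x = (\<rho> ^^ (b ^ m + c)) x"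
    using funpow_add[of c 1 \<rho>] funpow_add[of "b ^ m" c \<rho>] by simp
  then have "[c + 1 = b ^ m + c] (mod r)" using rot_power_eq_iff[OF x] by blast
  then show ?thesis by (metis add.commute cong_add_lcancel_nat cong_sym)
qed

lemma funpow_lift:
  assumes G: "continuous_map SS SS G" and lift: "\<And>z. z \<in> S \<Longrightarrow> q (G z) = g (q z)" and z: "z \<in> S"
  shows "q ((G ^^ m) z) = (g ^^ m) (q z)"
proof -
  have "(G ^^ m) z \<in> S \<and> q ((G ^^ m) z) = (g ^^ m) (q z)"
    by (induction m) (use z lift G in \<open>auto simp: continuous_map_def\<close>)
  then show ?thesis ..
qed

end

text \<open>Extraction of square roots modulo a prime leaves only a sign to choose, and \<open>- 1\<close> is a power of \<open>a\<close>. So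
  a residue whose order divides \<open>2 ^ j\<close> is a power of \<open>a\<close>, with an exponent that loses one factor \<open>2\<close> in
  each extraction.\<close>

lemma power_of_square_if_power_eq_1:
  fixes p a x k j :: nat
  assumes p: "prime p" and a: "[int a ^ 2 ^ k = - 1] (mod int p)" and "j \<le> k" and "[x ^ 2 ^ j = 1] (mod p)"
  shows "\<exists>i. [x = a ^ (2 ^ (Suc k - j) * i)] (mod p)"
  using assms(3,4)
proof (induction j arbitrary: x)
  case 0
  then show ?case by (intro exI[of _ 0]) simp
next
  case (Suc j)
  have "[(x ^ 2) ^ 2 ^ j = 1] (mod p)" using Suc.prems(2) by (simp flip: power_mult)
  then obtain i where i: "[x ^ 2 = a ^ (2 ^ (Suc k - j) * i)] (mod p)" using Suc.IH Suc.prems(1) by fastforce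
  let ?y = "a ^ (2 ^ (Suc k - Suc j) * i)"
  have e: "(2::nat) ^ (Suc k - j) = 2 * 2 ^ (Suc k - Suc j)"
    using Suc.prems(1) by (simp add: Suc_diff_le)
  have "a ^ (2 ^ (Suc k - j) * i) = ?y ^ 2" unfolding e by (simp add: power_mult[symmetric] mult_ac)
  then have "[int x ^ 2 = int ?y ^ 2] (mod int p)" using i by (metis cong_int_iff of_nat_power)
  then have "int p dvd (int x - int ?y) * (int x + int ?y)"
    by (simp add: cong_iff_dvd_diff power2_eq_square algebra_simps)
  then consider "int p dvd int x - int ?y" | "int p dvd int x + int ?y"
    using p prime_dvd_mult_iff[of "int p"] by auto
  then show ?case
  proof cases
    case 1
    then have "[x = ?y] (mod p)" by (simp add: cong_iff_dvd_diff flip: cong_int_iff)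
    then show ?thesis by blast
  next
    case 2
    have "2 ^ k = (2::nat) ^ (Suc k - Suc j) * 2 ^ j" using Suc.prems(1) by (simp flip: power_add)
    then have ay: "a ^ (2 ^ (Suc k - Suc j) * (i + 2 ^ j)) = ?y * a ^ 2 ^ k"
      by (simp add: distrib_left power_add)
    have "[int ?y * int a ^ 2 ^ k = int ?y * - 1] (mod int p)" using a by (rule cong_scalar_left)
    moreover have "[int x = int ?y * - 1] (mod int p)" using 2 by (simp add: cong_iff_dvd_diff)
    ultimately have "[int x = int ?y * int a ^ 2 ^ k] (mod int p)"
      using cong_trans cong_sym by blast
    then have "[int x = int (a ^ (2 ^ (Suc k - Suc j) * (i + 2 ^ j)))] (mod int p)"
      unfolding ay by simp
    then show ?thesis unfolding cong_int_iff by blast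
  qed
qed

context lens_action
begin

text \<open>Replacing the lift of \<open>g\<close> by its power with the odd part of \<open>m\<close> as exponent keeps the degree \<open>-1\<close> and makes
  the order of the twist a divisor of \<open>2 ^ k\<close>. Then an even power of \<open>F\<close> cancels the twist and
  leaves the degree unchanged, which contradicts the congruence for equivariant maps.\<close>

lemma no_degree_minus_one_self_map_of_small_order:
  fixes k a :: nat
  assumes r: "prime r" "odd r" and n2: "1 < n"
    and F: "twisted a F" "sphere_degree n F = - 1" and a: "[int a ^ 2 ^ k = - 1] (mod int r)"
    and g: "has_degree d L g (- 1)" and gm: "has_order L g m"
  shows "2 ^ Suc k \<le> m"
proof (rule ccontr)
  assume "\<not> 2 ^ Suc k \<le> m"
  then have m: "m < 2 ^ Suc k" "m > 0" using gm by (auto simp: has_order_def)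
  obtain t where t: "m = 2 ^ multiplicity 2 m * t" "\<not> 2 dvd t"
    using multiplicity_decompose'[of m 2] m(2) by auto
  define j where "j = multiplicity 2 m"
  have mj: "m = 2 ^ j * t" and "odd t" using t by (auto simp: j_def)
  have "2 ^ j \<le> m" using m(2) mj by (metis dvd_imp_le dvd_triv_left)
  then have "(2::nat) ^ j < 2 ^ Suc k" using m(1) by simp
  then have "j < Suc k" by (rule power_less_imp_less_exp[rotated]) simp
  then have jk: "j \<le> k" by simp
  obtain a0 where cont: "continuous_map L L g" and a0: "fundamental_class d L a0"
    "hom_induced (int d) L {} L {} g a0 = a0 [^]\<^bsub>homology_group (int d) L\<^esub> (- 1 :: int)"
    using g by (auto simp: has_degree_def)
  obtain G where G: "continuous_map SS SS G" "\<And>z. z \<in> S \<Longrightarrow> q (G z) = g (q z)"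
    using lift_of_self_map[OF n2 cont] by blast
  have degG: "sphere_degree n G = - 1"
    by (rule degree_of_lift[OF cont G(1) _ a0]) (simp add: G(2))
  obtain b where b: "twisted b G" using lift_twisted[OF G] by blast
  have "q ((G ^^ m) z) = q z" if "z \<in> S" for z
    using funpow_lift[OF G that, of m] gm that by (simp add: has_order_def topspace_lens)
  then have bm: "[b ^ m = 1] (mod r)" by (rule twist_power_eq_1[OF b])
  define x where "x = b ^ t"
  have x: "[x ^ 2 ^ j = 1] (mod r)" using bm by (simp add: x_def mj mult.commute flip: power_mult)
  \<comment> \<open>The inverse of \<open>x\<close> modulo \<open>r\<close>, to be realized as an even power of \<open>a\<close>.\<close>
  define y where "y = x ^ (2 ^ j - 1)"
  have xy: "x * y = x ^ 2 ^ j" by (simp add: y_def flip: power_Suc)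
  have "[(x ^ 2 ^ j) ^ (2 ^ j - 1) = 1 ^ (2 ^ j - 1)] (mod r)" using x by (rule cong_pow)
  then have "[y ^ 2 ^ j = 1] (mod r)" by (simp add: y_def mult.commute flip: power_mult)
  then obtain i where i: "[y = a ^ (2 ^ (Suc k - j) * i)] (mod r)"
    using power_of_square_if_power_eq_1[OF r(1) a jk] by blast
  define s where "s = 2 ^ (k - j) * i"
  have s: "2 ^ (Suc k - j) * i = 2 * s" using jk by (simp add: s_def Suc_diff_le)
  have Gt: "twisted x (G ^^ t)" unfolding x_def by (rule twisted_funpow[OF b])
  have Fs: "twisted (a ^ (2 * s)) (F ^^ (2 * s))" by (rule twisted_funpow[OF F(1)])
  have "[x * a ^ (2 * s) = 1] (mod r)"
    using cong_trans[OF cong_scalar_left[OF cong_sym[OF i], of x]] x by (simp add: xy s)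
  then have E: "twisted 1 (G ^^ t \<circ> F ^^ (2 * s))"
    using twisted_cong[OF twisted_compose[OF Gt Fs]] by simp
  have contF: "continuous_map SS SS F" using F(1) by (simp add: twisted_def)
  have "sphere_degree n (G ^^ t \<circ> F ^^ (2 * s)) = (- 1) ^ t * (- 1) ^ (2 * s)"
    using sphere_degree_compose[OF n_pos, of "F ^^ (2 * s)" "G ^^ t"] sphere_degree_funpow[OF n_pos G(1), of t]
      sphere_degree_funpow[OF n_pos contF, of "2 * s"] degG F(2) by simp
  then have "sphere_degree n (G ^^ t \<circ> F ^^ (2 * s)) = - 1" using \<open>odd t\<close> by simp
  moreover have "int r dvd sphere_degree n (G ^^ t \<circ> F ^^ (2 * s)) - 1"
    by (rule degree_of_equivariant_map[OF r(1)]) (use E in \<open>auto simp: twisted_def\<close>)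
  ultimately have "int r dvd 2" by (simp add: dvd_minus_iff[of "int r" 2, symmetric] del: dvd_minus_iff)
  then have "r dvd 2" by (metis int_dvd_int_iff of_nat_numeral)
  then have "r \<le> 2" by (rule dvd_imp_le) simp
  then show False using r prime_gt_1_nat[OF r(1)] by (cases "r = 2") auto
qed

end

section \<open>Smooth self-maps of lens spaces covered by coordinate maps\<close>

lemma C_k_const: "C_k k n U (\<lambda>_. c)"
proof (induction k arbitrary: c)
  case (Suc k)
  then show ?case by (auto intro!: exI[of _ "\<lambda>_. 0"] continuous_intros derivative_eq_intros)
qed (simp add: continuous_on_const)

lemma C_k_coordinate: "C_k k n U (\<lambda>w. w i)"
proof (cases k)
  case (Suc k')
  have "\<exists>g. C_k k' n U g \<and> (\<forall>z\<in>U. ((\<lambda>t::real. (z(j := z j + of_real t * e)) i) has_vector_derivative g z) (at 0))"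
    for j and e :: complex
    by (cases "i = j")
      (auto intro!: exI[of _ "\<lambda>_. if i = j then e else 0"] C_k_const derivative_eq_intros
        simp: has_vector_derivative_def scaleR_conv_of_real)
  then show ?thesis by (simp add: Suc continuous_on_coordinate del: fun_upd_apply)
qed (simp add: continuous_on_coordinate)

lemma C_k_cnj_coordinate: "C_k k n U (\<lambda>w. cnj (w i))"
proof (cases k)
  case (Suc k')
  have "\<exists>g. C_k k' n U g \<and> (\<forall>z\<in>U. ((\<lambda>t::real. cnj ((z(j := z j + of_real t * e)) i)) has_vector_derivative g z) (at 0))"
    for j and e :: complex
    by (cases "i = j")
      (auto intro!: exI[of _ "\<lambda>_. if i = j then cnj e else 0"] C_k_const derivative_eq_intros
        simp: has_vector_derivative_def scaleR_conv_of_real)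
  then show ?thesis
    by (auto simp: Suc simp del: fun_upd_apply intro!: continuous_intros)
qed (auto intro!: continuous_intros)

text \<open>A class of smooth maps that contains the permutations and conjugations of coordinates and is closed
  under composition, so that smoothness of iterates needs no chain rule.\<close>

definition coordinate_map :: "((nat \<Rightarrow> complex) \<Rightarrow> nat \<Rightarrow> complex) \<Rightarrow> bool" where
  "coordinate_map G \<longleftrightarrow> (\<forall>j. \<exists>i. (\<forall>w. G w j = w i) \<or> (\<forall>w. G w j = cnj (w i)))"

lemma coordinate_map_compose:
  assumes G: "coordinate_map G" and H: "coordinate_map H"
  shows "coordinate_map (G \<circ> H)"
  unfolding coordinate_map_def
proof
  fix j
  obtain i where i: "(\<forall>w. G w j = w i) \<or> (\<forall>w. G w j = cnj (w i))"
    using G unfolding coordinate_map_def by blast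
  obtain l where l: "(\<forall>w. H w i = w l) \<or> (\<forall>w. H w i = cnj (w l))"
    using H unfolding coordinate_map_def by blast
  have "(\<forall>w. (G \<circ> H) w j = w l) \<or> (\<forall>w. (G \<circ> H) w j = cnj (w l))"
    using i l by auto
  then show "\<exists>i. (\<forall>w. (G \<circ> H) w j = w i) \<or> (\<forall>w. (G \<circ> H) w j = cnj (w i))" ..
qed

lemma coordinate_map_id: "coordinate_map id"
  by (auto simp: coordinate_map_def)

lemma coordinate_map_funpow: "coordinate_map G \<Longrightarrow> coordinate_map (G ^^ m)"
proof (induction m)
  case 0
  then show ?case using coordinate_map_id by (simp add: id_def)
next
  case (Suc m)
  then show ?case unfolding funpow.simps(2) by (intro coordinate_map_compose) auto
qed

lemma smooth_coordinate_map:
  assumes "coordinate_map G" "A \<subseteq> complex_space n"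
  shows "smooth_on_subset n A G"
proof -
  have "C_k k n (complex_space n) (\<lambda>w. G w j)" for j k
  proof -
    obtain i where "(\<forall>w. G w j = w i) \<or> (\<forall>w. G w j = cnj (w i))"
      using assms(1) unfolding coordinate_map_def by blast
    then show ?thesis by (auto simp: C_k_coordinate C_k_cnj_coordinate)
  qed
  then show ?thesis
    unfolding smooth_on_subset_def using assms(2)
    by (intro ballI exI[of _ "complex_space n"] exI[of _ G]) auto
qed

context lens_action
begin

text \<open>The map of the lens space covered by \<open>G\<close>. The choice of the point does not matter when \<open>G\<close> is
  \<open>twisted\<close> (see \<open>descend_orbit\<close>).\<close>

definition descend :: "((nat \<Rightarrow> complex) \<Rightarrow> nat \<Rightarrow> complex) \<Rightarrow> (nat \<Rightarrow> complex) set \<Rightarrow> (nat \<Rightarrow> complex) set" where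
  "descend G A = q (G (SOME z. z \<in> A))"

lemma descend_orbit:
  assumes G: "twisted b G" and z: "z \<in> S"
  shows "descend G (q z) = q (G z)"
proof -
  have "(SOME w. w \<in> q z) \<in> q z" using orbit_self[of z] by (rule someI[of "\<lambda>w. w \<in> q z"])
  then obtain m where "(SOME w. w \<in> q z) = (\<rho> ^^ m) z" by (auto simp: orbit_iff)
  then show ?thesis
    using twisted_rot_power[OF G z] orbit_rot_power[OF twisted_sphere[OF G z]] by (simp add: descend_def)
qed

lemma continuous_map_descend:
  assumes G: "twisted b G" shows "continuous_map L L (descend G)"
proof (rule continuous_compose_quotient_map[OF quotient_map_orbit])
  have "continuous_map SS L (q \<circ> G)"
    using G by (intro continuous_map_compose[OF _ continuous_map_orbit]) (simp add: twisted_def)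
  then show "continuous_map SS L (descend G \<circ> q)"
    by (rule continuous_map_eq) (simp add: descend_orbit[OF G])
qed

lemma lens_smooth_map_descend:
  assumes G: "twisted b G" and "coordinate_map G"
  shows "lens_smooth_map r ks (descend G)"
  unfolding lens_smooth_map_def Let_def
proof
  fix z assume "z \<in> S"
  have "smooth_on_subset n S G"
    by (rule smooth_coordinate_map[OF assms(2)]) (auto simp: complex_sphere_def)
  then show "\<exists>U F. openin SS U \<and> z \<in> U \<and> F ` U \<subseteq> S \<and> smooth_on_subset n U F \<and>
      (\<forall>w\<in>U. descend G (q w) = q (F w))"
    using \<open>z \<in> S\<close> descend_orbit[OF G] twisted_sphere[OF G] by (intro exI[of _ S] exI[of _ G]) auto
qed

lemma descend_inverse:
  assumes G: "twisted b G" and H: "twisted c H" and inv: "\<And>z. z \<in> S \<Longrightarrow> H (G z) = z" and A: "A \<in> topspace L"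
  shows "descend H (descend G A) = A"
proof -
  obtain z where z: "z \<in> S" "A = q z" using A by (auto simp: topspace_lens)
  then show ?thesis using descend_orbit[OF G z(1)] descend_orbit[OF H twisted_sphere[OF G z(1)]] inv by simp
qed

lemma orientation_reversing_descend:
  assumes G: "twisted b G" and hm: "homeomorphic_map L L (descend G)" and deg: "sphere_degree n G = - 1"
  shows "orientation_reversing d L (descend G)"
proof -
  let ?H = "homology_group (int d) L" and ?f = "hom_induced (int d) L {} L {} (descend G)"
  obtain a where a: "fundamental_class d L a" using ex_fundamental_class_lens by blast
  then have aH: "a \<in> carrier ?H" and iso: "(\<lambda>m::int. a [^]\<^bsub>?H\<^esub> m) \<in> iso integer_group ?H"
    by (auto simp: fundamental_class_def)
  have "?f a \<in> carrier ?H" by (rule hom_induced_carrier)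
  then obtain e :: int where e: "?f a = a [^]\<^bsub>?H\<^esub> e"
    using iso by (auto simp: iso_def bij_betw_def image_iff)
  have contG: "continuous_map SS SS G" using G by (simp add: twisted_def)
  have "sphere_degree n G = e"
    by (rule degree_of_lift[OF continuous_map_descend[OF G] contG descend_orbit[OF G] a e])
  then have "?f a = inv\<^bsub>?H\<^esub> a"
    using e deg aH group.int_pow_neg[OF group_relative_homology_group, of a _ _ _ 1]
      group.int_pow_1[OF group_relative_homology_group aH] by simp
  then show ?thesis using hm a unfolding orientation_reversing_def by blast
qed

text \<open>Homology detects the dimension: it is infinite cyclic in the top degree and vanishes above.\<close>

lemma not_homeomorphic_lens_longer:
  assumes "lens_parameters r' ks'" "length ks < length ks'"
  shows "\<not> L homeomorphic_space lens_space r' ks'"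
proof
  interpret L': lens_action r' ks' by unfold_locales (rule assms(1))
  assume hs: "L homeomorphic_space lens_space r' ks'"
  have "trivial_group (homology_group (int L'.d) L)"
    using assms(2) n_pos by (intro trivial_homology_lens_above) linarith
  then have triv: "trivial_group (homology_group (int L'.d) L'.L)"
    using isomorphic_group_triviality[OF homeomorphic_space_imp_isomorphic_homology_groups[OF hs]] by simp
  obtain a where "fundamental_class L'.d L'.L a" using L'.ex_fundamental_class_lens by blast
  then have "integer_group \<cong> homology_group (int L'.d) L'.L"
    unfolding fundamental_class_def is_iso_def by blast
  then show False using triv isomorphic_group_triviality by fastforce
qed

end

section \<open>The lens spaces with weights \<open>1, 2, 4, \<dots>\<close>\<close>

text \<open>The square of \<open>- 1\<close> is \<open>1\<close>, and \<open>- 1\<close> itself differs from \<open>1\<close> modulo an odd prime.\<close>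

lemma ord_2_if_power_minus_1:
  assumes "prime p" "odd p" "[int 2 ^ 2 ^ k = - 1] (mod int p)"
  shows "ord p 2 = 2 ^ Suc k"
proof -
  have "[(2::int) ^ 2 ^ Suc k = 1] (mod int p)"
  proof -
    have "[(int 2 ^ 2 ^ k) ^ 2 = (- 1) ^ 2] (mod int p)" using assms(3) by (rule cong_pow)
    then show ?thesis by (simp add: mult.commute flip: power_mult)
  qed
  then have "[2 ^ 2 ^ Suc k = 1] (mod p)"
    by (metis cong_int_iff of_nat_1 of_nat_numeral of_nat_power)
  then have "ord p 2 dvd 2 ^ Suc k" by (simp only: ord_divides)
  then obtain i where i: "i \<le> Suc k" "ord p 2 = 2 ^ i"
    using divides_primepow_nat[of 2 "ord p 2" "Suc k"] by auto
  have "\<not> i \<le> k"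
  proof
    assume "i \<le> k"
    then have "ord p 2 dvd 2 ^ k" by (simp add: i(2) le_imp_power_dvd)
    then have "[2 ^ 2 ^ k = 1] (mod p)" by (simp only: ord_divides)
    then have "[int 2 ^ 2 ^ k = 1] (mod int p)" by (metis cong_int_iff of_nat_1 of_nat_power)
    then have "[- 1 = (1::int)] (mod int p)" using assms(3) cong_sym cong_trans by blast
    then have "int p dvd 2" by (simp add: cong_iff_dvd_diff)
    then have "p dvd 2" by presburger
    then have "p \<le> 2" by (rule dvd_imp_le) simp
    then show False using assms(1,2) prime_gt_1_nat[OF assms(1)] by (cases "p = 2") auto
  qed
  then show ?thesis using i by (simp add: le_Suc_eq)
qed

text \<open>Here \<open>k\<close> is one less than the exponent of the order \<open>2 ^ Suc k\<close>, and \<open>1 < m\<close> makes the sphere simply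
  connected even for \<open>k = 0\<close>.\<close>

locale doubling_lens = lens_action r ks for r ks +
  fixes k m :: nat
  assumes prime: "prime r" and minus_1: "[int 2 ^ 2 ^ k = - 1] (mod int r)"
    and weights: "ks = map (\<lambda>j. 2 ^ j) [0..<2 ^ k * m]" and m: "odd m" "1 < m"
begin

lemma n_eq: "n = 2 ^ k * m"
  by (simp add: weights)

lemma n_gt_1: "1 < n"
  using m(2) unfolding n_eq by (rule less_le_trans) simp

lemma odd_r: "odd r"
proof
  assume "even r"
  then have "r = 2" using prime by (metis primes_dvd_imp_eq two_is_prime_nat)
  then have "even (2 ^ 2 ^ k + 1 :: int)" using minus_1 by (simp add: cong_iff_dvd_diff)
  then show False by simp
qed

lemma r_dvd: "r dvd 2 ^ n + 1"
proof -
  have "[(int 2 ^ 2 ^ k) ^ m = (- 1) ^ m] (mod int r)" using minus_1 by (rule cong_pow)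
  then have "[2 ^ n = - 1] (mod int r)" using m(1) by (simp add: n_eq flip: power_mult)
  then have "int r dvd int (2 ^ n + 1)" by (simp add: cong_iff_dvd_diff add.commute)
  then show ?thesis by (simp only: int_dvd_int_iff)
qed

lemma \<omega>_Suc: "Suc j < n \<Longrightarrow> \<omega> (Suc j) = \<omega> j ^ 2"
proof -
  assume j: "Suc j < n"
  then have "\<omega> (Suc j) = exp (of_nat 2 * (2 * pi * \<i> * of_int (ks ! j) / of_nat r))"
    unfolding \<omega>_def by (simp add: weights field_simps)
  then show ?thesis unfolding \<omega>_def exp_of_nat_mult .
qed

lemma \<omega>_eq: "j < n \<Longrightarrow> \<omega> j = \<omega> 0 ^ 2 ^ j"
  by (induction j) (simp_all add: \<omega>_Suc mult.commute flip: power_mult)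

lemma \<omega>_last: "\<omega> (n - 1) ^ 2 = cnj (\<omega> 0)"
proof -
  have "n - 1 < n" "Suc (n - 1) = n" using n_pos by linarith+
  then have "\<omega> (n - 1) ^ 2 = \<omega> 0 ^ 2 ^ n" using \<omega>_eq[of "n - 1"] by (metis mult.commute power_Suc power_mult)
  moreover have "\<omega> 0 ^ (2 ^ n + 1) = 1" unfolding \<omega>_power_eq_1_iff[OF n_pos] by (rule r_dvd)
  moreover have "cnj (\<omega> 0) * \<omega> 0 = 1" by (simp add: complex_norm_square[symmetric] mult.commute)
  moreover have "\<omega> 0 \<noteq> 0" by (simp add: \<omega>_def)
  ultimately show ?thesis by (metis mult_right_cancel power_add power_one_right)
qed

definition shift :: "nat \<Rightarrow> nat" where
  "shift j = (if j < n then if Suc j = n then 0 else Suc j else j)"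

lemma shift_permutes: "shift permutes {..<n}"
proof (rule bij_imp_permutes)
  show "bij_betw shift {..<n} {..<n}"
    by (rule bij_betw_byWitness[where f' = "\<lambda>j. if j = 0 then n - 1 else j - 1"])
      (use n_pos in \<open>auto simp: shift_def\<close>)
qed (simp add: shift_def)

definition F :: "(nat \<Rightarrow> complex) \<Rightarrow> nat \<Rightarrow> complex" where
  "F z = conjugate_first z \<circ> shift"

lemma F_apply: "F z j = (if j < n then if Suc j = n then cnj (z 0) else z (Suc j) else z j)"
  using n_pos by (auto simp: F_def shift_def conjugate_first_def)

lemma continuous_map_conjugate_first: "continuous_map SS SS conjugate_first"
proof -
  have "continuous_on S conjugate_first"
  proof (rule continuous_on_coordinatewise_then_product)
    fix j show "continuous_on S (\<lambda>z. conjugate_first z j)"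
      by (cases "j = 0") (auto simp: conjugate_first_def intro!: continuous_intros)
  qed
  then show ?thesis
    using fun_upd_sphere[OF n_pos] by (auto simp: continuous_map_in_subtopology conjugate_first_def)
qed

lemma sphere_degree_F: "sphere_degree n F = - 1" and continuous_map_F: "continuous_map SS SS F"
proof -
  have F: "F = (\<lambda>z. z \<circ> shift) \<circ> conjugate_first" by (simp add: F_def fun_eq_iff)
  note c = continuous_map_conjugate_first continuous_map_permute[OF n_pos shift_permutes]
  show "sphere_degree n F = - 1"
    unfolding F using sphere_degree_compose[OF n_pos c] sphere_degree_conjugate_first[OF n_pos]
      sphere_degree_permute[OF n_pos shift_permutes] by simp
  show "continuous_map SS SS F" unfolding F by (rule continuous_map_compose[OF c])
qed

text \<open>The shift meets the weights in doubled form. At the last place it does so because of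
  \<open>\<omega>_last\<close>, where conjugation provides the sign in \<open>2 ^ n = - 1\<close> modulo \<open>r\<close>.\<close>

lemma twisted_F: "twisted 2 F"
  unfolding twisted_def
proof (intro conjI ballI continuous_map_F)
  fix z assume z: "z \<in> S"
  have Fz: "F z \<in> complex_space n" using continuous_map_F z sphere_space by (auto simp: continuous_map_def)
  show "F (\<rho> z) = (\<rho> ^^ 2) (F z)"
  proof
    fix j
    consider "n \<le> j" | "Suc j = n" | "Suc j < n" by linarith
    then show "F (\<rho> z) j = (\<rho> ^^ 2) (F z) j"
    proof cases
      case 1
      then show ?thesis by (simp add: rot_power[OF Fz] F_apply rot_eq)
    next
      case 2
      then have "\<omega> j ^ 2 = cnj (\<omega> 0)" using \<omega>_last by (metis diff_Suc_1)
      then show ?thesis using 2 n_pos by (simp add: rot_power[OF Fz] F_apply rot_eq)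
    next
      case 3
      then show ?thesis by (simp add: rot_power[OF Fz] F_apply rot_eq \<omega>_Suc)
    qed
  qed
qed

lemma coordinate_map_F: "coordinate_map F"
  unfolding coordinate_map_def F_apply by (metis (mono_tags))

text \<open>The first \<open>n\<close> iterates shift the coordinates around, and a coordinate is conjugated when it passes
  from the first place to the last. After \<open>n\<close> steps each one has been conjugated once.\<close>

lemma F_power:
  "i \<le> n \<Longrightarrow> (F ^^ i) z j = (if j < n then if j + i < n then z (j + i) else cnj (z (j + i - n)) else z j)"
proof (induction i arbitrary: j)
  case (Suc i)
  have "(F ^^ Suc i) z j = F ((F ^^ i) z) j" by simp
  moreover have "Suc (j + i) - n = i" if "Suc j = n" using that by linarith
  ultimately show ?case using Suc by (auto simp: F_apply Suc_diff_le not_less)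
qed simp

lemma F_power_id: "(F ^^ (2 * n)) z = z"
proof
  fix j
  have "(F ^^ (2 * n)) z = (F ^^ n) ((F ^^ n) z)" by (simp add: mult_2 funpow_add)
  then show "(F ^^ (2 * n)) z j = z j" by (simp add: F_power)
qed

text \<open>The odd power \<open>F ^^ m\<close> still has degree \<open>-1\<close>, and its order is the 2-part of the order of \<open>F\<close>.\<close>

lemma orientation_reversing_diffeomorphism_of_order:
  "\<exists>f. lens_diffeomorphism r ks f \<and> orientation_reversing d L f \<and> has_order L f (2 ^ Suc k)"
proof (intro exI conjI)
  \<comment> \<open>The exponents of \<open>?G\<close> and \<open>?H\<close> add up to \<open>2 * n\<close>.\<close>
  let ?G = "F ^^ m" and ?H = "F ^^ (m * (2 ^ Suc k - 1))"
  let ?f = "descend ?G" and ?g = "descend ?H"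
  have G: "twisted (2 ^ m) ?G" and H: "twisted (2 ^ (m * (2 ^ Suc k - 1))) ?H"
    by (rule twisted_funpow[OF twisted_F])+
  have mn: "m * 2 ^ Suc k = 2 * n" by (simp add: n_eq)
  have "m * (2 ^ Suc k - 1) + m = m * 2 ^ Suc k" by (simp add: algebra_simps del: power_Suc)
  then have GH: "?H (?G z) = z" "?G (?H z) = z" for z
    using F_power_id funpow_add[of "m * (2 ^ Suc k - 1)" m F, THEN fun_cong, of z]
      funpow_add[of m "m * (2 ^ Suc k - 1)" F, THEN fun_cong, of z]
    unfolding mn by (simp_all only: add.commute o_apply)
  have maps: "homeomorphic_maps L L ?f ?g"
    unfolding homeomorphic_maps_def
    using continuous_map_descend[OF G] continuous_map_descend[OF H] descend_inverse[OF G H] descend_inverse[OF H G] GH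
    by simp
  show "lens_diffeomorphism r ks ?f"
    unfolding lens_diffeomorphism_def
    using maps lens_smooth_map_descend[OF G] lens_smooth_map_descend[OF H] coordinate_map_funpow[OF coordinate_map_F]
    by blast
  have "sphere_degree n ?G = - 1"
    using sphere_degree_funpow[OF n_pos continuous_map_F, of m] m(1) by (simp add: sphere_degree_F)
  then show "orientation_reversing d L ?f"
    using orientation_reversing_descend[OF G] maps homeomorphic_map_maps by blast
  have contG: "continuous_map SS SS ?G" using G by (simp add: twisted_def)
  have lift: "q (?G z) = ?f (q z)" if "z \<in> S" for z using descend_orbit[OF G that] by simp
  have pow: "(?f ^^ l) (q z) = q ((?G ^^ l) z)" if "z \<in> S" for l z
    using funpow_lift[OF contG lift that] by simp
  have "2 ^ Suc k \<le> l" if "0 < l" and l: "\<And>x. x \<in> topspace L \<Longrightarrow> (?f ^^ l) x = x" for l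
  proof -
    have "q ((?G ^^ l) z) = q z" if "z \<in> S" for z
      using pow[OF that, of l] l[of "q z"] that by (simp add: topspace_lens)
    then have "[(2 ^ m) ^ l = 1] (mod r)" by (rule twist_power_eq_1[OF G])
    then have "[2 ^ (m * l) = 1] (mod r)" by (simp only: power_mult)
    then have "ord r 2 dvd m * l" by (simp only: ord_divides)
    then have "2 ^ Suc k dvd m * l" using ord_2_if_power_minus_1[OF prime odd_r minus_1] by simp
    moreover have "coprime (2 ^ Suc k) m" using m(1) by (simp add: coprime_power_left_iff)
    ultimately have "2 ^ Suc k dvd l" using coprime_dvd_mult_right_iff by blast
    then show ?thesis using that(1) by (rule dvd_imp_le)
  qed
  moreover have "(?f ^^ (2 ^ Suc k)) x = x" if x: "x \<in> topspace L" for x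
  proof -
    obtain z where z: "z \<in> S" "x = q z" using x by (auto simp: topspace_lens)
    have "?G ^^ (2 ^ Suc k) = F ^^ (2 * n)"
      unfolding mn[symmetric] by (simp only: funpow_mult mult.commute)
    then have "(?G ^^ (2 ^ Suc k)) z = z" by (simp only: F_power_id)
    then show ?thesis using pow[OF z(1), of "2 ^ Suc k"] z(2) by simp
  qed
  ultimately show "has_order L ?f (2 ^ Suc k)"
    unfolding has_order_def by (metis not_less zero_less_power zero_less_numeral)
qed

lemma no_self_map_of_smaller_order:
  assumes "has_degree d L g (- 1)" "has_order L g l"
  shows "2 ^ Suc k \<le> l"
  using no_degree_minus_one_self_map_of_small_order[OF prime odd_r n_gt_1 twisted_F sphere_degree_F minus_1 assms] .

end

theorem theoremC:
  fixes k :: nat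
  assumes "k > 0"
  shows "\<exists>P :: (nat \<times> int list) set. infinite P \<and>
    (\<forall>(r, ks)\<in>P. lens_parameters r ks) \<and>
    pairwise (\<lambda>(r, ks) (r', ks'). \<not> lens_space r ks homeomorphic_space lens_space r' ks') P \<and>
    (\<forall>(r, ks)\<in>P.
       (\<exists>f. lens_diffeomorphism r ks f \<and>
            orientation_reversing (2 * length ks - 1) (lens_space r ks) f \<and>
            has_order (lens_space r ks) f (2 ^ k)) \<and>
       \<not> (\<exists>g m. has_degree (2 * length ks - 1) (lens_space r ks) g (-1) \<and>
            has_order (lens_space r ks) g m \<and> m < 2 ^ k))"
proof -
  obtain k' where k: "k = Suc k'" using assms gr0_implies_Suc by blast
  have "(2::nat) ^ 2 ^ k' + 1 \<noteq> 1" by simp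
  then obtain r where r: "prime r" "r dvd (2::nat) ^ 2 ^ k' + 1" using prime_factor_nat by blast
  have minus_1: "[int 2 ^ 2 ^ k' = - 1] (mod int r)"
  proof -
    have "int r dvd int (2 ^ 2 ^ k' + 1)" using r(2) by (simp only: int_dvd_int_iff)
    then show ?thesis by (simp add: cong_iff_dvd_diff add.commute)
  qed
  have odd_r: "odd r"
  proof
    assume "even r"
    then have "even (2 ^ 2 ^ k' + 1 :: nat)" using r(2) by (rule dvd_trans)
    then show False by simp
  qed
  define weights :: "nat \<Rightarrow> int list" where "weights m = map (\<lambda>j. 2 ^ j) [0..<2 ^ k' * m]" for m
  define M where "M = {m::nat. odd m \<and> 1 < m}"
  define P where "P = (\<lambda>m. (r, weights m)) ` M"
  have valid: "lens_parameters r (weights m)" if "m \<in> M" for m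
  proof -
    have "0 < 2 ^ k' * m" using that by (simp add: M_def)
    moreover have "coprime ((2::int) ^ j) (int r)" for j using odd_r by simp
    ultimately show ?thesis using r(1) prime_gt_0_nat by (auto simp: lens_parameters_def weights_def)
  qed
  have lens: "doubling_lens r (weights m) k' m" if "m \<in> M" for m
    by unfold_locales (use valid[OF that] r(1) minus_1 that in \<open>auto simp: weights_def M_def\<close>)
  have "infinite M"
  proof -
    have "(\<lambda>i. 2 * i + 3) ` UNIV \<subseteq> M" by (auto simp: M_def)
    moreover have "infinite (range (\<lambda>i::nat. 2 * i + 3))" by (intro range_inj_infinite injI) simp
    ultimately show ?thesis using finite_subset by blast
  qed
  moreover have "inj_on (\<lambda>m. (r, weights m)) M"
    by (rule inj_onI) (auto simp: weights_def dest!: arg_cong[of _ _ length])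
  ultimately have "infinite P" unfolding P_def by (simp add: finite_image_iff)
  moreover have "\<not> lens_space r (weights m) homeomorphic_space lens_space r (weights m')"
    if mm: "m \<in> M" "m' \<in> M" "m \<noteq> m'" for m m'
  proof -
    have *: "\<not> lens_space r (weights a) homeomorphic_space lens_space r (weights b)"
      if "a \<in> M" "b \<in> M" "a < b" for a b
    proof -
      interpret lens_action r "weights a" using valid[OF that(1)] by unfold_locales
      show ?thesis using not_homeomorphic_lens_longer[OF valid[OF that(2)]] that(3) by (simp add: weights_def)
    qed
    show ?thesis using *[of m m'] *[of m' m] mm homeomorphic_space_sym by (metis nat_neq_iff)
  qed
  then have "pairwise (\<lambda>(r, ks) (r', ks'). \<not> lens_space r ks homeomorphic_space lens_space r' ks') P"
    unfolding pairwise_def P_def by auto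
  moreover have "(\<exists>f. lens_diffeomorphism r (weights m) f \<and>
            orientation_reversing (2 * length (weights m) - 1) (lens_space r (weights m)) f \<and>
            has_order (lens_space r (weights m)) f (2 ^ k)) \<and>
       \<not> (\<exists>g l. has_degree (2 * length (weights m) - 1) (lens_space r (weights m)) g (-1) \<and>
            has_order (lens_space r (weights m)) g l \<and> l < 2 ^ k)" if "m \<in> M" for m
  proof -
    interpret doubling_lens r "weights m" k' m by (rule lens[OF that])
    show ?thesis
      using orientation_reversing_diffeomorphism_of_order no_self_map_of_smaller_order unfolding k
      by (meson not_le)
  qed
  ultimately show ?thesis
    using valid by (intro exI[of _ P]) (auto simp: P_def)
qed

end
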